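(* Let $n\ge 2$, let $\mathcal{O}\in\mathbb{S}^n$, let $\Sigma\subset\mathbb{S}^n$ be a convex open cone with vertex $\mathcal{O}$, and let $0<R<R_1<\pi/2$. Let $\Omega=\Omega_1\setminus\overline{\Omega}_2$ be an annular sector-like domain in $\Sigma$, contained in $\mathbb{S}^n_+$, with $\Omega_2=B_R(\mathcal{O})\cap\Sigma$ (so $\Gamma_2=\partial B_R(\mathcal{O})\cap\Sigma$). Suppose there is $u\in C^2(\Omega)\cap C^1(\overline{\Omega})\cap W^{1,\infty}(\Omega)\cap W^{2,2}(\Omega)$ and a constant $a>0$ such that \[ \Delta u=-nu-n \text{ in }\Omega,\quad u=0,\ \frac{\partial u}{\partial\nu}=-\frac{\sin R_1}{\cos R_1} \text{ on }\Gamma_0,\quad \frac{\partial u}{\partial\nu}=0 \text{ on }\Gamma_1,\quad u=a,\ \frac{\partial u}{\partial\nu}=\frac{\sin R}{\cos R_1} \text{ on }\Gamma_2 . \] Then $\Gamma_0=\partial B_{R_1}(\mathcal{O})\cap\Sigma$, i.e. $\Omega=\{x\in\Sigma: R<d(x,\mathcal{O})<R_1\}$, and $u(x)=\frac{\cos r-\cos R_1}{\cos R_1}$ with $r=\operatorname{dist}(x,\mathcal{O})$.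
   Context: Distances and balls are geodesic for the round metric on the unit sphere, in polar coordinates around $\mathcal{O}$ given by $dr^2+\sin^2 r\,d\theta^2$. $\mathbb{S}^n_+=\{x: d(x,\mathcal{O})<\pi/2\}$ is the open hemisphere centered at $\mathcal{O}$. An open cone with vertex $\mathcal{O}$ is $\Sigma=\{\exp_{\mathcal{O}}(t\theta): \theta\in\omega,\ t\in(0,\pi)\}$ for an open domain $\omega$ of the unit sphere of $T_{\mathcal{O}}\mathbb{S}^n$; it is convex if the second fundamental form $A(X,Y)=g(\nabla_X\nu,Y)$ of $\partial\Sigma$ (outward unit normal $\nu$) satisfies $A(X,X)\ge0$ for all tangent $X$ at every (regular) point of $\partial\Sigma$. An annular sector-like domain in $\Sigma$ is $\Omega=\Omega_1\setminus\overline{\Omega}_2$, with $\Omega_1,\Omega_2\subset\Sigma$ bounded domains, $\overline{\Omega}_2\cap\Sigma\subset\Omega_1$, $\mathcal{O}\in\partial\Omega_2$, such that with $\Gamma_0=\partial\Omega_1\cap\Sigma$, $\Gamma_2=\partial\Omega_2\cap\Sigma$, $\Gamma_1=\partial\Omega\setminus(\overline{\Gamma}_0\cup\overline{\Gamma}_2)$: $\mathcal{H}_{n-1}(\Gamma_i)>0$ ($i=0,1,2$); each $\Gamma_i$ is a smooth $(n-1)$-manifold; $\partial\Gamma_0,\partial\Gamma_2$ are smooth $(n-2)$-manifolds; $\partial\Gamma_1=\partial\Gamma_0\cup\partial\Gamma_2$. $\nu$ is the outward unit normal to $\partial\Omega$. *)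

theory Defs
  imports "HOL-Analysis.Analysis"
begin

text \<open>The unit sphere S^n is realised as sphere 0 1 in real^'n, with n = CARD('n) - 1.\<close>

definition sgdist :: "'a::real_inner \<Rightarrow> 'a \<Rightarrow> real" where
  "sgdist x y = arccos (x \<bullet> y)"

definition sgball :: "'a::real_inner \<Rightarrow> real \<Rightarrow> 'a set" where
  "sgball p r = {x \<in> sphere 0 1. sgdist x p < r}"

definition hemisphere :: "'a::real_inner \<Rightarrow> 'a set" where
  "hemisphere p = sgball p (pi/2)"

text \<open>exponential map of the sphere at x applied to t v, for a unit tangent vector v\<close>
definition sexp :: "'a::real_inner \<Rightarrow> real \<Rightarrow> 'a \<Rightarrow> 'a" where
  "sexp x t v = cos t *\<^sub>R x + sin t *\<^sub>R v"

text \<open>topological boundary (closure minus the set); applied to relatively open subsets of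
  the sphere and to pieces of boundaries (manifold boundary of an embedded manifold)\<close>
definition bdry :: "'a::topological_space set \<Rightarrow> 'a set" where
  "bdry A = closure A - A"

fun Ck_on :: "nat \<Rightarrow> 'a::euclidean_space set \<Rightarrow> ('a \<Rightarrow> 'b::real_normed_vector) \<Rightarrow> bool" where
  "Ck_on 0 U f = continuous_on U f"
| "Ck_on (Suc k) U f = (f differentiable_on U \<and>
      (\<forall>v. Ck_on k U (\<lambda>x. frechet_derivative f (at x) v)))"

definition Cinf_on :: "'a::euclidean_space set \<Rightarrow> ('a \<Rightarrow> 'b::real_normed_vector) \<Rightarrow> bool" where
  "Cinf_on U f = (\<forall>k. Ck_on k U f)"

definition smooth_submfld :: "nat \<Rightarrow> 'a::euclidean_space set \<Rightarrow> bool" where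
  "smooth_submfld k M = (\<forall>p\<in>M. \<exists>U V (\<phi>::'a\<Rightarrow>'a) \<psi> L.
      open U \<and> p \<in> U \<and> open V \<and> Cinf_on U \<phi> \<and> Cinf_on V \<psi> \<and> \<phi> ` U = V \<and>
      (\<forall>x\<in>U. \<psi> (\<phi> x) = x) \<and> subspace L \<and> dim L = k \<and> \<phi> ` (M \<inter> U) = V \<inter> L)"

text \<open>(unnormalised) s-dimensional Hausdorff measure; the normalising constant is irrelevant
  for positivity\<close>
definition hausdorff_approx :: "real \<Rightarrow> real \<Rightarrow> 'a::metric_space set \<Rightarrow> ennreal" where
  "hausdorff_approx s \<delta> A =
     (INF C \<in> {C :: nat \<Rightarrow> 'a set. A \<subseteq> (\<Union>i. C i) \<and> (\<forall>i. bounded (C i) \<and> diameter (C i) \<le> \<delta>)}.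
        (\<Sum>i. ennreal (diameter (C i) powr s)))"

definition hausdorff_measure :: "real \<Rightarrow> 'a::metric_space set \<Rightarrow> ennreal" where
  "hausdorff_measure s A = (SUP \<delta> \<in> {0<..}. hausdorff_approx s \<delta> A)"

definition tangent_vecs :: "'a::real_normed_vector set \<Rightarrow> 'a \<Rightarrow> 'a set" where
  "tangent_vecs M x = {v. \<exists>\<gamma> \<epsilon>. \<epsilon> > 0 \<and> \<gamma> 0 = x \<and> (\<forall>t. \<bar>t\<bar> < \<epsilon> \<longrightarrow> \<gamma> t \<in> M) \<and>
                              (\<gamma> has_vector_derivative v) (at 0)}"

definition outward_normal :: "'a::real_inner set \<Rightarrow> 'a \<Rightarrow> 'a \<Rightarrow> bool" where
  "outward_normal A x \<nu> = (norm \<nu> = 1 \<and> \<nu> \<bullet> x = 0 \<and>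
      (\<forall>v \<in> tangent_vecs (bdry A) x. v \<bullet> \<nu> = 0) \<and>
      (\<exists>\<epsilon>>0. \<forall>t. 0 < t \<and> t < \<epsilon> \<longrightarrow> sexp x (-t) \<nu> \<in> A \<and> sexp x t \<nu> \<notin> A))"

definition sph_cone :: "'a::real_inner \<Rightarrow> 'a set \<Rightarrow> 'a set" where
  "sph_cone p \<omega> = {cos t *\<^sub>R p + sin t *\<^sub>R \<theta> | t \<theta>. \<theta> \<in> \<omega> \<and> 0 < t \<and> t < pi}"

definition is_open_cone :: "'a::euclidean_space \<Rightarrow> 'a set \<Rightarrow> bool" where
  "is_open_cone p Sg = (\<exists>\<omega>. \<omega> \<subseteq> {\<theta>. norm \<theta> = 1 \<and> \<theta> \<bullet> p = 0} \<and>
      openin (top_of_set {\<theta>. norm \<theta> = 1 \<and> \<theta> \<bullet> p = 0}) \<omega> \<and> connected \<omega> \<and> \<omega> \<noteq> {} \<and>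
      Sg = sph_cone p \<omega>)"

text \<open>convex open cone: second fundamental form A(X,X) = <D_X nu, X> of the boundary
  (outward unit normal nu) is nonnegative at every regular point of the boundary\<close>
definition convex_sph_cone :: "real^'n \<Rightarrow> (real^'n) set \<Rightarrow> bool" where
  "convex_sph_cone p Sg = (is_open_cone p Sg \<and>
     (\<forall>q U. q \<in> bdry Sg \<and> open U \<and> q \<in> U \<and> smooth_submfld (CARD('n) - 2) (bdry Sg \<inter> U) \<longrightarrow>
        (\<exists>N. \<forall>z \<in> bdry Sg \<inter> U. outward_normal Sg z (N z)) \<and>
        (\<forall>N. (\<forall>z \<in> bdry Sg \<inter> U. outward_normal Sg z (N z)) \<longrightarrow>
           (\<forall>\<gamma> \<epsilon> X w. \<epsilon> > 0 \<and> \<gamma> 0 = q \<and> (\<forall>t. \<bar>t\<bar> < \<epsilon> \<longrightarrow> \<gamma> t \<in> bdry Sg \<inter> U) \<and>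
              (\<gamma> has_vector_derivative X) (at 0) \<and> ((N \<circ> \<gamma>) has_vector_derivative w) (at 0)
              \<longrightarrow> w \<bullet> X \<ge> 0))))"

definition annular_sector :: "real^'n \<Rightarrow> (real^'n) set \<Rightarrow> (real^'n) set \<Rightarrow> (real^'n) set \<Rightarrow> bool" where
  "annular_sector p Sg Om1 Om2 =
    (let Om = Om1 - closure Om2; G0 = bdry Om1 \<inter> Sg; G2 = bdry Om2 \<inter> Sg;
         G1 = bdry Om - (closure G0 \<union> closure G2); s = real (CARD('n) - 2) in
      openin (top_of_set (sphere 0 1)) Om1 \<and> connected Om1 \<and> Om1 \<noteq> {} \<and> Om1 \<subseteq> Sg \<and>
      openin (top_of_set (sphere 0 1)) Om2 \<and> connected Om2 \<and> Om2 \<noteq> {} \<and> Om2 \<subseteq> Sg \<and>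
      closure Om2 \<inter> Sg \<subseteq> Om1 \<and> p \<in> bdry Om2 \<and>
      hausdorff_measure s G0 > 0 \<and> hausdorff_measure s G1 > 0 \<and> hausdorff_measure s G2 > 0 \<and>
      smooth_submfld (CARD('n) - 2) G0 \<and> smooth_submfld (CARD('n) - 2) G1 \<and>
      smooth_submfld (CARD('n) - 2) G2 \<and>
      smooth_submfld (CARD('n) - 3) (bdry G0) \<and> smooth_submfld (CARD('n) - 3) (bdry G2) \<and>
      bdry G1 = bdry G0 \<union> bdry G2)"

text \<open>Calculus on the sphere through the 0-homogeneous extension of u\<close>
definition hext :: "('a::real_normed_vector \<Rightarrow> 'b) \<Rightarrow> 'a \<Rightarrow> 'b" where
  "hext u y = u (inverse (norm y) *\<^sub>R y)"

definition cone_over :: "'a::real_normed_vector set \<Rightarrow> 'a set" where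
  "cone_over A = {y. y \<noteq> 0 \<and> inverse (norm y) *\<^sub>R y \<in> A}"

definition egrad :: "('a::euclidean_space \<Rightarrow> real) \<Rightarrow> 'a \<Rightarrow> 'a" where
  "egrad f x = (\<Sum>i\<in>Basis. frechet_derivative f (at x) i *\<^sub>R i)"

definition ehess :: "('a::euclidean_space \<Rightarrow> real) \<Rightarrow> 'a \<Rightarrow> 'a \<Rightarrow> 'a \<Rightarrow> real" where
  "ehess f x i j = frechet_derivative (\<lambda>y. frechet_derivative f (at y) i) (at x) j"

definition elap :: "('a::euclidean_space \<Rightarrow> real) \<Rightarrow> 'a \<Rightarrow> real" where
  "elap f x = (\<Sum>i\<in>Basis. ehess f x i i)"

definition sgrad :: "('a::euclidean_space \<Rightarrow> real) \<Rightarrow> 'a \<Rightarrow> 'a" where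
  "sgrad u x = egrad (hext u) x"

definition slap :: "('a::euclidean_space \<Rightarrow> real) \<Rightarrow> 'a \<Rightarrow> real" where
  "slap u x = elap (hext u) x"

definition sph_C2 :: "'a::euclidean_space set \<Rightarrow> ('a \<Rightarrow> real) \<Rightarrow> bool" where
  "sph_C2 Om u = Ck_on 2 (cone_over Om) (hext u)"

definition sph_C1_closure :: "'a::euclidean_space set \<Rightarrow> ('a \<Rightarrow> real) \<Rightarrow> ('a \<Rightarrow> 'a) \<Rightarrow> bool" where
  "sph_C1_closure Om u G = (continuous_on (closure Om) u \<and> continuous_on (closure Om) G \<and>
      (\<forall>x\<in>Om. sgrad u x = G x))"

text \<open>L^2 with respect to the spherical measure, via the cone (polar coordinate) measure\<close>
definition sph_L2 :: "'a::euclidean_space set \<Rightarrow> ('a \<Rightarrow> real) \<Rightarrow> bool" where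
  "sph_L2 Om f = ((\<lambda>y. (hext f y)\<^sup>2) integrable_on {y \<in> cone_over Om. norm y \<le> 1})"

definition sph_W1inf :: "'a::euclidean_space set \<Rightarrow> ('a \<Rightarrow> real) \<Rightarrow> bool" where
  "sph_W1inf Om u = (bounded (u ` Om) \<and> bounded (sgrad u ` Om))"

definition sph_W22 :: "'a::euclidean_space set \<Rightarrow> ('a \<Rightarrow> real) \<Rightarrow> bool" where
  "sph_W22 Om u = (sph_L2 Om u \<and> (\<forall>i\<in>Basis. sph_L2 Om (\<lambda>x. sgrad u x \<bullet> i)) \<and>
      (\<forall>i\<in>Basis. \<forall>j\<in>Basis. sph_L2 Om (\<lambda>x. ehess (hext u) x i j)))"

end

theory Submission
  imports Defs "HOL-Complex_Analysis.Complex_Analysis"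
begin

text \<open>On \<open>\<Gamma>\<^sub>2\<close> the solution has full Cauchy data, and these agree with the data of a radial solution
  \<open>f (cos r)\<close> of the same equation. The function \<open>|y| (u (y/|y|) + 1 - f (cos r))\<close> is harmonic in
  the cone over \<open>\<Omega>\<close>; extended by zero across the cone over \<open>\<Gamma>\<^sub>2\<close> it is \<open>C\<^sup>1\<close>, hence weakly harmonic in
  the connected cone over \<open>\<Omega>\<^sub>1\<close>, and it vanishes on an open set. By unique continuation \<open>u + 1 = f (cos r)\<close>
  in \<open>\<Omega>\<close>. A Sturm type argument shows that \<open>f (cos r) = 1\<close> for a single \<open>r\<close> only, so that \<open>\<Gamma>\<^sub>0\<close> is part
  of a geodesic sphere. Finally the P-function \<open>|\<nabla>u|\<^sup>2 + (u + 1)\<^sup>2\<close> is monotone in \<open>r\<close>, which is compatible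
  with its values on \<open>\<Gamma>\<^sub>0\<close> and \<open>\<Gamma>\<^sub>2\<close> only if \<open>f (cos r) = cos r / cos R\<^sub>1\<close>.\<close>

subsection \<open>Partial derivatives\<close>

text \<open>The factor n in the equation is the eigenvalue of the coordinate functions on the
  sphere, so \<open>u + 1\<close> solves Delta w + n w = 0 and its extension of degree one is
  harmonic in the ambient space. This trades analysis on the sphere for potential theory in
  dimension at least three. One obstacle is regularity: \<open>u\<close> is only C^1 up to Gamma_2,
  its second derivatives may blow up there, and the zero extension need not be C^2. Hence a weak
  notion of harmonicity, for which a vanishing gradient on the hypersurface is enough, and unique
  continuation obtained from an integral representation. The other obstacle is that \<open>a\<close>
  is free: the Cauchy data on Gamma_2 fix a radial solution containing an unknown multiple
  \<open>C\<close> of a second solution, and the data on Gamma_0 must yield C = 0. A priori Gamma_0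
  may touch the equator, where the formula for the radial solution degenerates, so values there are
  used only as limits along sequences from inside.\<close>

definition has_pd :: "'a::real_normed_vector \<Rightarrow> ('a \<Rightarrow> real) \<Rightarrow> real \<Rightarrow> 'a \<Rightarrow> bool" where
  "has_pd i f D y = ((\<lambda>t. f (y + t *\<^sub>R i)) has_real_derivative D) (at 0)"

lemma has_pd_line:
  assumes "has_pd i f D (y + t *\<^sub>R i)"
  shows "((\<lambda>t. f (y + t *\<^sub>R i)) has_real_derivative D) (at t)"
proof -
  have "((\<lambda>h. f (y + (t + h) *\<^sub>R i)) has_real_derivative D) (at 0)"
    using assms unfolding has_pd_def by (simp add: algebra_simps)
  then show ?thesis
    using DERIV_at_within_shift [of "\<lambda>t. f (y + t *\<^sub>R i)" D t 0 UNIV] by (simp add: add.commute)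
qed

lemma has_derivative_imp_has_pd:
  assumes "(f has_derivative f') (at y)"
  shows "has_pd i f (f' i) y"
proof -
  have "(f has_derivative f') (at (y + 0 *\<^sub>R i))" using assms by simp
  moreover have "((\<lambda>t::real. y + t *\<^sub>R i) has_derivative (\<lambda>t. t *\<^sub>R i)) (at 0)"
    by (auto intro!: derivative_eq_intros)
  ultimately have "(f \<circ> (\<lambda>t. y + t *\<^sub>R i) has_derivative f' \<circ> (\<lambda>t. t *\<^sub>R i)) (at 0)"
    by (rule diff_chain_at[rotated])
  moreover have "f' (t *\<^sub>R i) = f' i * t" for t
    using has_derivative_bounded_linear[OF assms] by (simp add: linear_simps)
  ultimately show ?thesis
    unfolding has_pd_def has_field_derivative_def o_def by simp
qed

lemma has_pd_mult:
  "has_pd i f A y \<Longrightarrow> has_pd i g B y \<Longrightarrow> has_pd i (\<lambda>y. f y * g y) (A * g y + f y * B) y"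
  unfolding has_pd_def by (auto intro!: derivative_eq_intros)

lemma has_pd_add: "has_pd i f A y \<Longrightarrow> has_pd i g B y \<Longrightarrow> has_pd i (\<lambda>y. f y + g y) (A + B) y"
  unfolding has_pd_def by (auto intro!: derivative_eq_intros)

lemma has_pd_diff: "has_pd i f A y \<Longrightarrow> has_pd i g B y \<Longrightarrow> has_pd i (\<lambda>y. f y - g y) (A - B) y"
  unfolding has_pd_def by (auto intro!: derivative_eq_intros)

lemma has_pd_const: "has_pd i (\<lambda>y. k) 0 y"
  unfolding has_pd_def by (auto intro!: derivative_eq_intros)

lemma has_pd_inner: "has_pd i (\<lambda>y. (y - z) \<bullet> v) (i \<bullet> v) y"
  unfolding has_pd_def by (auto intro!: derivative_eq_intros simp: inner_left_distrib algebra_simps)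

lemma has_pd_norm2: "has_pd i (\<lambda>y. (norm (y - z))\<^sup>2) (2 * ((y - z) \<bullet> i)) y"
  unfolding has_pd_def power2_norm_eq_inner
  by (auto intro!: derivative_eq_intros simp: inner_left_distrib inner_commute algebra_simps)

lemma has_pd_chain:
  assumes "(\<phi> has_real_derivative B) (at (f y))" "has_pd i f A y"
  shows "has_pd i (\<lambda>y. \<phi> (f y)) (B * A) y"
  using DERIV_chain2[of \<phi> B "\<lambda>t. f (y + t *\<^sub>R i)" 0 A UNIV] assms unfolding has_pd_def by simp

lemma has_pd_cong_open:
  assumes "has_pd i f D y" "open U" "y \<in> U" "\<And>z. z \<in> U \<Longrightarrow> f z = g z"
  shows "has_pd i g D y"
proof -
  have "eventually (\<lambda>t::real. y + t *\<^sub>R i \<in> U) (nhds 0)"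
  proof -
    have "((\<lambda>t::real. y + t *\<^sub>R i) \<longlongrightarrow> y + 0 *\<^sub>R i) (nhds 0)"
      by (intro tendsto_intros filterlim_ident)
    then show ?thesis using assms(2,3) by (simp add: topological_tendstoD)
  qed
  then have "eventually (\<lambda>t::real. f (y + t *\<^sub>R i) = g (y + t *\<^sub>R i)) (nhds 0)"
    by eventually_elim (use assms(4) in auto)
  then show ?thesis
    using assms(1) unfolding has_pd_def by (simp cong: DERIV_cong_ev)
qed

lemma has_pd_unique: "has_pd i f A y \<Longrightarrow> has_pd i f B y \<Longrightarrow> A = B"
  unfolding has_pd_def by (rule DERIV_unique)

lemma has_pd_zero_outside:
  assumes "has_pd i f D y" "closed K" "y \<notin> K" "\<And>z. z \<notin> K \<Longrightarrow> f z = 0"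
  shows "D = 0"
proof -
  have "has_pd i f 0 y"
    by (rule has_pd_cong_open[OF has_pd_const[of i 0], where U="- K"]) (use assms in auto)
  then show ?thesis using assms(1) has_pd_unique by blast
qed

section \<open>Integration by parts for compactly supported functions\<close>

lemma integrable_compact_support:
  fixes f :: "'a::euclidean_space \<Rightarrow> real"
  assumes "continuous_on UNIV f" "compact K" "\<And>y. y \<notin> K \<Longrightarrow> f y = 0"
  shows "integrable lborel f"
proof -
  have "integrable lborel (\<lambda>x. indicator K x *\<^sub>R f x)"
    by (rule borel_integrable_compact) (use assms continuous_on_subset[OF assms(1)] in auto)
  moreover have "(\<lambda>x. indicator K x *\<^sub>R f x) = f"
    using assms(3) by (auto simp: indicator_def fun_eq_iff)
  ultimately show ?thesis by simp
qed

lemma integral_translate: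
  fixes f :: "'a::euclidean_space \<Rightarrow> real"
  assumes "f \<in> borel_measurable borel"
  shows "(\<integral>y. f (y + v) \<partial>lborel) = (\<integral>y. f y \<partial>lborel)"
proof -
  have "(\<integral>y. f y \<partial>lborel) = (\<integral>y. f y \<partial>(distr lborel borel ((+) v)))"
    by (simp add: lborel_distr_plus)
  also have "\<dots> = (\<integral>y. f (v + y) \<partial>lborel)"
    by (rule integral_distr) (use assms in auto)
  finally show ?thesis by (simp add: add.commute)
qed

lemma bounded_of_compact_support:
  fixes f :: "'a::euclidean_space \<Rightarrow> real"
  assumes "continuous_on UNIV f" "compact K" "\<And>y. y \<notin> K \<Longrightarrow> f y = 0"
  obtains M where "M > 0" "\<And>y. \<bar>f y\<bar> \<le> M"
proof -
  have "bounded (f ` K)"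
    by (intro compact_imp_bounded compact_continuous_image) (use assms continuous_on_subset[OF assms(1)] in auto)
  then obtain M where "M > 0" "\<And>y. y \<in> K \<Longrightarrow> \<bar>f y\<bar> \<le> M"
    by (auto simp: bounded_pos)
  then show ?thesis using assms(3) that[of M] by (metis abs_0 less_imp_le)
qed

text \<open>Difference quotients of \<open>f\<close> have integral zero by translation invariance of
  Lebesgue measure, and they converge to \<open>f'\<close> boundedly on a fixed compact set. The
  direction \<open>i\<close> may be any vector.\<close>

lemma integral_pd_eq_0:
  fixes f :: "'a::euclidean_space \<Rightarrow> real"
  assumes pd: "\<And>y. has_pd i f (f' y) y"
    and cf: "continuous_on UNIV f" and cf': "continuous_on UNIV f'"
    and K: "compact K" and f0: "\<And>y. y \<notin> K \<Longrightarrow> f y = 0"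
  shows "integral\<^sup>L lborel f' = 0"
proof -
  have f'0: "f' y = 0" if "y \<notin> K" for y
    using has_pd_zero_outside[OF pd compact_imp_closed[OF K] that f0] by blast
  obtain M where M: "M > 0" "\<And>y. \<bar>f' y\<bar> \<le> M"
    using bounded_of_compact_support[OF cf' K f'0] by blast
  define D where "D j y = (f (y + (1 / real (Suc j)) *\<^sub>R i) - f y) / (1 / real (Suc j))" for j y
  have D_alt: "\<bar>D j y\<bar> \<le> M" if "\<bar>f (y + (1 / real (Suc j)) *\<^sub>R i) - f y\<bar> \<le> M * (1 / real (Suc j))" for j y
    using that unfolding D_def abs_divide by (subst pos_divide_le_eq) auto
  \<comment> \<open>All points from which some multiple of \<open>i\<close> with factor in [0, 1]
    leads into \<open>K\<close>: together with the bound \<open>M\<close> this dominates every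
    \<open>D j\<close>.\<close>
  define L where "L = {x + y | x y. x \<in> K \<and> y \<in> (\<lambda>t. t *\<^sub>R (- i)) ` {0..1::real}}"
  have cL: "compact L"
    unfolding L_def by (intro compact_sums K compact_continuous_image continuous_intros) auto
  have KL: "K \<subseteq> L"
    unfolding L_def by (force intro: image_eqI[of _ _ "0::real"])
  have lip: "\<bar>f (y + h *\<^sub>R i) - f y\<bar> \<le> M * h" if "h > 0" for y h
  proof -
    have "\<exists>z. 0 < z \<and> z < h \<and> f (y + h *\<^sub>R i) - f (y + 0 *\<^sub>R i) = (h - 0) * f' (y + z *\<^sub>R i)"
      by (rule MVT2[where f="\<lambda>t. f (y + t *\<^sub>R i)"]) (use that has_pd_line[OF pd] in auto)
    then obtain z where "f (y + h *\<^sub>R i) - f y = h * f' (y + z *\<^sub>R i)" by auto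
    then show ?thesis using M(2)[of "y + z *\<^sub>R i"] that by (simp add: abs_mult mult.commute)
  qed
  have bound: "\<bar>D j y\<bar> \<le> M * indicator L y" for j y
  proof (cases "y \<in> L")
    case True
    then show ?thesis
      using D_alt[OF lip] by simp
  next
    case False
    then have "y \<notin> K" using KL by auto
    moreover have "y + (1 / real (Suc j)) *\<^sub>R i \<notin> K"
    proof
      assume "y + (1 / real (Suc j)) *\<^sub>R i \<in> K"
      then have "\<exists>x z. y = x + z \<and> x \<in> K \<and> z \<in> (\<lambda>t. t *\<^sub>R (- i)) ` {0..1::real}"
        by (intro exI[of _ "y + (1 / real (Suc j)) *\<^sub>R i"] exI[of _ "(1 / real (Suc j)) *\<^sub>R (- i)"])
           (auto intro!: imageI)
      then show False using False unfolding L_def by auto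
    qed
    ultimately show ?thesis using f0 False by (simp add: D_def)
  qed
  have fm: "f \<in> borel_measurable borel" "f' \<in> borel_measurable borel"
    using cf cf' by (auto intro: borel_measurable_continuous_onI)
  have fm2: "(\<lambda>y. f (y + v)) \<in> borel_measurable borel" for v
    using cf by (intro borel_measurable_continuous_onI) (auto intro!: continuous_intros continuous_on_compose2[of UNIV f])
  have "(\<lambda>j. integral\<^sup>L lborel (D j)) \<longlonglongrightarrow> integral\<^sup>L lborel f'"
  proof (rule integral_dominated_convergence[where w="\<lambda>y. M * indicator L y"])
    show "f' \<in> borel_measurable lborel" using fm by simp
    show "D j \<in> borel_measurable lborel" for j using fm fm2 unfolding D_def by simp
    show "integrable lborel (\<lambda>y. M * indicator L y)"
      using borel_integrable_compact[OF cL continuous_on_const[of L "1::real"]]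
      by (intro integrable_mult_right) (simp add: real_scaleR_def)
    show "AE y in lborel. (\<lambda>j. D j y) \<longlonglongrightarrow> f' y"
    proof (rule AE_I2)
      fix y
      have "((\<lambda>h. (f (y + h *\<^sub>R i) - f y) / h) \<longlongrightarrow> f' y) (at 0)"
        using pd[of y] unfolding has_pd_def DERIV_def by simp
      moreover have "filterlim (\<lambda>j. 1 / real (Suc j)) (at 0) sequentially"
        unfolding filterlim_at using LIMSEQ_Suc[OF lim_1_over_n] by auto
      ultimately show "(\<lambda>j. D j y) \<longlonglongrightarrow> f' y"
        unfolding D_def by (rule filterlim_compose)
    qed
    show "AE y in lborel. norm (D j y) \<le> M * indicator L y" for j
      using bound by auto
  qed
  moreover have "integral\<^sup>L lborel (D j) = 0" for j
  proof -
    have 1: "integrable lborel f" by (rule integrable_compact_support[OF cf K f0])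
    have 2: "integrable lborel (\<lambda>y. f (y + v))" for v
      by (rule integrable_compact_support[where K="(\<lambda>y. y - v) ` K"])
        (auto intro!: continuous_intros continuous_on_compose2[OF cf] compact_continuous_image K f0 simp: image_iff)
    show ?thesis unfolding D_def using 1 2 integral_translate[OF fm(1)] by simp
  qed
  ultimately show ?thesis by (simp add: LIMSEQ_const_iff)
qed

subsection \<open>Weakly harmonic functions\<close>

text \<open>Harmonicity tested against functions with continuous pure second derivatives along the
  axes. This class contains what is inserted later, products of a spline cutoff with a regularised
  Newton kernel. \<open>\<psi>1\<close> and \<open>\<psi>2\<close> stand for the first and second
  derivatives.\<close>

definition weakly_harmonic_on :: "'a::euclidean_space set \<Rightarrow> ('a \<Rightarrow> real) \<Rightarrow> bool" where
  "weakly_harmonic_on W H \<longleftrightarrow> continuous_on W H \<and>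
     (\<forall>K \<psi> \<psi>1 \<psi>2. compact K \<and> K \<subseteq> W \<and> (\<forall>y. y \<notin> K \<longrightarrow> \<psi> y = 0) \<and> continuous_on UNIV \<psi> \<and>
        (\<forall>i\<in>Basis. continuous_on UNIV (\<psi>1 i) \<and> continuous_on UNIV (\<psi>2 i)) \<and>
        (\<forall>i\<in>Basis. \<forall>y. has_pd i \<psi> (\<psi>1 i y) y \<and> has_pd i (\<psi>1 i) (\<psi>2 i y) y)
        \<longrightarrow> (\<integral>y. H y * (\<Sum>i\<in>Basis. \<psi>2 i y) \<partial>lborel) = 0)"

lemma continuous_on_UNIV_local:
  fixes f :: "'a::t2_space \<Rightarrow> 'b::topological_space"
  assumes "\<And>y. \<exists>U. open U \<and> y \<in> U \<and> continuous_on U f"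
  shows "continuous_on UNIV f"
proof (rule continuous_at_imp_continuous_on, rule ballI)
  fix y :: 'a
  obtain U where "open U" "y \<in> U" "continuous_on U f" using assms by blast
  then show "isCont f y" using continuous_on_eq_continuous_at by blast
qed

text \<open>\<open>H\<close> is arbitrary outside \<open>W\<close>, but the product vanishes on the
  open set \<open>- K\<close>, and \<open>W\<close> and \<open>- K\<close> cover the space.\<close>

lemma continuous_on_mult_compact_support:
  fixes H \<gamma> :: "'a::euclidean_space \<Rightarrow> real"
  assumes "open W" "continuous_on W H" "continuous_on UNIV \<gamma>" "compact K" "K \<subseteq> W"
    and z: "\<And>y. y \<notin> K \<Longrightarrow> \<gamma> y = 0"
  shows "continuous_on UNIV (\<lambda>y. H y * \<gamma> y)"
proof (rule continuous_on_UNIV_local)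
  fix y
  show "\<exists>U. open U \<and> y \<in> U \<and> continuous_on U (\<lambda>y. H y * \<gamma> y)"
  proof (cases "y \<in> W")
    case True
    then show ?thesis
      using assms by (intro exI[of _ W]) (auto intro!: continuous_on_mult intro: continuous_on_subset)
  next
    case False
    have "continuous_on (- K) (\<lambda>y. 0::real)" by simp
    then have "continuous_on (- K) (\<lambda>y. H y * \<gamma> y)"
      by (rule continuous_on_eq) (use z in auto)
    then show ?thesis
      using False assms by (intro exI[of _ "- K"]) (auto intro: compact_imp_closed)
  qed
qed

lemma has_pd_mult_compact_support:
  assumes W: "\<And>y. y \<in> W \<Longrightarrow> has_pd i H (H1 y) y" and g: "\<And>y. has_pd i \<gamma> (\<gamma>1 y) y"
    and K: "compact K" "K \<subseteq> W" "\<And>y. y \<notin> K \<Longrightarrow> \<gamma> y = 0"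
  shows "has_pd i (\<lambda>y. H y * \<gamma> y) (H1 y * \<gamma> y + H y * \<gamma>1 y) y"
proof (cases "y \<in> W")
  case True
  then show ?thesis using W g by (intro has_pd_mult) auto
next
  case False
  then have "y \<notin> K" using K by auto
  then have "\<gamma>1 y = 0" "\<gamma> y = 0"
    using has_pd_zero_outside[OF g compact_imp_closed[OF K(1)] _ K(3)] K(3) by auto
  moreover have "has_pd i (\<lambda>y. H y * \<gamma> y) 0 y"
    by (rule has_pd_cong_open[OF has_pd_const[of i 0], where U="- K"])
       (use \<open>y \<notin> K\<close> K in \<open>auto intro: compact_imp_closed\<close>)
  ultimately show ?thesis by simp
qed

section \<open>Truncated powers and spline steps\<close>

definition pos_power :: "nat \<Rightarrow> real \<Rightarrow> real" where
  "pos_power k t = (max 0 t) ^ k"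

text \<open>The exponent starts at 2 because the first truncated power has a corner at 0; for higher
  exponents the difference quotient at 0 is a truncated power of one degree less and tends to
  0.\<close>

lemma pos_power_deriv:
  "(pos_power (Suc (Suc k)) has_real_derivative real (Suc (Suc k)) * pos_power (Suc k) t) (at t)"
proof -
  consider "t < 0" | "t > 0" | "t = 0" by linarith
  then show ?thesis
  proof cases
    case 1
    have "((\<lambda>t. 0) has_real_derivative 0) (at t)" by simp
    then have "(pos_power (Suc (Suc k)) has_real_derivative 0) (at t)"
      by (rule has_field_derivative_transform_within_open[where S="{..<0}"])
         (use 1 in \<open>auto simp: pos_power_def\<close>)
    then show ?thesis using 1 by (simp add: pos_power_def)
  next
    case 2
    have "((\<lambda>t. t ^ Suc (Suc k)) has_real_derivative real (Suc (Suc k)) * t ^ Suc k) (at t)"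
      using DERIV_pow[of "Suc (Suc k)" t] by simp
    then have "(pos_power (Suc (Suc k)) has_real_derivative real (Suc (Suc k)) * t ^ Suc k) (at t)"
      by (rule has_field_derivative_transform_within_open[where S="{0<..}"])
         (use 2 in \<open>auto simp: pos_power_def\<close>)
    then show ?thesis using 2 by (simp add: pos_power_def)
  next
    case 3
    have "(\<lambda>h::real. (max 0 h) ^ Suc k) \<midarrow>0\<rightarrow> (max 0 0) ^ Suc k"
      by (intro tendsto_intros)
    then have "(\<lambda>h::real. (max 0 h) ^ Suc k) \<midarrow>0\<rightarrow> 0" by simp
    moreover have "eventually (\<lambda>h::real. (max 0 h) ^ Suc k = (max 0 h) ^ Suc (Suc k) / h) (at 0)"
      unfolding eventually_at_filter by (rule always_eventually) (auto simp: max_def)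
    ultimately have "(\<lambda>h::real. (max 0 h) ^ Suc (Suc k) / h) \<midarrow>0\<rightarrow> 0"
      using tendsto_cong by fast
    then show ?thesis using 3 by (simp add: DERIV_def pos_power_def)
  qed
qed

lemma continuous_on_pos_power: "continuous_on A (pos_power k)"
  unfolding pos_power_def by (intro continuous_intros)

text \<open>Integrated B-splines, linear for \<open>step2\<close> and quadratic for \<open>step3\<close>.\<close>

definition step2 :: "real \<Rightarrow> real" where
  "step2 t = pos_power 2 t - 2 * pos_power 2 (t - 1) + pos_power 2 (t - 2)"
definition step2' :: "real \<Rightarrow> real" where
  "step2' t = 2 * pos_power 1 t - 4 * pos_power 1 (t - 1) + 2 * pos_power 1 (t - 2)"

lemma step2_deriv: "(step2 has_real_derivative step2' t) (at t)"
proof -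
  have "(pos_power 2 has_real_derivative 2 * pos_power 1 t) (at t)" for t
    using pos_power_deriv[of 0 t] by (simp add: numeral_2_eq_2)
  note * = this DERIV_chain2[OF this]
  show ?thesis unfolding step2_def[abs_def] step2'_def
    by (rule derivative_eq_intros * refl | simp)+
qed

lemma step2_props:
  shows "t \<le> 0 \<Longrightarrow> step2 t = 0" and "t \<ge> 2 \<Longrightarrow> step2 t = 2"
    and "t \<le> 0 \<or> t \<ge> 2 \<Longrightarrow> step2' t = 0" and "\<bar>step2' t\<bar> \<le> 2" and "\<bar>step2 t\<bar> \<le> 2"
proof -
  show "t \<le> 0 \<Longrightarrow> step2 t = 0" by (simp add: step2_def pos_power_def)
  show 2: "step2 t = 2" if "t \<ge> 2" using that
    by (simp add: step2_def pos_power_def max_absorb2) (simp add: power2_eq_square algebra_simps)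
  show "t \<le> 0 \<or> t \<ge> 2 \<Longrightarrow> step2' t = 0" "\<bar>step2' t\<bar> \<le> 2"
    unfolding step2'_def pos_power_def power_one_right by (auto simp: max_def)
  consider "t \<le> 0" | "0 < t" "t \<le> 1" | "1 < t" "t \<le> 2" | "2 < t" by linarith
  then show "\<bar>step2 t\<bar> \<le> 2"
  proof cases
    case 2
    then have "t * t \<le> 1" by (simp add: mult_le_one)
    then show ?thesis using 2 by (simp add: step2_def pos_power_def power2_eq_square max_absorb1 max_absorb2)
  next
    case 3
    then have "step2 t = 2 - (2 - t)\<^sup>2"
      by (simp add: step2_def pos_power_def max_absorb1 max_absorb2) (simp add: power2_eq_square algebra_simps)
    moreover have "(2 - t)\<^sup>2 \<le> 1" using 3 by (intro power_le_one) auto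
    ultimately show ?thesis by (simp add: abs_le_iff)
  qed (use 2 in \<open>simp_all add: step2_def pos_power_def\<close>)
qed

lemma continuous_on_step2: "continuous_on A step2" "continuous_on A step2'"
  unfolding step2_def[abs_def] step2'_def[abs_def]
  by (auto intro!: continuous_intros continuous_on_compose2[OF continuous_on_pos_power[of UNIV]])

text \<open>Translating the strip by multiples of \<open>2 * \<delta>\<close> along
  \<open>- e\<close> raises \<open>d\<close> by the same amounts, so about 1/\<delta> translates are
  pairwise disjoint and all lie in one ball. Hence a single strip has measure O(\<delta>).\<close>

lemma strip_measure:
  fixes d :: "'a::euclidean_space \<Rightarrow> real"
  assumes K: "compact K" and cd: "continuous_on UNIV d"
    and shift: "\<And>y t. d (y - t *\<^sub>R e) = d y + t"
  shows "\<exists>V\<ge>0. \<forall>\<delta>. 0 < \<delta> \<and> \<delta> \<le> 1 \<longrightarrow> measure lebesgue {y\<in>K. \<delta> < d y \<and> d y < 3 * \<delta>} \<le> V * \<delta>"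
proof -
  obtain B where B: "\<And>y. y \<in> K \<Longrightarrow> norm y \<le> B"
    using compact_imp_bounded[OF K] by (auto simp: bounded_iff)
  \<comment> \<open>As \<open>\<delta> * j\<close> stays below 1, no translate moves further than
    \<open>2 * norm e\<close>. The factor 2 in \<open>V\<close> pays for rounding 1/\<delta> down to
    an integer, which loses at most half because 1/\<delta> is at least 1.\<close>
  define C where "C = cball (0::'a) (B + 2 * norm e)"
  define V where "V = 2 * measure lebesgue C"
  have "measure lebesgue {y\<in>K. \<delta> < d y \<and> d y < 3 * \<delta>} \<le> V * \<delta>" if "0 < \<delta>" "\<delta> \<le> 1" for \<delta>
  proof -
    define T where "T = {y\<in>K. \<delta> < d y \<and> d y < 3 * \<delta>}"
    define J where "J = nat \<lfloor>1 / \<delta>\<rfloor>"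
    have "1 \<le> 1 / \<delta>" using that by simp
    then have J: "real J \<le> 1 / \<delta>" "1 / \<delta> < real J + 1" "1 \<le> J"
      unfolding J_def by linarith+
    then have J2: "1 / \<delta> \<le> 2 * real J" by linarith
    have "open {y. \<delta> < d y \<and> d y < 3 * \<delta>}"
      using cd by (auto intro!: open_Collect_conj open_Collect_less continuous_intros)
    then have "K \<inter> {y. \<delta> < d y \<and> d y < 3 * \<delta>} \<in> sets lebesgue"
      using compact_imp_closed[OF K] by (intro sets.Int) auto
    moreover have "T = K \<inter> {y. \<delta> < d y \<and> d y < 3 * \<delta>}" by (auto simp: T_def)
    ultimately have Tm: "T \<in> sets lebesgue" by simp
    have "bounded T" using compact_imp_bounded[OF K] by (rule bounded_subset) (auto simp: T_def)
    then have Tl: "T \<in> lmeasurable" using Tm by (simp add: bounded_set_imp_lmeasurable)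
    define A where "A j = (+) (- ((2 * \<delta> * real j) *\<^sub>R e)) ` T" for j
    have Al: "A j \<in> lmeasurable" for j unfolding A_def using Tl by (rule measurable_translation)
    have Am: "measure lebesgue (A j) = measure lebesgue T" for j
      unfolding A_def by (rule measure_translation)
    have dA: "\<delta> + 2 * \<delta> * real j < d y \<and> d y < 3 * \<delta> + 2 * \<delta> * real j" if "y \<in> A j" for j y
    proof -
      obtain z where "z \<in> T" "y = z - (2 * \<delta> * real j) *\<^sub>R e"
        using \<open>y \<in> A j\<close> unfolding A_def by auto
      then show ?thesis using shift[of z "2 * \<delta> * real j"] unfolding T_def by auto
    qed
    have "disjoint_family_on A {..<J}"
      unfolding disjoint_family_on_def
    proof (intro ballI impI)
      fix j k :: nat assume "j \<noteq> k"
      have aux: "A j \<inter> A k = {}" if "j < k" for j k :: nat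
      proof -
        have "real j + 1 \<le> real k" using that by simp
        then have "2 * \<delta> * (real j + 1) \<le> 2 * \<delta> * real k"
          using \<open>0 < \<delta>\<close> by (intro mult_left_mono) auto
        then have "3 * \<delta> + 2 * \<delta> * real j \<le> \<delta> + 2 * \<delta> * real k" by (simp add: algebra_simps)
        then show ?thesis using dA[of _ j] dA[of _ k] by fastforce
      qed
      show "A j \<inter> A k = {}" using aux[of j k] aux[of k j] \<open>j \<noteq> k\<close> by (metis Int_commute linorder_neqE_nat)
    qed
    then have "measure lebesgue (\<Union>j<J. A j) = (\<Sum>j<J. measure lebesgue (A j))"
      by (intro measure_finite_Union) (use fmeasurableD2[OF Al] fmeasurableD[OF Al] in \<open>auto simp del: emeasure_completion\<close>)
    then have "real J * measure lebesgue T = measure lebesgue (\<Union>j<J. A j)"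
      using Am by simp
    also have "\<dots> \<le> measure lebesgue C"
    proof (rule measure_mono_fmeasurable)
      show "(\<Union>j<J. A j) \<subseteq> C"
      proof
        fix y assume "y \<in> (\<Union>j<J. A j)"
        then obtain j z where j: "j < J" and z: "z \<in> T" "y = z - (2 * \<delta> * real j) *\<^sub>R e"
          unfolding A_def by auto
        have "real j \<le> 1 / \<delta>" using j J(1) by simp
        then have "\<delta> * real j \<le> 1" using that by (simp add: field_simps)
        then have "2 * \<delta> * real j * norm e \<le> 2 * norm e" by (intro mult_right_mono) auto
        moreover have "norm ((2 * \<delta> * real j) *\<^sub>R e) = 2 * \<delta> * real j * norm e"
          using that by simp
        moreover have "norm z \<le> B" using z B unfolding T_def by auto
        ultimately have "norm y \<le> B + 2 * norm e"
          unfolding z(2) using norm_triangle_ineq4[of z "(2 * \<delta> * real j) *\<^sub>R e"] by linarith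
        then show "y \<in> C" by (simp add: C_def)
      qed
      show "(\<Union>j<J. A j) \<in> sets lebesgue" using Al by (auto simp: fmeasurableD)
      show "C \<in> lmeasurable" unfolding C_def by simp
    qed
    finally have "real J * measure lebesgue T \<le> measure lebesgue C" .
    moreover have "(1 / \<delta>) * measure lebesgue T \<le> 2 * real J * measure lebesgue T"
      using J2 by (intro mult_right_mono) auto
    ultimately have "(1 / \<delta>) * measure lebesgue T \<le> V" unfolding V_def by linarith
    then show ?thesis using that unfolding T_def[symmetric] by (simp add: field_simps)
  qed
  moreover have "V \<ge> 0" unfolding V_def by simp
  ultimately show ?thesis by blast
qed

text \<open>On the compact set where \<open>norm (g y)\<close> is at least \<epsilon>,
  \<open>d\<close> is positive and attains a positive minimum; half of it serves as
  \<delta>.\<close>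

lemma uniformly_small_near_zero_set:
  fixes g :: "'a::euclidean_space \<Rightarrow> 'b::real_normed_vector" and d :: "'a \<Rightarrow> real"
  assumes K: "compact K" and cg: "continuous_on K g" and cd: "continuous_on K d"
    and z: "\<And>y. y \<in> K \<Longrightarrow> d y \<le> 0 \<Longrightarrow> g y = 0" and "\<epsilon> > 0"
  shows "\<exists>\<delta>>0. \<forall>y\<in>K. d y \<le> \<delta> \<longrightarrow> norm (g y) \<le> \<epsilon>"
proof -
  define K' where "K' = {y \<in> K. \<epsilon> \<le> norm (g y)}"
  have "closedin (top_of_set K) (K \<inter> (\<lambda>y. norm (g y)) -` {\<epsilon>..})"
    by (rule continuous_closedin_preimage) (auto intro!: continuous_intros cg)
  then have "compact (K \<inter> (\<lambda>y. norm (g y)) -` {\<epsilon>..})"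
    using K closedin_compact by blast
  moreover have "K \<inter> (\<lambda>y. norm (g y)) -` {\<epsilon>..} = K'" by (auto simp: K'_def)
  ultimately have cK': "compact K'" by simp
  show ?thesis
  proof (cases "K' = {}")
    case True
    then show ?thesis unfolding K'_def by (intro exI[of _ 1]) force
  next
    case False
    then obtain y where y: "y \<in> K'" "\<And>z. z \<in> K' \<Longrightarrow> d y \<le> d z"
      using continuous_attains_inf[OF cK' False, of d] continuous_on_subset[OF cd, of K'] K'_def by auto
    have "d y > 0" using y(1) z[of y] \<open>\<epsilon> > 0\<close> unfolding K'_def by force
    moreover have "norm (g z) \<le> \<epsilon>" if "z \<in> K" "d z \<le> d y / 2" for z
    proof (rule ccontr)
      assume "\<not> norm (g z) \<le> \<epsilon>"
      then have "d y \<le> d z" using that y(2)[of z] unfolding K'_def by auto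
      then show False using that \<open>d y > 0\<close> by linarith
    qed
    ultimately show ?thesis by (intro exI[of _ "d y / 2"]) auto
  qed
qed

text \<open>Cutting off with a step of width \<open>\<delta>\<close> in \<open>d\<close> produces an error bounded by \<open>1/\<delta>\<close> times the supremum
  of \<open>|g|\<close> on a strip times the measure \<open>O(\<delta>)\<close> of that strip.\<close>

lemma zero_extension_weakly_harmonic:
  fixes H d :: "'a::euclidean_space \<Rightarrow> real" and g dg :: "'a \<Rightarrow> 'a" and h :: "'a \<Rightarrow> 'a \<Rightarrow> real"
  assumes W: "open W"
    and H: "\<And>y i. y \<in> W \<Longrightarrow> i \<in> Basis \<Longrightarrow> has_pd i H (g y \<bullet> i) y"
    and cH: "continuous_on W H" and cg: "continuous_on W g"
    and d: "\<And>y i. y \<in> W \<Longrightarrow> i \<in> Basis \<Longrightarrow> has_pd i d (dg y \<bullet> i) y"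
    and cd: "continuous_on UNIV d" and cdg: "continuous_on W dg"
    and shift: "\<And>y t. d (y - t *\<^sub>R e) = d y + t"
    and g0: "\<And>y. y \<in> W \<Longrightarrow> d y \<le> 0 \<Longrightarrow> g y = 0"
    and h: "\<And>y i. y \<in> W \<Longrightarrow> d y > 0 \<Longrightarrow> i \<in> Basis \<Longrightarrow> has_pd i (\<lambda>z. g z \<bullet> i) (h i y) y"
    and ch: "\<And>i. i \<in> Basis \<Longrightarrow> continuous_on {y\<in>W. d y > 0} (h i)"
    and harm: "\<And>y. y \<in> W \<Longrightarrow> d y > 0 \<Longrightarrow> (\<Sum>i\<in>Basis. h i y) = 0"
  shows "weakly_harmonic_on W H"
  unfolding weakly_harmonic_on_def
proof (intro conjI allI impI cH)
  fix K :: "'a set" and \<psi> and \<psi>1 \<psi>2 :: "'a \<Rightarrow> 'a \<Rightarrow> real"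
  assume "compact K \<and> K \<subseteq> W \<and> (\<forall>y. y \<notin> K \<longrightarrow> \<psi> y = 0) \<and> continuous_on UNIV \<psi> \<and>
        (\<forall>i\<in>Basis. continuous_on UNIV (\<psi>1 i) \<and> continuous_on UNIV (\<psi>2 i)) \<and>
        (\<forall>i\<in>Basis. \<forall>y. has_pd i \<psi> (\<psi>1 i y) y \<and> has_pd i (\<psi>1 i) (\<psi>2 i y) y)"
  then have K: "compact K" "K \<subseteq> W" and p0: "\<And>y. y \<notin> K \<Longrightarrow> \<psi> y = 0"
    and cp: "continuous_on UNIV \<psi>"
    and cp1: "\<And>i. i \<in> Basis \<Longrightarrow> continuous_on UNIV (\<psi>1 i)"
    and cp2: "\<And>i. i \<in> Basis \<Longrightarrow> continuous_on UNIV (\<psi>2 i)"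
    and p1: "\<And>i y. i \<in> Basis \<Longrightarrow> has_pd i \<psi> (\<psi>1 i y) y"
    and p2: "\<And>i y. i \<in> Basis \<Longrightarrow> has_pd i (\<psi>1 i) (\<psi>2 i y) y"
    by auto
  have clK: "closed K" using K(1) by (rule compact_imp_closed)
  have p10: "\<psi>1 i y = 0" if "i \<in> Basis" "y \<notin> K" for i y
    using has_pd_zero_outside[OF p1[OF that(1)] clK that(2) p0] by simp
  have p20: "\<psi>2 i y = 0" if "i \<in> Basis" "y \<notin> K" for i y
    using has_pd_zero_outside[OF p2[OF that(1)] clK that(2) p10[OF that(1)]] by simp
  have cgi: "continuous_on W (\<lambda>y. g y \<bullet> i)" for i by (intro continuous_intros cg)
  note cms = continuous_on_mult_compact_support[OF W _ _ K]
  have cgp1: "continuous_on UNIV (\<lambda>y. g y \<bullet> i * \<psi>1 i y)" if "i \<in> Basis" for i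
    by (rule cms[OF cgi cp1[OF that] p10[OF that]])
  have cHp2: "continuous_on UNIV (\<lambda>y. H y * \<psi>2 i y)" if "i \<in> Basis" for i
    by (rule cms[OF cH cp2[OF that] p20[OF that]])
  have cHp1: "continuous_on UNIV (\<lambda>y. H y * \<psi>1 i y)" if "i \<in> Basis" for i
    by (rule cms[OF cH cp1[OF that] p10[OF that]])
  have intg: "integrable lborel (\<lambda>y. g y \<bullet> i * \<psi>1 i y)" if "i \<in> Basis" for i
    by (rule integrable_compact_support[OF cgp1[OF that] K(1)]) (use p10[OF that] in simp)
  have intH: "integrable lborel (\<lambda>y. H y * \<psi>2 i y)" if "i \<in> Basis" for i
    by (rule integrable_compact_support[OF cHp2[OF that] K(1)]) (use p20[OF that] in simp)
  \<comment> \<open>One integration by parts is legitimate across the hypersurface d = 0, since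
    \<open>H\<close> has the continuous gradient \<open>g\<close> on all of \<open>W\<close>; second
    derivatives of \<open>H\<close> are available only where d > 0.\<close>
  have parts: "(\<integral>y. H y * \<psi>2 i y \<partial>lborel) = - (\<integral>y. g y \<bullet> i * \<psi>1 i y \<partial>lborel)" if i: "i \<in> Basis" for i
  proof -
    have "(\<integral>y. (g y \<bullet> i) * \<psi>1 i y + H y * \<psi>2 i y \<partial>lborel) = 0"
    proof (rule integral_pd_eq_0[where f="\<lambda>y. H y * \<psi>1 i y" and K=K and i=i])
      show "has_pd i (\<lambda>y. H y * \<psi>1 i y) (g y \<bullet> i * \<psi>1 i y + H y * \<psi>2 i y) y" for y
        by (rule has_pd_mult_compact_support[OF H[OF _ i] p2[OF i] K p10[OF i]])
      show "continuous_on UNIV (\<lambda>y. g y \<bullet> i * \<psi>1 i y + H y * \<psi>2 i y)"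
        by (intro continuous_on_add cgp1 cHp2 i)
    qed (use K cHp1 i p10 in auto)
    then show ?thesis using intg[OF i] intH[OF i] by simp
  qed
  define f where "f y = (\<Sum>i\<in>Basis. g y \<bullet> i * \<psi>1 i y)" for y
  have fint: "integrable lborel f" unfolding f_def by (intro Bochner_Integration.integrable_sum intg)
  have cf: "continuous_on UNIV f" unfolding f_def by (intro continuous_on_sum cgp1)
  have "(\<integral>y. H y * (\<Sum>i\<in>Basis. \<psi>2 i y) \<partial>lborel) = - (\<integral>y. f y \<partial>lborel)"
    unfolding sum_distrib_left f_def using intg intH parts
    by (simp add: Bochner_Integration.integral_sum sum_negf)
  moreover have "(\<integral>y. f y \<partial>lborel) = 0"
  proof -
    \<comment> \<open>Equal to 0 for d \<le> \<delta> and to 2 for d \<ge> 3\<delta>, so its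
      gradient lives in the strip measured by \<open>strip_measure\<close>.\<close>
    define q where "q \<delta> y = step2 ((d y - \<delta>) / \<delta>)" for \<delta> y
    define q' where "q' \<delta> y = step2' ((d y - \<delta>) / \<delta>) / \<delta>" for \<delta> y
    have cq: "continuous_on UNIV (q \<delta>)" "continuous_on UNIV (q' \<delta>)" if "\<delta> > 0" for \<delta>
      unfolding q_def q'_def using that
      by (auto intro!: continuous_intros cd continuous_on_compose2[OF continuous_on_step2(1)[of UNIV]]
          continuous_on_compose2[OF continuous_on_step2(2)[of UNIV]])
    have qpd: "has_pd i (q \<delta>) (q' \<delta> y * (dg y \<bullet> i)) y" if "\<delta> > 0" "y \<in> W" "i \<in> Basis" for \<delta> y i
    proof -
      have "((\<lambda>t. step2 ((t - \<delta>) / \<delta>)) has_real_derivative q' \<delta> y) (at (d y))"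
      proof -
        have "((\<lambda>t. (t - \<delta>) / \<delta>) has_real_derivative 1 / \<delta>) (at (d y))"
          using that(1) by (auto intro!: derivative_eq_intros)
        from DERIV_chain2[OF step2_deriv this] that(1) show ?thesis by (simp add: q'_def)
      qed
      then show ?thesis
        unfolding q_def by (rule has_pd_chain[OF _ d[OF that(2,3)]])
    qed
    have q0: "q \<delta> y = 0" "q' \<delta> y = 0" if "\<delta> > 0" "d y \<le> \<delta>" for \<delta> y
      using that by (simp_all add: q_def q'_def step2_props divide_nonpos_pos)
    have q'0: "q' \<delta> y = 0" if "\<delta> > 0" "d y \<ge> 3 * \<delta>" for \<delta> y
    proof -
      have "(d y - \<delta>) / \<delta> \<ge> 2" using that by (simp add: field_simps)
      then show ?thesis by (simp add: q'_def step2_props)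
    qed
    have q'b: "\<bar>q' \<delta> y\<bar> \<le> 2 / \<delta>" if "\<delta> > 0" for \<delta> y
      using that step2_props(4) unfolding q'_def by (simp add: divide_right_mono)
    define r where "r y = (dg y \<bullet> g y) * \<psi> y" for y
    have cr: "continuous_on UNIV r"
      unfolding r_def by (rule cms[OF _ cp p0]) (intro continuous_intros cg cdg)
    have r0: "r y = 0" if "y \<notin> K" for y using p0[OF that] by (simp add: r_def)
    have qf_int: "integrable lborel (\<lambda>y. q \<delta> y * f y)" if "\<delta> > 0" for \<delta>
      by (rule integrable_compact_support[OF continuous_on_mult[OF cq(1)[OF that] cf] K(1)])
        (use p10 in \<open>simp add: f_def\<close>)
    have qr_int: "integrable lborel (\<lambda>y. q' \<delta> y * r y)" if "\<delta> > 0" for \<delta>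
      by (rule integrable_compact_support[OF continuous_on_mult[OF cq(2)[OF that] cr] K(1)])
        (use r0 in simp)
    have key: "(\<integral>y. q \<delta> y * f y \<partial>lborel) = - (\<integral>y. q' \<delta> y * r y \<partial>lborel)" if del: "\<delta> > 0" for \<delta>
    proof -
      \<comment> \<open>The vector field q \<psi> g; \<open>F'\<close> lists the diagonal terms of
        its divergence, and those containing \<open>h\<close> add up to zero by harmonicity.\<close>
      define F where "F i y = q \<delta> y * \<psi> y * (g y \<bullet> i)" for i y
      define F' where "F' i y = q \<delta> y * (g y \<bullet> i * \<psi>1 i y)
        + q' \<delta> y * ((dg y \<bullet> i) * (g y \<bullet> i) * \<psi> y) + q \<delta> y * \<psi> y * h i y" for i y
      have Fpd: "has_pd i (F i) (F' i y) y" if i: "i \<in> Basis" for i y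
      proof (cases "y \<in> W \<and> d y > 0")
        case True
        have "has_pd i (F i) ((q' \<delta> y * (dg y \<bullet> i) * \<psi> y + q \<delta> y * \<psi>1 i y) * (g y \<bullet> i)
           + (q \<delta> y * \<psi> y) * h i y) y"
          unfolding F_def using True i del by (intro has_pd_mult qpd p1 h) auto
        then show ?thesis unfolding F'_def by (simp add: algebra_simps)
      next
        case False
        define U where "U = (if y \<in> W then {z. d z < \<delta>} else - K)"
        have "open U" unfolding U_def using clK cd
          by (auto intro!: open_Collect_less continuous_intros)
        moreover have "y \<in> U" using False del K unfolding U_def by auto
        moreover have "F i z = 0" if "z \<in> U" for z
          using that q0(1)[OF del, of z] p0[of z] unfolding U_def F_def by (auto split: if_splits)
        ultimately have "has_pd i (F i) 0 y"
          by (intro has_pd_cong_open[OF has_pd_const[of i 0]]) auto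
        moreover have "F' i y = 0"
        proof (cases "y \<in> W")
          case True
          then have "d y \<le> \<delta>" using False del by auto
          then show ?thesis using q0[OF del] by (simp add: F'_def)
        next
          case f: False
          then have "y \<notin> K" using K by auto
          then show ?thesis using p0 p10 i by (simp add: F'_def)
        qed
        ultimately show ?thesis by simp
      qed
      have cFF: "continuous_on UNIV (F i) \<and> continuous_on UNIV (F' i)" if i: "i \<in> Basis" for i
      proof -
        have c1: "continuous_on UNIV (F i)"
        proof -
          have "continuous_on UNIV (\<lambda>y. q \<delta> y * (g y \<bullet> i * \<psi> y))"
            by (intro continuous_on_mult cq(1)[OF del] cms[OF cgi cp p0])
          then show ?thesis by (simp add: F_def[abs_def] algebra_simps)
        qed
        have c2: "continuous_on UNIV (F' i)"
        proof (rule continuous_on_UNIV_local)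
          fix y
          have op: "open {z\<in>W. d z > 0}"
            using W cd by (auto intro!: open_Collect_conj open_Collect_less continuous_intros)
          show "\<exists>U. open U \<and> y \<in> U \<and> continuous_on U (F' i)"
          proof (cases "y \<in> W \<and> d y > 0")
            case True
            have sub: "{z\<in>W. d z > 0} \<subseteq> W" by auto
            have "continuous_on {z\<in>W. d z > 0} (F' i)"
              unfolding F'_def
              by (intro continuous_intros ch i continuous_on_subset[OF cg sub]
                  continuous_on_subset[OF cdg sub] continuous_on_subset[OF cq(1)[OF del]]
                  continuous_on_subset[OF cq(2)[OF del]] continuous_on_subset[OF cp]
                  continuous_on_subset[OF cp1[OF i]]) auto
            then show ?thesis using op True by blast
          next
            case False
            define U where "U = (if y \<in> W then {z. d z < \<delta>} else - K)"
            have "open U" unfolding U_def using clK cd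
              by (auto intro!: open_Collect_less continuous_intros)
            moreover have "y \<in> U" using False del K unfolding U_def by auto
            moreover have z: "F' i z = 0" if "z \<in> U" for z
              using that q0[OF del, of z] p0[of z] p10[OF i, of z] unfolding U_def F'_def
              by (auto split: if_splits)
            moreover have "continuous_on U (F' i)"
              using continuous_on_eq[of U "\<lambda>z. 0::real" "F' i"] z by simp
            ultimately show ?thesis by blast
          qed
        qed
        show ?thesis using c1 c2 by simp
      qed
      have F0: "F i y = 0" "F' i y = 0" if "i \<in> Basis" "y \<notin> K" for i y
        using that p0 p10 by (simp_all add: F_def F'_def)
      have "(\<integral>y. F' i y \<partial>lborel) = 0" if "i \<in> Basis" for i
        by (rule integral_pd_eq_0[OF Fpd[OF that] _ _ K(1)]) (use cFF F0 that in auto)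
      moreover have "integrable lborel (F' i)" if "i \<in> Basis" for i
        by (rule integrable_compact_support[OF _ K(1)]) (use cFF F0 that in auto)
      ultimately have "(\<integral>y. (\<Sum>i\<in>Basis. F' i y) \<partial>lborel) = 0"
        by (simp add: Bochner_Integration.integral_sum)
      moreover have "(\<Sum>i\<in>Basis. F' i y) = q \<delta> y * f y + q' \<delta> y * r y" for y
      proof -
        have "q \<delta> y * \<psi> y * (\<Sum>i\<in>Basis. h i y) = 0"
        proof (cases "y \<in> K \<and> d y > 0")
          case True
          then show ?thesis using harm[of y] K by auto
        next
          case False
          then show ?thesis using p0[of y] q0(1)[OF del, of y] del by auto
        qed
        moreover have "(\<Sum>i\<in>Basis. (dg y \<bullet> i) * (g y \<bullet> i) * \<psi> y) = r y"
          unfolding r_def by (simp add: euclidean_inner[of "dg y" "g y"] sum_distrib_right)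
        ultimately show ?thesis
          unfolding F'_def f_def by (simp add: sum.distrib sum_distrib_left[symmetric])
      qed
      ultimately have "(\<integral>y. q \<delta> y * f y + q' \<delta> y * r y \<partial>lborel) = 0" by simp
      then show ?thesis using qf_int[OF del] qr_int[OF del] by simp
    qed
    obtain M where M: "M > 0" "\<And>y. \<bar>\<psi> y\<bar> \<le> M"
      using bounded_of_compact_support[OF cp K(1) p0] by blast
    have "bounded (dg ` K)"
      using K by (intro compact_imp_bounded compact_continuous_image continuous_on_subset[OF cdg]) auto
    then obtain L where L: "L > 0" "\<And>y. y \<in> K \<Longrightarrow> norm (dg y) \<le> L"
      by (auto simp: bounded_pos)
    obtain V where V: "V \<ge> 0" "\<And>\<delta>. 0 < \<delta> \<Longrightarrow> \<delta> \<le> 1 \<Longrightarrow>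
        measure lebesgue {y\<in>K. \<delta> < d y \<and> d y < 3 * \<delta>} \<le> V * \<delta>"
      using strip_measure[OF K(1) cd shift] by blast
    have est: "\<exists>\<delta>0>0. \<forall>\<delta>. 0 < \<delta> \<and> \<delta> \<le> \<delta>0 \<longrightarrow> \<bar>\<integral>y. q' \<delta> y * r y \<partial>lborel\<bar> \<le> 2 * L * M * V * \<epsilon>"
      if "\<epsilon> > 0" for \<epsilon>
    proof -
      obtain \<delta>1 where d1: "\<delta>1 > 0" "\<And>y. y \<in> K \<Longrightarrow> d y \<le> \<delta>1 \<Longrightarrow> norm (g y) \<le> \<epsilon>"
      proof -
        have "\<exists>\<delta>>0. \<forall>y\<in>K. d y \<le> \<delta> \<longrightarrow> norm (g y) \<le> \<epsilon>"
          using K g0 \<open>\<epsilon> > 0\<close> continuous_on_subset[OF cg K(2)] continuous_on_subset[OF cd, of K]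
          by (intro uniformly_small_near_zero_set) auto
        then show ?thesis using that by blast
      qed
      \<comment> \<open>The bound \<delta>1 / 3 puts the whole strip d < 3\<delta> into the region
        where \<open>norm (g y)\<close> is at most \<epsilon>.\<close>
      have "\<bar>\<integral>y. q' \<delta> y * r y \<partial>lborel\<bar> \<le> 2 * L * M * V * \<epsilon>"
        if del: "0 < \<delta>" "\<delta> \<le> min 1 (\<delta>1 / 3)" for \<delta>
      proof -
        define T where "T = {y\<in>K. \<delta> < d y \<and> d y < 3 * \<delta>}"
        have "open {y. \<delta> < d y \<and> d y < 3 * \<delta>}"
          using cd by (auto intro!: open_Collect_conj open_Collect_less continuous_intros)
        then have "K \<inter> {y. \<delta> < d y \<and> d y < 3 * \<delta>} \<in> sets borel"
          using clK by (intro sets.Int) auto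
        moreover have Teq: "T = K \<inter> {y. \<delta> < d y \<and> d y < 3 * \<delta>}" by (auto simp: T_def)
        ultimately have Tm: "T \<in> sets borel" by simp
        have "emeasure lborel T < \<infinity>"
          using K(1) Tm by (intro emeasure_bounded_finite bounded_subset[OF compact_imp_bounded[OF K(1)]]) (auto simp: T_def)
        then have Ti: "integrable lborel (\<lambda>y. indicator T y :: real)"
          using Tm by (simp add: integrable_indicator_iff)
        \<comment> \<open>Supremum of |q'| times supremum of |r| on the strip; its factor 1/\<delta>
          cancels against the measure \<open>V * \<delta>\<close>.\<close>
        define B where "B = 2 / \<delta> * (L * \<epsilon> * M)"
        have b: "\<bar>q' \<delta> y * r y\<bar> \<le> B * indicator T y" for y
        proof (cases "y \<in> T")
          case True
          then have y: "y \<in> K" "d y \<le> \<delta>1" using del by (auto simp: T_def)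
          have "\<bar>dg y \<bullet> g y\<bar> \<le> norm (dg y) * norm (g y)" by (rule Cauchy_Schwarz_ineq2)
          also have "\<dots> \<le> L * \<epsilon>" using L d1 y by (intro mult_mono) auto
          finally have "\<bar>r y\<bar> \<le> L * \<epsilon> * M" unfolding r_def abs_mult using M \<open>\<epsilon> > 0\<close> L
            by (intro mult_mono) auto
          then have "\<bar>q' \<delta> y * r y\<bar> \<le> B" using q'b[OF del(1), of y] del(1) unfolding B_def abs_mult
            by (intro mult_mono) auto
          then show ?thesis using True by simp
        next
          case False
          then consider "y \<notin> K" | "d y \<le> \<delta>" | "d y \<ge> 3 * \<delta>" unfolding T_def by fastforce
          then have "r y = 0 \<or> q' \<delta> y = 0"
            using r0 q0(2)[OF del(1)] q'0[OF del(1)] by cases auto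
          then show ?thesis using False by auto
        qed
        have "\<bar>\<integral>y. q' \<delta> y * r y \<partial>lborel\<bar> \<le> (\<integral>y. \<bar>q' \<delta> y * r y\<bar> \<partial>lborel)"
          by (rule integral_abs_bound)
        also have "\<dots> \<le> (\<integral>y. B * indicator T y \<partial>lborel)"
          using qr_int[OF del(1)] Ti b by (intro integral_mono) auto
        also have "\<dots> = B * measure lebesgue T"
          using Tm by (simp add: measure_completion)
        also have "\<dots> \<le> B * (V * \<delta>)"
          using V(2)[of \<delta>] del L M \<open>\<epsilon> > 0\<close> unfolding T_def B_def by (intro mult_left_mono) auto
        also have "\<dots> = 2 * L * M * V * \<epsilon>" using del unfolding B_def by simp
        finally show ?thesis .
      qed
      then show ?thesis using d1(1) by (intro exI[of _ "min 1 (\<delta>1 / 3)"]) auto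
    qed
    define \<delta> where "\<delta> j = 1 / real (Suc j)" for j
    have dpos: "\<delta> j > 0" for j by (simp add: \<delta>_def)
    have dlim: "\<delta> \<longlonglongrightarrow> 0" unfolding \<delta>_def[abs_def] using LIMSEQ_Suc[OF lim_1_over_n] by simp
    have "(\<lambda>j. \<integral>y. q' (\<delta> j) y * r y \<partial>lborel) \<longlonglongrightarrow> 0"
    proof (rule LIMSEQ_I)
      fix \<epsilon> :: real assume "\<epsilon> > 0"
      \<comment> \<open>The added 1 keeps the denominator positive when \<open>V\<close> is
        0.\<close>
      define \<epsilon>' where "\<epsilon>' = \<epsilon> / (2 * (2 * L * M * V + 1))"
      have pos: "0 < 2 * L * M * V + 1" using L M V by (intro add_nonneg_pos) auto
      then have "\<epsilon>' > 0" unfolding \<epsilon>'_def using \<open>\<epsilon> > 0\<close> by simp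
      then obtain \<delta>0 where d0: "\<delta>0 > 0"
        "\<And>\<delta>. 0 < \<delta> \<Longrightarrow> \<delta> \<le> \<delta>0 \<Longrightarrow> \<bar>\<integral>y. q' \<delta> y * r y \<partial>lborel\<bar> \<le> 2 * L * M * V * \<epsilon>'"
        using est[OF \<open>\<epsilon>' > 0\<close>] by auto
      have "2 * L * M * V * \<epsilon>' \<le> (2 * L * M * V + 1) * \<epsilon>'" using \<open>\<epsilon>' > 0\<close> by (simp add: algebra_simps)
      also have "\<dots> = \<epsilon> / 2" unfolding \<epsilon>'_def using pos by (simp add: field_simps)
      finally have sm: "2 * L * M * V * \<epsilon>' < \<epsilon>" using \<open>\<epsilon> > 0\<close> by linarith
      have "eventually (\<lambda>j. \<delta> j < \<delta>0) sequentially"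
        using dlim d0(1) by (simp add: order_tendstoD(2))
      then obtain N where N: "\<And>j. j \<ge> N \<Longrightarrow> \<delta> j < \<delta>0" by (auto simp: eventually_sequentially)
      show "\<exists>N. \<forall>j\<ge>N. norm ((\<integral>y. q' (\<delta> j) y * r y \<partial>lborel) - 0) < \<epsilon>"
      proof (intro exI[of _ N] allI impI)
        fix j assume "N \<le> j"
        then have "\<delta> j \<le> \<delta>0" using N[of j] by simp
        then show "norm ((\<integral>y. q' (\<delta> j) y * r y \<partial>lborel) - 0) < \<epsilon>"
          using d0(2)[OF dpos, of j] sm by simp
      qed
    qed
    from tendsto_minus[OF this] have l1: "(\<lambda>j. \<integral>y. q (\<delta> j) y * f y \<partial>lborel) \<longlonglongrightarrow> 0"
      unfolding key[OF dpos] by simp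
    \<comment> \<open>The limit is twice \<open>f\<close>: \<open>step2\<close> ends at 2, and where
      d \<le> 0 the gradient \<open>g\<close>, hence \<open>f\<close>, vanishes.\<close>
    have "(\<lambda>j. \<integral>y. q (\<delta> j) y * f y \<partial>lborel) \<longlonglongrightarrow> (\<integral>y. 2 * f y \<partial>lborel)"
    proof (rule integral_dominated_convergence[where w="\<lambda>y. 2 * \<bar>f y\<bar>"])
      show "(\<lambda>y. 2 * f y) \<in> borel_measurable lborel" using fint by simp
      show "(\<lambda>y. q (\<delta> j) y * f y) \<in> borel_measurable lborel" for j using qf_int[OF dpos] by simp
      show "integrable lborel (\<lambda>y. 2 * \<bar>f y\<bar>)" using fint by simp
      show "AE y in lborel. (\<lambda>j. q (\<delta> j) y * f y) \<longlonglongrightarrow> 2 * f y"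
      proof (rule AE_I2)
        fix y
        show "(\<lambda>j. q (\<delta> j) y * f y) \<longlonglongrightarrow> 2 * f y"
        proof (cases "y \<in> K \<and> d y > 0")
          case True
          have "eventually (\<lambda>j. \<delta> j < d y / 3) sequentially"
            by (rule order_tendstoD(2)[OF dlim]) (use True in simp)
          then have "eventually (\<lambda>j. 2 * f y = q (\<delta> j) y * f y) sequentially"
          proof eventually_elim
            case (elim j)
            then have "(d y - \<delta> j) / \<delta> j \<ge> 2" using dpos[of j] by (simp add: field_simps)
            then show ?case by (simp add: q_def step2_props)
          qed
          then show ?thesis by (rule Lim_transform_eventually[OF tendsto_const])
        next
          case False
          have "f y = 0"
            using False g0[of y] p10[of _ y] K unfolding f_def
            by (cases "y \<in> K") (auto intro!: sum.neutral)
          then show ?thesis by simp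
        qed
      qed
      show "AE y in lborel. norm (q (\<delta> j) y * f y) \<le> 2 * \<bar>f y\<bar>" for j
        using step2_props(5) by (auto simp: q_def abs_mult intro!: mult_right_mono)
    qed
    then have "(\<integral>y. 2 * f y \<partial>lborel) = 0" using l1 LIMSEQ_unique by blast
    then show ?thesis by simp
  qed
  ultimately show "(\<integral>y. H y * (\<Sum>i\<in>Basis. \<psi>2 i y) \<partial>lborel) = 0" by simp
qed

subsection \<open>Unique continuation\<close>

text \<open>One order smoother than \<open>step2\<close>, because the cutoff built from it enters
  test functions, which need two continuous derivatives. Its final value is 3! = 6, whence the
  factor 1/6 in \<open>smooth_cutoff\<close>.\<close>

definition step3 :: "real \<Rightarrow> real" where
  "step3 t = pos_power 3 t - 3 * pos_power 3 (t - 1) + 3 * pos_power 3 (t - 2) - pos_power 3 (t - 3)"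
definition step3' :: "real \<Rightarrow> real" where
  "step3' t = 3 * (pos_power 2 t - 3 * pos_power 2 (t - 1) + 3 * pos_power 2 (t - 2) - pos_power 2 (t - 3))"
definition step3'' :: "real \<Rightarrow> real" where
  "step3'' t = 6 * (pos_power 1 t - 3 * pos_power 1 (t - 1) + 3 * pos_power 1 (t - 2) - pos_power 1 (t - 3))"

lemma step3_deriv:
  "(step3 has_real_derivative step3' t) (at t)" "(step3' has_real_derivative step3'' t) (at t)"
proof -
  have "(pos_power 2 has_real_derivative 2 * pos_power 1 t) (at t)" for t
    using pos_power_deriv[of 0 t] by (simp add: numeral_2_eq_2)
  note * = this DERIV_chain2[OF this]
  have "(pos_power 3 has_real_derivative 3 * pos_power 2 t) (at t)" for t
    using pos_power_deriv[of 1 t] by (simp add: numeral_3_eq_3 numeral_2_eq_2)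
  note ** = this DERIV_chain2[OF this]
  show "(step3 has_real_derivative step3' t) (at t)" unfolding step3_def[abs_def] step3'_def
    by (rule derivative_eq_intros ** refl | simp)+
  show "(step3' has_real_derivative step3'' t) (at t)" unfolding step3'_def[abs_def] step3''_def
    by (rule derivative_eq_intros * refl | simp)+
qed

lemma continuous_on_step3:
  "continuous_on A step3" "continuous_on A step3'" "continuous_on A step3''"
  unfolding step3_def[abs_def] step3'_def[abs_def] step3''_def[abs_def]
  by (auto intro!: continuous_intros continuous_on_compose2[OF continuous_on_pos_power[of UNIV]])

lemma step3_props:
  shows "t \<le> 0 \<Longrightarrow> step3 t = 0" and "t \<ge> 3 \<Longrightarrow> step3 t = 6" and "step3 t \<ge> 0"
    and "t \<ge> 3 \<Longrightarrow> step3' t = 0" and "t \<ge> 3 \<Longrightarrow> step3'' t = 0"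
proof -
  show 1: "step3 t = 0" if "t \<le> 0" for t using that by (simp add: step3_def pos_power_def)
  show 2: "step3 t = 6" if "t \<ge> 3" for t using that
    by (simp add: step3_def pos_power_def max_absorb2) (simp add: power3_eq_cube algebra_simps)
  show "step3' t = 0" if "t \<ge> 3" using that
    by (simp add: step3'_def pos_power_def max_absorb2) (simp add: power2_eq_square algebra_simps)
  show "step3'' t = 0" if "t \<ge> 3" using that
    by (simp add: step3''_def pos_power_def max_absorb2)
  consider "t \<le> 0" | "0 < t" "t \<le> 1" | "1 < t" "t \<le> 2" | "2 < t" "t \<le> 3" | "3 < t" by linarith
  then show "step3 t \<ge> 0"
  proof cases
    case 3
    \<comment> \<open>Here t \<le> 2 means 2 (t - 1) \<le> t; cubing yields the factor 8, more than
      the 3 required.\<close>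
    have "(2 * (t - 1)) ^ 3 \<le> t ^ 3" using 3 by (intro power_mono) auto
    then have "8 * (t - 1) ^ 3 \<le> t ^ 3" unfolding power_mult_distrib by simp
    moreover have "(t - 1) ^ 3 \<ge> 0" using 3 by simp
    ultimately have "3 * (t - 1) ^ 3 \<le> t ^ 3" by linarith
    then show ?thesis using 3
      by (simp add: step3_def pos_power_def max_absorb1 max_absorb2 power_mult_distrib del: zero_le_power_eq)
  next
    case 4
    \<comment> \<open>The graph is point symmetric about t = 3/2, so the last piece mirrors the
      first one.\<close>
    then have "step3 t = 6 - (3 - t) ^ 3"
      by (simp add: step3_def pos_power_def max_absorb1 max_absorb2)
        (simp add: power3_eq_cube algebra_simps)
    moreover have "(3 - t) ^ 3 \<le> 1" using 4 by (intro power_le_one) auto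
    ultimately show ?thesis by simp
  qed (use 1 2 in \<open>simp_all add: step3_def pos_power_def\<close>)
qed

text \<open>The step is applied to a function of the squared norm, which is smooth at the centre.
  Both derivatives vanish on the closed inner ball, so kernels built from them are supported in an
  annulus.\<close>

lemma smooth_cutoff:
  fixes x0 :: "'a::euclidean_space"
  assumes "0 < \<rho>1" "\<rho>1 < \<rho>2"
  obtains \<eta> \<eta>1 \<eta>2 where
    "\<And>i y. i \<in> Basis \<Longrightarrow> has_pd i \<eta> (\<eta>1 i y) y"
    "\<And>i y. i \<in> Basis \<Longrightarrow> has_pd i (\<eta>1 i) (\<eta>2 i y) y"
    "continuous_on UNIV \<eta>" "\<And>i. continuous_on UNIV (\<eta>1 i)" "\<And>i. continuous_on UNIV (\<eta>2 i)"
    "\<And>y. 0 \<le> \<eta> y" "\<And>y. y \<notin> cball x0 \<rho>2 \<Longrightarrow> \<eta> y = 0"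
    "\<And>y. y \<in> cball x0 \<rho>1 \<Longrightarrow> \<eta> y = 1"
    "\<And>i y. y \<in> cball x0 \<rho>1 \<Longrightarrow> \<eta>1 i y = 0" "\<And>i y. y \<in> cball x0 \<rho>1 \<Longrightarrow> \<eta>2 i y = 0"
proof -
  \<comment> \<open>Scales \<open>t\<close> to run from 3 on the inner sphere to 0 on the outer one,
    the two ends of \<open>step3\<close>.\<close>
  define w where "w = 3 / (\<rho>2\<^sup>2 - \<rho>1\<^sup>2)"
  have "\<rho>1\<^sup>2 < \<rho>2\<^sup>2" using assms by (intro power_strict_mono) auto
  then have w: "w > 0" unfolding w_def by simp
  define t where "t y = w * (\<rho>2\<^sup>2 - (norm (y - x0))\<^sup>2)" for y
  define t1 where "t1 i y = w * (0 - 2 * ((y - x0) \<bullet> i))" for i y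
  define \<eta> where "\<eta> y = step3 (t y) * (1 / 6)" for y
  define \<eta>1 where "\<eta>1 i y = step3' (t y) * t1 i y * (1 / 6)" for i y
  define \<eta>2 where "\<eta>2 i y = (step3'' (t y) * t1 i y * t1 i y + step3' (t y) * (- 2 * w * (i \<bullet> i))) / 6" for i y
  have ct: "continuous_on UNIV t" "\<And>i. continuous_on UNIV (t1 i)"
    unfolding t_def t1_def by (intro continuous_intros)+
  have t1: "has_pd i t (t1 i y) y" for i y
  proof -
    have "has_pd i t (0 * (\<rho>2\<^sup>2 - (norm (y - x0))\<^sup>2) + w * (0 - 2 * ((y - x0) \<bullet> i))) y"
      unfolding t_def by (intro has_pd_mult has_pd_const has_pd_diff has_pd_norm2)
    then show ?thesis by (simp add: t1_def)
  qed
  have t2: "has_pd i (t1 i) (- 2 * w * (i \<bullet> i)) y" for i y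
  proof -
    have "has_pd i (t1 i) (0 * (0 - 2 * ((y - x0) \<bullet> i)) + w * (0 - (0 * ((y - x0) \<bullet> i) + 2 * (i \<bullet> i)))) y"
      unfolding t1_def by (intro has_pd_mult has_pd_const has_pd_diff has_pd_inner)
    then show ?thesis by (simp add: algebra_simps)
  qed
  have big: "t y \<ge> 3" if "y \<in> cball x0 \<rho>1" for y
  proof -
    have "(norm (y - x0))\<^sup>2 \<le> \<rho>1\<^sup>2"
      using that by (intro power_mono) (auto simp: dist_norm norm_minus_commute)
    then have "t y \<ge> w * (\<rho>2\<^sup>2 - \<rho>1\<^sup>2)" unfolding t_def using w by (intro mult_left_mono) auto
    moreover have "3 / c * c = 3" if "0 < c" for c :: real using that by simp
    from this[of "\<rho>2\<^sup>2 - \<rho>1\<^sup>2"] have "w * (\<rho>2\<^sup>2 - \<rho>1\<^sup>2) = 3" using \<open>\<rho>1\<^sup>2 < \<rho>2\<^sup>2\<close> unfolding w_def by linarith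
    ultimately show ?thesis by simp
  qed
  have small: "t y \<le> 0" if "y \<notin> cball x0 \<rho>2" for y
  proof -
    have "(norm (y - x0))\<^sup>2 \<ge> \<rho>2\<^sup>2"
      using that assms by (intro power_mono) (auto simp: dist_norm norm_minus_commute)
    then show ?thesis unfolding t_def using w by (simp add: mult_nonneg_nonpos)
  qed
  show thesis
  proof (rule that[of \<eta> \<eta>1 \<eta>2])
    show "has_pd i \<eta> (\<eta>1 i y) y" for i y
    proof -
      have "has_pd i \<eta> (step3' (t y) * t1 i y * (1 / 6) + step3 (t y) * 0) y"
        unfolding \<eta>_def by (intro has_pd_mult has_pd_chain[OF step3_deriv(1) t1] has_pd_const)
      then show ?thesis by (simp add: \<eta>1_def)
    qed
    show "has_pd i (\<eta>1 i) (\<eta>2 i y) y" for i y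
    proof -
      have "has_pd i (\<eta>1 i) ((step3'' (t y) * t1 i y * t1 i y + step3' (t y) * (- 2 * w * (i \<bullet> i))) * (1 / 6)
         + (step3' (t y) * t1 i y) * 0) y"
        unfolding \<eta>1_def by (intro has_pd_mult has_pd_chain[OF step3_deriv(2) t1] t2 has_pd_const)
      then show ?thesis by (simp add: \<eta>2_def)
    qed
    note cs = continuous_on_compose2[OF continuous_on_step3(1)[of UNIV]]
      continuous_on_compose2[OF continuous_on_step3(2)[of UNIV]]
      continuous_on_compose2[OF continuous_on_step3(3)[of UNIV]]
    show "continuous_on UNIV \<eta>" "continuous_on UNIV (\<eta>1 i)" "continuous_on UNIV (\<eta>2 i)" for i
      unfolding \<eta>_def \<eta>1_def \<eta>2_def by (intro continuous_intros cs ct; simp)+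
  qed (use step3_props big small in \<open>auto simp: \<eta>_def \<eta>1_def \<eta>2_def\<close>)
qed

section \<open>Local representation of weakly harmonic functions by a Newton kernel\<close>

lemma weakly_harmonic_on_const: "weakly_harmonic_on W (\<lambda>_. k)"
  unfolding weakly_harmonic_on_def
proof (intro conjI allI impI continuous_on_const)
  fix K :: "'a set" and \<psi> and \<psi>1 \<psi>2 :: "'a \<Rightarrow> 'a \<Rightarrow> real"
  assume A: "compact K \<and> K \<subseteq> W \<and> (\<forall>y. y \<notin> K \<longrightarrow> \<psi> y = 0) \<and> continuous_on UNIV \<psi> \<and>
        (\<forall>i\<in>Basis. continuous_on UNIV (\<psi>1 i) \<and> continuous_on UNIV (\<psi>2 i)) \<and>
        (\<forall>i\<in>Basis. \<forall>y. has_pd i \<psi> (\<psi>1 i y) y \<and> has_pd i (\<psi>1 i) (\<psi>2 i y) y)"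
  have K: "compact K" "closed K" using A compact_imp_closed by auto
  have p10: "\<psi>1 i y = 0" if "i \<in> Basis" "y \<notin> K" for i y
    using has_pd_zero_outside[of i \<psi> "\<psi>1 i y" y K] that A K by auto
  have p20: "\<psi>2 i y = 0" if "i \<in> Basis" "y \<notin> K" for i y
    using has_pd_zero_outside[of i "\<psi>1 i" "\<psi>2 i y" y K] that A K p10 by auto
  have "(\<integral>y. \<psi>2 i y \<partial>lborel) = 0" if "i \<in> Basis" for i
    by (rule integral_pd_eq_0[where f="\<psi>1 i" and K=K and i=i]) (use A that p10 in auto)
  moreover have "integrable lborel (\<psi>2 i)" if "i \<in> Basis" for i
    by (rule integrable_compact_support[OF _ K(1)]) (use A that p20 in auto)
  ultimately show "(\<integral>y. k * (\<Sum>i\<in>Basis. \<psi>2 i y) \<partial>lborel) = 0"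
    by (simp add: Bochner_Integration.integral_sum)
qed

text \<open>For \<open>a = 1 - N/2\<close> the power \<open>(|y - x|\<^sup>2 + s)\<^sup>a\<close> is a regularised Newton kernel, whose Laplacian is an
  approximate identity up to a constant.\<close>

lemma has_pd_kernel:
  assumes "s > 0"
  shows "has_pd i (\<lambda>y. ((norm (y - x))\<^sup>2 + s) powr a) (2 * a * ((norm (y - x))\<^sup>2 + s) powr (a - 1) * ((y - x) \<bullet> i)) y"
proof -
  have pos: "(norm (y - x))\<^sup>2 + s > 0" using assms by (simp add: add_nonneg_pos)
  have "((\<lambda>q. q powr a) has_real_derivative a * ((norm (y - x))\<^sup>2 + s) powr (a - 1)) (at ((norm (y - x))\<^sup>2 + s))"
    using has_real_derivative_powr[OF pos] .
  from has_pd_chain[where f="\<lambda>y. (norm (y - x))\<^sup>2 + s", OF this has_pd_add[OF has_pd_norm2 has_pd_const]]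
  show ?thesis by (simp add: algebra_simps)
qed

lemma has_pd_kernel2:
  assumes "s > 0"
  shows "has_pd i (\<lambda>y. 2 * a * ((norm (y - x))\<^sup>2 + s) powr (a - 1) * ((y - x) \<bullet> i))
     (4 * a * (a - 1) * ((norm (y - x))\<^sup>2 + s) powr (a - 2) * ((y - x) \<bullet> i)\<^sup>2
       + 2 * a * ((norm (y - x))\<^sup>2 + s) powr (a - 1) * (i \<bullet> i)) y"
proof -
  have "has_pd i (\<lambda>y. 2 * a * ((norm (y - x))\<^sup>2 + s) powr (a - 1) * ((y - x) \<bullet> i))
    ((0 * ((norm (y - x))\<^sup>2 + s) powr (a - 1) + 2 * a *
       (2 * (a - 1) * ((norm (y - x))\<^sup>2 + s) powr (a - 1 - 1) * ((y - x) \<bullet> i))) * ((y - x) \<bullet> i)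
       + 2 * a * ((norm (y - x))\<^sup>2 + s) powr (a - 1) * (i \<bullet> i)) y"
    by (intro has_pd_mult has_pd_const has_pd_kernel assms has_pd_inner)
  then show ?thesis by (simp add: algebra_simps power2_eq_square)
qed

text \<open>The choice of \<open>a\<close> gives 2 (a - 1) = - N. After extracting
  \<open>Q powr (a - 2)\<close>, the coefficients of \<open>Q\<close> and of the squared norm are
  then opposite, and only the difference \<open>s\<close> remains.\<close>

lemma kernel_laplacian:
  fixes x y :: "'a::euclidean_space"
  assumes s: "s > 0" and a: "a = 1 - real DIM('a) / 2"
  shows "(\<Sum>i\<in>Basis. 4 * a * (a - 1) * ((norm (y - x))\<^sup>2 + s) powr (a - 2) * ((y - x) \<bullet> i)\<^sup>2
       + 2 * a * ((norm (y - x))\<^sup>2 + s) powr (a - 1) * (i \<bullet> i))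
     = 2 * a * real DIM('a) * s * ((norm (y - x))\<^sup>2 + s) powr (a - 2)"
proof -
  define Q where "Q = (norm (y - x))\<^sup>2 + s"
  have Q: "Q > 0" using s by (simp add: Q_def add_nonneg_pos)
  have "(\<Sum>i\<in>Basis. ((y - x) \<bullet> i)\<^sup>2) = (norm (y - x))\<^sup>2"
    unfolding power2_norm_eq_inner by (simp add: euclidean_inner[of "y - x" "y - x"] power2_eq_square)
  then have "(\<Sum>i\<in>Basis. 4 * a * (a - 1) * Q powr (a - 2) * ((y - x) \<bullet> i)\<^sup>2 + 2 * a * Q powr (a - 1) * (i \<bullet> i))
    = 4 * a * (a - 1) * Q powr (a - 2) * (norm (y - x))\<^sup>2 + 2 * a * Q powr (a - 1) * real DIM('a)"
    by (simp add: sum.distrib sum_distrib_left[symmetric])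
  also have "\<dots> = 4 * a * (a - 1) * Q powr (a - 2) * (norm (y - x))\<^sup>2 + 2 * a * (Q powr (a - 2) * Q) * real DIM('a)"
    using Q powr_add[of Q "a - 2" 1] by simp
  also have "\<dots> = 2 * a * real DIM('a) * Q powr (a - 2) * (Q - (norm (y - x))\<^sup>2)"
    unfolding a by (simp add: field_simps)
  finally show ?thesis unfolding Q_def by (simp only: add_diff_cancel_left' mult_ac)
qed

text \<open>Test with the cut-off regularised Newton kernel and let the regularisation tend to zero. The kernel
  of the resulting integral is supported in an annulus, hence real analytic in \<open>x\<close>.\<close>

lemma weakly_harmonic_representation:
  fixes x0 :: "'a::euclidean_space"
  assumes dim: "DIM('a) \<ge> 3" and W: "open W" "cball x0 \<rho>2 \<subseteq> W" and rho: "0 < \<rho>1" "\<rho>1 < \<rho>2"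
  obtains \<alpha> :: "'a \<Rightarrow> real" and \<beta> :: "'a \<Rightarrow> 'a" and a :: real where
    "continuous_on UNIV \<alpha>" "continuous_on UNIV \<beta>"
    "\<And>y. y \<in> cball x0 \<rho>1 \<or> y \<notin> cball x0 \<rho>2 \<Longrightarrow> \<alpha> y = 0"
    "\<And>y. y \<in> cball x0 \<rho>1 \<or> y \<notin> cball x0 \<rho>2 \<Longrightarrow> \<beta> y = 0"
    "\<And>x. x \<in> ball x0 \<rho>1 \<Longrightarrow> \<exists>c>0. \<forall>H. weakly_harmonic_on W H \<longrightarrow>
      H x * c = (\<integral>y. H y * (\<alpha> y * (norm (y - x))\<^sup>2 powr a
        + (\<beta> y \<bullet> (y - x)) * (norm (y - x))\<^sup>2 powr (a - 1)) \<partial>lborel)"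
proof -
  obtain \<eta> :: "'a \<Rightarrow> real" and \<eta>1 \<eta>2 where
    e1: "\<And>i y. i \<in> Basis \<Longrightarrow> has_pd i \<eta> (\<eta>1 i y) y" and
    e2: "\<And>i y. i \<in> Basis \<Longrightarrow> has_pd i (\<eta>1 i) (\<eta>2 i y) y" and
    ce: "continuous_on UNIV \<eta>" "\<And>i. continuous_on UNIV (\<eta>1 i)" "\<And>i. continuous_on UNIV (\<eta>2 i)" and
    enn: "\<And>y. 0 \<le> \<eta> y" and e0: "\<And>y. y \<notin> cball x0 \<rho>2 \<Longrightarrow> \<eta> y = 0" and
    eone: "\<And>y. y \<in> cball x0 \<rho>1 \<Longrightarrow> \<eta> y = 1" and
    e1in: "\<And>i y. y \<in> cball x0 \<rho>1 \<Longrightarrow> \<eta>1 i y = 0" and e2in: "\<And>i y. y \<in> cball x0 \<rho>1 \<Longrightarrow> \<eta>2 i y = 0"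
    using smooth_cutoff[OF rho, of x0] by blast
  define K where "K = cball x0 \<rho>2"
  have K: "compact K" "K \<subseteq> W" using W by (auto simp: K_def)
  have e10: "\<eta>1 i y = 0" if "i \<in> Basis" "y \<notin> K" for i y
    using has_pd_zero_outside[OF e1[OF that(1)] compact_imp_closed[OF K(1)] that(2)] e0 by (auto simp: K_def)
  have e20: "\<eta>2 i y = 0" if "i \<in> Basis" "y \<notin> K" for i y
    using has_pd_zero_outside[OF e2[OF that(1)] compact_imp_closed[OF K(1)] that(2)] e10 that by auto
  define a where "a = 1 - real DIM('a) / 2"
  have a: "a < 0" using dim by (simp add: a_def)
  define \<alpha> where "\<alpha> y = (\<Sum>i\<in>Basis. \<eta>2 i y)" for y
  \<comment> \<open>4 a = 2 (2 a): the 2 comes from the cross term of the product rule, the 2 a from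
    the gradient of \<open>Q powr a\<close>.\<close>
  define \<beta> where "\<beta> y = (4 * a) *\<^sub>R (\<Sum>i\<in>Basis. \<eta>1 i y *\<^sub>R i)" for y
  have cab: "continuous_on UNIV \<alpha>" "continuous_on UNIV \<beta>"
    unfolding \<alpha>_def \<beta>_def by (intro continuous_intros ce)+
  have ab0: "\<alpha> y = 0" "\<beta> y = 0" if "y \<in> cball x0 \<rho>1 \<or> y \<notin> K" for y
    using that e10 e20 e1in e2in by (auto simp: \<alpha>_def \<beta>_def)
  define Q where "Q x s y = (norm (y - x))\<^sup>2 + s" for x y :: 'a and s :: real
  \<comment> \<open>The Laplacian of \<eta> Q^a is k - P: in \<open>k\<close> some derivative falls
    on \<eta>, in \<open>P\<close> none. As s tends to 0, \<open>k\<close> stays regular for x in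
    the inner ball, while \<open>P\<close> concentrates at x.\<close>
  define k where "k x s y = \<alpha> y * Q x s y powr a + (\<beta> y \<bullet> (y - x)) * Q x s y powr (a - 1)" for x s y
  define P where "P x s y = \<eta> y * (- (2 * a * real DIM('a))) * s * Q x s y powr (a - 2)" for x s y
  have Qpos: "Q x s y > 0" if "s > 0" for x s y using that by (simp add: Q_def add_nonneg_pos)
  have cQ: "continuous_on UNIV (\<lambda>y. Q x s y powr b)" if "s > 0" for x s b
    using Qpos[OF that, of x] unfolding Q_def by (intro continuous_intros) (simp add: less_imp_neq[THEN not_sym])
  have ck: "continuous_on UNIV (k x s)" "continuous_on UNIV (P x s)" if "s > 0" for x s
  proof -
    show "continuous_on UNIV (k x s)" unfolding k_def[abs_def]
      by (intro continuous_on_add continuous_on_mult cQ[OF that] cab continuous_intros)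
    show "continuous_on UNIV (P x s)" unfolding P_def[abs_def]
      by (intro continuous_on_mult cQ[OF that] ce continuous_on_const)
  qed
  have k0: "k x s y = 0" "P x s y = 0" if "y \<notin> K" for x s y
    using that ab0 e0 by (auto simp: k_def P_def K_def)
  have Pnn: "P x s y \<ge> 0" if "s > 0" for x s y
    unfolding P_def using enn that a by (auto intro!: mult_nonneg_nonneg mult_nonpos_nonneg)
  have ckH: "continuous_on UNIV (\<lambda>y. H y * k x s y)" "continuous_on UNIV (\<lambda>y. H y * P x s y)"
    if "s > 0" "continuous_on W H" for H x s
    using continuous_on_mult_compact_support[OF W(1) that(2) ck(1)[OF that(1)] K k0(1)]
      continuous_on_mult_compact_support[OF W(1) that(2) ck(2)[OF that(1)] K k0(2)] by auto
  have intk: "integrable lborel (\<lambda>y. H y * k x s y)" "integrable lborel (\<lambda>y. H y * P x s y)"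
    if "s > 0" "continuous_on W H" for H x s
    using integrable_compact_support[OF ckH(1)[OF that] K(1)] integrable_compact_support[OF ckH(2)[OF that] K(1)]
      k0 by simp_all
  have id: "(\<integral>y. H y * P x s y \<partial>lborel) = (\<integral>y. H y * k x s y \<partial>lborel)"
    if "s > 0" and H: "weakly_harmonic_on W H" for H x s
  proof -
    define \<phi> where "\<phi> y = Q x s y powr a" for y
    define \<phi>1 where "\<phi>1 i y = 2 * a * Q x s y powr (a - 1) * ((y - x) \<bullet> i)" for i y
    define \<phi>2 where "\<phi>2 i y = 4 * a * (a - 1) * Q x s y powr (a - 2) * ((y - x) \<bullet> i)\<^sup>2
       + 2 * a * Q x s y powr (a - 1) * (i \<bullet> i)" for i y
    have p1: "has_pd i \<phi> (\<phi>1 i y) y" for i y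
      unfolding \<phi>_def[abs_def] \<phi>1_def Q_def by (rule has_pd_kernel[OF that(1)])
    have p2: "has_pd i (\<phi>1 i) (\<phi>2 i y) y" for i y
      unfolding \<phi>1_def[abs_def] \<phi>2_def Q_def by (rule has_pd_kernel2[OF that(1)])
    have cphi: "continuous_on UNIV \<phi>" "continuous_on UNIV (\<phi>1 i)" "continuous_on UNIV (\<phi>2 i)" for i
      unfolding \<phi>_def \<phi>1_def \<phi>2_def by (intro continuous_intros cQ that)+
    define \<psi>2 where "\<psi>2 i y = \<eta>2 i y * \<phi> y + \<eta>1 i y * \<phi>1 i y + (\<eta>1 i y * \<phi>1 i y + \<eta> y * \<phi>2 i y)" for i y
    have "(\<integral>y. H y * (\<Sum>i\<in>Basis. \<psi>2 i y) \<partial>lborel) = 0"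
      using H unfolding weakly_harmonic_on_def
    proof (elim conjE allE impE)
      let ?p = "\<lambda>y. \<eta> y * \<phi> y" and ?p1 = "\<lambda>i y. \<eta>1 i y * \<phi> y + \<eta> y * \<phi>1 i y"
      show "compact K \<and> K \<subseteq> W \<and> (\<forall>y. y \<notin> K \<longrightarrow> ?p y = 0) \<and> continuous_on UNIV ?p \<and>
        (\<forall>i\<in>Basis. continuous_on UNIV (?p1 i) \<and> continuous_on UNIV (\<psi>2 i)) \<and>
        (\<forall>i\<in>Basis. \<forall>y. has_pd i ?p (?p1 i y) y \<and> has_pd i (?p1 i) (\<psi>2 i y) y)"
      proof (intro conjI ballI allI K)
        show "y \<notin> K \<longrightarrow> ?p y = 0" for y using e0 by (simp add: K_def)
        show "continuous_on UNIV ?p" by (intro continuous_intros ce cphi)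
        show "continuous_on UNIV (?p1 i)" "continuous_on UNIV (\<psi>2 i)" for i
          unfolding \<psi>2_def by (intro continuous_intros ce cphi)+
        show "has_pd i ?p (?p1 i y) y" if "i \<in> Basis" for i y
          by (intro has_pd_mult e1 p1 that)
        show "has_pd i (?p1 i) (\<psi>2 i y) y" if "i \<in> Basis" for i y
          unfolding \<psi>2_def by (intro has_pd_add has_pd_mult e1 e2 p1 p2 that)
      qed
    qed
    moreover have "(\<Sum>i\<in>Basis. \<psi>2 i y) = k x s y - P x s y" for y
    proof -
      have "(\<Sum>i\<in>Basis. \<phi>2 i y) = 2 * a * real DIM('a) * s * Q x s y powr (a - 2)"
        using kernel_laplacian[OF that(1) a_def, of y x] by (simp add: \<phi>2_def Q_def)
      then have "(\<Sum>i\<in>Basis. \<eta> y * \<phi>2 i y) = - P x s y"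
        by (simp add: sum_distrib_left[symmetric] P_def)
      moreover have "(\<Sum>i\<in>Basis. 2 * (\<eta>1 i y * \<phi>1 i y)) = (\<beta> y \<bullet> (y - x)) * Q x s y powr (a - 1)"
      proof -
        have "\<beta> y \<bullet> (y - x) = (\<Sum>i\<in>Basis. 4 * a * (\<eta>1 i y * ((y - x) \<bullet> i)))"
          unfolding \<beta>_def inner_scaleR_left inner_sum_left sum_distrib_left
          by (simp add: inner_commute)
        then show ?thesis
          by (simp only: sum_distrib_right \<phi>1_def) (auto intro!: sum.cong)
      qed
      moreover have "(\<Sum>i\<in>Basis. \<eta>2 i y * \<phi> y) = \<alpha> y * Q x s y powr a"
        by (simp add: \<alpha>_def \<phi>_def sum_distrib_right)
      moreover have "(\<Sum>i\<in>Basis. \<psi>2 i y) = (\<Sum>i\<in>Basis. \<eta>2 i y * \<phi> y) + (\<Sum>i\<in>Basis. 2 * (\<eta>1 i y * \<phi>1 i y)) + (\<Sum>i\<in>Basis. \<eta> y * \<phi>2 i y)"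
        by (simp add: \<psi>2_def sum.distrib algebra_simps)
      ultimately show ?thesis by (simp add: k_def)
    qed
    ultimately have "(\<integral>y. H y * k x s y - H y * P x s y \<partial>lborel) = 0"
      by (simp add: right_diff_distrib)
    then show ?thesis using intk[OF that(1), of H x] H unfolding weakly_harmonic_on_def by simp
  qed
  \<comment> \<open>A square, so that 1/(j + 1) is the length scale on which \<open>P\<close>
    concentrates.\<close>
  define s where "s j = (1 / real (Suc j))\<^sup>2" for j
  have spos: "s j > 0" for j by (simp add: s_def)
  have slim: "s \<longlonglongrightarrow> 0"
  proof -
    have "(\<lambda>j. 1 / real (Suc j)) \<longlonglongrightarrow> 0" by (rule LIMSEQ_Suc[OF lim_1_over_n])
    from tendsto_power[OF this, of 2] show ?thesis unfolding s_def[abs_def] by simp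
  qed
  have limk: "(\<lambda>j. \<integral>y. H y * k x (s j) y \<partial>lborel) \<longlonglongrightarrow> (\<integral>y. H y * k x 0 y \<partial>lborel)"
    if x: "x \<in> ball x0 \<rho>1" and cH: "continuous_on W H" for H x
  proof -
    \<comment> \<open>A lower bound, uniform in s, for \<open>Q\<close> off the inner ball; as the
      exponents are negative, it dominates the integrands.\<close>
    define \<mu> where "\<mu> = (\<rho>1 - dist x x0)\<^sup>2"
    have mu: "\<mu> > 0" using x by (simp add: \<mu>_def dist_commute)
    have Qb: "\<mu> \<le> Q x t y" if "y \<notin> cball x0 \<rho>1" "t \<ge> 0" for y t
    proof -
      have "\<rho>1 - dist x x0 \<le> norm (y - x)"
        using that dist_triangle[of x0 y x] by (simp add: dist_norm norm_minus_commute)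
      then have "\<mu> \<le> (norm (y - x))\<^sup>2" unfolding \<mu>_def using x by (intro power_mono) (auto simp: dist_commute)
      then show ?thesis using that by (simp add: Q_def)
    qed
    define w where "w y = H y * (\<bar>\<alpha> y\<bar> * \<mu> powr a + norm (\<beta> y) * norm (y - x) * \<mu> powr (a - 1))" for y
    have cw: "continuous_on UNIV w" unfolding w_def
      by (rule continuous_on_mult_compact_support[OF W(1) cH _ K]) (use ab0 in \<open>auto intro!: continuous_intros cab\<close>)
    have iw: "integrable lborel w"
      by (rule integrable_compact_support[OF cw K(1)]) (use ab0 in \<open>auto simp: w_def\<close>)
    have pw: "(\<lambda>j. k x (s j) y) \<longlonglongrightarrow> k x 0 y" for y
    proof (cases "y \<in> cball x0 \<rho>1")
      case True
      then show ?thesis using ab0 by (simp add: k_def)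
    next
      case False
      then have "Q x 0 y > 0" using Qb[of y 0] mu by simp
      moreover have "(\<lambda>j. Q x (s j) y) \<longlonglongrightarrow> Q x 0 y" unfolding Q_def by (intro tendsto_intros slim)
      ultimately show ?thesis unfolding k_def by (intro tendsto_intros) auto
    qed
    show ?thesis
    proof (rule integral_dominated_convergence[where w="\<lambda>y. \<bar>w y\<bar>"])
      show "(\<lambda>y. H y * k x (s j) y) \<in> borel_measurable lborel" for j
        using intk(1)[OF spos cH] by simp
      then show "(\<lambda>y. H y * k x 0 y) \<in> borel_measurable lborel"
        by (rule borel_measurable_LIMSEQ_real[where u="\<lambda>j y. H y * k x (s j) y", rotated])
          (intro tendsto_intros pw)
      show "integrable lborel (\<lambda>y. \<bar>w y\<bar>)" using iw by simp
      show "AE y in lborel. (\<lambda>j. H y * k x (s j) y) \<longlonglongrightarrow> H y * k x 0 y"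
        by (intro AE_I2 tendsto_intros pw)
      show "AE y in lborel. norm (H y * k x (s j) y) \<le> \<bar>w y\<bar>" for j
      proof (rule AE_I2)
        fix y
        show "norm (H y * k x (s j) y) \<le> \<bar>w y\<bar>"
        proof (cases "y \<in> cball x0 \<rho>1")
          case True
          then show ?thesis using ab0 by (simp add: k_def)
        next
          case False
          have q: "\<mu> \<le> Q x (s j) y" using Qb[OF False] spos less_imp_le by blast
          have "Q x (s j) y powr a \<le> \<mu> powr a" "Q x (s j) y powr (a - 1) \<le> \<mu> powr (a - 1)"
            using q mu a by (auto intro!: powr_mono2')
          moreover have "\<bar>\<beta> y \<bullet> (y - x)\<bar> \<le> norm (\<beta> y) * norm (y - x)" by (rule Cauchy_Schwarz_ineq2)
          ultimately have "\<bar>\<alpha> y\<bar> * Q x (s j) y powr a + \<bar>\<beta> y \<bullet> (y - x)\<bar> * Q x (s j) y powr (a - 1)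
            \<le> \<bar>\<alpha> y\<bar> * \<mu> powr a + norm (\<beta> y) * norm (y - x) * \<mu> powr (a - 1)"
            by (intro add_mono mult_mono) auto
          moreover have "\<bar>k x (s j) y\<bar> \<le> \<bar>\<alpha> y\<bar> * Q x (s j) y powr a + \<bar>\<beta> y \<bullet> (y - x)\<bar> * Q x (s j) y powr (a - 1)"
            unfolding k_def by (rule order_trans[OF abs_triangle_ineq]) (simp add: abs_mult)
          ultimately show ?thesis unfolding w_def by (auto simp: abs_mult intro!: mult_left_mono)
        qed
      qed
    qed
  qed
  have conc: "H x * (\<integral>y. k x 0 y \<partial>lborel) = (\<integral>y. H y * k x 0 y \<partial>lborel)"
    if x: "x \<in> ball x0 \<rho>1" and H: "weakly_harmonic_on W H" for H x
  proof -
    have cH: "continuous_on W H" using H by (simp add: weakly_harmonic_on_def)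
    \<comment> \<open>The constant 1 calibrates the formula: it identifies the limiting mass of
      \<open>P\<close> with the integral of \<open>k\<close>.\<close>
    have one: "weakly_harmonic_on W (\<lambda>_. 1)" by (rule weakly_harmonic_on_const)
    define I where "I = (\<integral>y. k x 0 y \<partial>lborel)"
    define IH where "IH = (\<integral>y. H y * k x 0 y \<partial>lborel)"
    have l1: "(\<lambda>j. \<integral>y. P x (s j) y \<partial>lborel) \<longlonglongrightarrow> I"
      using limk[OF x continuous_on_const[of W 1]] id[OF spos one] by (simp add: I_def)
    have l2: "(\<lambda>j. \<integral>y. H y * P x (s j) y \<partial>lborel) \<longlonglongrightarrow> IH"
      using limk[OF x cH] id[OF spos H] by (simp add: IH_def)
    have iP: "integrable lborel (P x (s j))" for j
      using intk(2)[OF spos continuous_on_const[of W 1]] by simp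
    have iHP: "integrable lborel (\<lambda>y. H y * P x (s j) y)" for j
      by (rule intk(2)[OF spos cH])
    have xW: "x \<in> W" using x W rho by (force simp: subset_iff dist_commute)
    \<comment> \<open>Approximate identity: within \<delta> of x the continuity of \<open>H\<close>
      is used, and beyond that distance \<open>P\<close> is at most a constant times
      \<open>s j\<close>.\<close>
    have ab: "\<bar>IH - H x * I\<bar> \<le> \<epsilon> * I" if "\<epsilon> > 0" for \<epsilon>
    proof -
      obtain \<delta> where d: "\<delta> > 0" "\<And>y. y \<in> W \<Longrightarrow> dist y x < \<delta> \<Longrightarrow> dist (H y) (H x) < \<epsilon>"
        using cH xW \<open>\<epsilon> > 0\<close> unfolding continuous_on_iff by metis
      define C where "C = - (2 * a * real DIM('a)) * (\<delta>\<^sup>2) powr (a - 2)"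
      have C: "C \<ge> 0" unfolding C_def using a by (intro mult_nonneg_nonneg) (auto simp: mult_nonpos_nonneg)
      define v where "v y = (H y - H x) * \<eta> y" for y
      have cv: "continuous_on UNIV v" unfolding v_def
        by (rule continuous_on_mult_compact_support[OF W(1) _ ce(1) K])
          (use e0 cH in \<open>auto simp: K_def intro!: continuous_intros\<close>)
      have iv: "integrable lborel v"
        by (rule integrable_compact_support[OF cv K(1)]) (use e0 in \<open>auto simp: v_def K_def\<close>)
      have pt: "\<bar>(H y - H x) * P x (s j) y\<bar> \<le> \<epsilon> * P x (s j) y + s j * C * \<bar>v y\<bar>" for j y
      proof (cases "y \<in> W")
        case False
        then have "y \<notin> K" using K by auto
        then show ?thesis using k0 spos[of j] C by (simp add: less_imp_le)
      next
        case y: True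
        show ?thesis
        proof (cases "dist y x < \<delta>")
          case True
          then have "\<bar>H y - H x\<bar> \<le> \<epsilon>" using d(2)[OF y] by (simp add: dist_real_def)
          then have "\<bar>(H y - H x) * P x (s j) y\<bar> \<le> \<epsilon> * P x (s j) y"
            using Pnn[OF spos] by (simp add: abs_mult mult_right_mono)
          moreover have "0 \<le> s j * C * \<bar>v y\<bar>" using spos[of j] C by simp
          ultimately show ?thesis by linarith
        next
          case False
          have "\<delta>\<^sup>2 \<le> (norm (y - x))\<^sup>2" using False d(1) by (intro power_mono) (auto simp: dist_norm)
          then have "\<delta>\<^sup>2 \<le> Q x (s j) y" using spos[of j] by (simp add: Q_def)
          then have "Q x (s j) y powr (a - 2) \<le> (\<delta>\<^sup>2) powr (a - 2)"
            using d(1) a by (intro powr_mono2') auto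
          then have "P x (s j) y \<le> \<eta> y * (- (2 * a * real DIM('a))) * s j * (\<delta>\<^sup>2) powr (a - 2)"
            unfolding P_def using enn a spos[of j]
            by (intro mult_left_mono mult_nonneg_nonneg) (auto simp: mult_nonpos_nonneg less_imp_le)
          also have "\<dots> = s j * C * \<eta> y" by (simp add: C_def)
          finally have "\<bar>H y - H x\<bar> * P x (s j) y \<le> \<bar>H y - H x\<bar> * (s j * C * \<eta> y)"
            by (intro mult_left_mono) auto
          then have "\<bar>(H y - H x) * P x (s j) y\<bar> \<le> s j * C * \<bar>v y\<bar>"
            using Pnn[OF spos] enn unfolding v_def by (simp add: abs_mult mult_ac)
          moreover have "0 \<le> \<epsilon> * P x (s j) y" using Pnn[OF spos] \<open>\<epsilon> > 0\<close> by simp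
          ultimately show ?thesis by linarith
        qed
      qed
      have "\<bar>(\<integral>y. H y * P x (s j) y \<partial>lborel) - H x * (\<integral>y. P x (s j) y \<partial>lborel)\<bar>
        \<le> \<epsilon> * (\<integral>y. P x (s j) y \<partial>lborel) + s j * C * (\<integral>y. \<bar>v y\<bar> \<partial>lborel)" for j
      proof -
        have i1: "integrable lborel (\<lambda>y. (H y - H x) * P x (s j) y)"
          using iP iHP by (simp add: left_diff_distrib)
        have "(\<integral>y. H y * P x (s j) y \<partial>lborel) - H x * (\<integral>y. P x (s j) y \<partial>lborel)
          = (\<integral>y. (H y - H x) * P x (s j) y \<partial>lborel)"
          using iP iHP by (simp add: left_diff_distrib)
        also have "\<bar>\<dots>\<bar> \<le> (\<integral>y. \<bar>(H y - H x) * P x (s j) y\<bar> \<partial>lborel)" by (rule integral_abs_bound)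
        also have "\<dots> \<le> (\<integral>y. \<epsilon> * P x (s j) y + s j * C * \<bar>v y\<bar> \<partial>lborel)"
          using i1 iP iv pt by (intro integral_mono) auto
        also have "\<dots> = \<epsilon> * (\<integral>y. P x (s j) y \<partial>lborel) + s j * C * (\<integral>y. \<bar>v y\<bar> \<partial>lborel)"
          using iP iv by simp
        finally show ?thesis .
      qed
      moreover have "(\<lambda>j. \<bar>(\<integral>y. H y * P x (s j) y \<partial>lborel) - H x * (\<integral>y. P x (s j) y \<partial>lborel)\<bar>)
        \<longlonglongrightarrow> \<bar>IH - H x * I\<bar>" by (intro tendsto_intros l1 l2)
      moreover have "(\<lambda>j. \<epsilon> * (\<integral>y. P x (s j) y \<partial>lborel) + s j * C * (\<integral>y. \<bar>v y\<bar> \<partial>lborel))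
        \<longlonglongrightarrow> \<epsilon> * I + 0 * C * (\<integral>y. \<bar>v y\<bar> \<partial>lborel)"
        by (intro tendsto_intros l1 slim)
      ultimately have "\<bar>IH - H x * I\<bar> \<le> \<epsilon> * I + 0 * C * (\<integral>y. \<bar>v y\<bar> \<partial>lborel)"
        by (intro LIMSEQ_le) auto
      then show ?thesis by simp
    qed
    have "\<bar>IH - H x * I\<bar> \<le> 0"
    proof (rule tendsto_lowerbound)
      show "((\<lambda>\<epsilon>. \<epsilon> * I) \<longlongrightarrow> 0) (at_right 0)" by (auto intro!: tendsto_eq_intros)
      show "eventually (\<lambda>\<epsilon>. \<bar>IH - H x * I\<bar> \<le> \<epsilon> * I) (at_right 0)"
        using ab by (auto simp: eventually_at_right_field intro!: exI[of _ 1])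
    qed simp
    then show ?thesis by (simp add: I_def IH_def)
  qed
  have pos: "(\<integral>y. k x 0 y \<partial>lborel) > 0" if x: "x \<in> ball x0 \<rho>1" for x
  proof -
    have one: "weakly_harmonic_on W (\<lambda>_. 1)" by (rule weakly_harmonic_on_const)
    have l1: "(\<lambda>j. \<integral>y. P x (s j) y \<partial>lborel) \<longlonglongrightarrow> (\<integral>y. k x 0 y \<partial>lborel)"
      using limk[OF x continuous_on_const[of W 1]] id[OF spos one] by simp
    \<comment> \<open>Lower bound for the mass of \<open>P\<close> that is the same for all large j:
      on the ball of radius e with s = e^2 one has Q \<le> 2 e^2, and the powers of e cancel because
      2 + 2 (a - 2) + N = 0.\<close>
    define c where "c = - (2 * a * real DIM('a)) * 2 powr (a - 2) * unit_ball_vol (real DIM('a))"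
    have c: "c > 0" unfolding c_def using a
      by (intro mult_pos_pos) (auto simp: mult_neg_pos unit_ball_vol_def)
    have iP: "integrable lborel (P x (s j))" for j
      using intk(2)[OF spos continuous_on_const[of W 1]] by simp
    have low: "c \<le> (\<integral>y. P x (s j) y \<partial>lborel)" if j: "1 / real (Suc j) < \<rho>1 - dist x x0" for j
    proof -
      define e where "e = 1 / real (Suc j)"
      have e: "e > 0" "s j = e\<^sup>2" by (simp_all add: e_def s_def)
      define B where "B = - (2 * a * real DIM('a)) * e\<^sup>2 * (2 * e\<^sup>2) powr (a - 2)"
      have "B * indicator (ball x e) y \<le> P x (s j) y" for y
      proof (cases "y \<in> ball x e")
        case True
        have "dist y x0 < \<rho>1" using True j dist_triangle[of y x0 x] by (simp add: e_def dist_commute)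
        then have "\<eta> y = 1" by (intro eone) (simp add: dist_commute)
        moreover have "(norm (y - x))\<^sup>2 \<le> e\<^sup>2" using True by (intro power_mono) (auto simp: dist_norm norm_minus_commute)
        then have "(2 * e\<^sup>2) powr (a - 2) \<le> Q x (e\<^sup>2) y powr (a - 2)"
          using a e Qpos[of "e\<^sup>2" x y] by (intro powr_mono2') (auto simp: Q_def)
        ultimately show ?thesis unfolding P_def B_def e(2) using True a
          by (simp, intro mult_left_mono) (auto simp: mult_nonpos_nonneg mult_nonneg_nonpos)
      next
        case False
        then show ?thesis using Pnn[OF spos] by simp
      qed
      moreover have ii: "integrable lborel (\<lambda>y. indicator (ball x e) y :: real)"
        using emeasure_bounded_finite[OF bounded_ball] by (simp add: integrable_indicator_iff)
      ultimately have "(\<integral>y. B * indicator (ball x e) y \<partial>lborel) \<le> (\<integral>y. P x (s j) y \<partial>lborel)"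
        using iP by (intro integral_mono) auto
      moreover have "(\<integral>y. B * indicator (ball x e) y \<partial>lborel) = B * (unit_ball_vol (real DIM('a)) * e ^ DIM('a))"
        using content_ball[of e x] e by simp
      moreover have "B * (unit_ball_vol (real DIM('a)) * e ^ DIM('a)) = c"
      proof -
        have "e\<^sup>2 * (2 * e\<^sup>2) powr (a - 2) * e ^ DIM('a) =
          2 powr (a - 2) * (e powr 2 * (e powr 2) powr (a - 2) * e powr real DIM('a))"
          using e by (simp add: powr_mult powr_realpow)
        also have "e powr 2 * (e powr 2) powr (a - 2) * e powr real DIM('a) = e powr (2 + 2 * (a - 2) + real DIM('a))"
          by (simp only: powr_powr powr_add)
        also have "2 + 2 * (a - 2) + real DIM('a) = 0" by (simp add: a_def field_simps)
        finally have "e\<^sup>2 * (2 * e\<^sup>2) powr (a - 2) * e ^ DIM('a) = 2 powr (a - 2)" using e by simp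
        then show ?thesis unfolding B_def c_def by (simp add: mult_ac)
      qed
      ultimately show ?thesis by simp
    qed
    have "eventually (\<lambda>j. 1 / real (Suc j) < \<rho>1 - dist x x0) sequentially"
      using LIMSEQ_Suc[OF lim_1_over_n] x by (intro order_tendstoD(2)[where y=0]) (auto simp: dist_commute)
    then have "eventually (\<lambda>j. c \<le> (\<integral>y. P x (s j) y \<partial>lborel)) sequentially"
      by (rule eventually_mono) (rule low)
    then have "c \<le> (\<integral>y. k x 0 y \<partial>lborel)"
      by (intro tendsto_lowerbound[OF l1]) auto
    then show ?thesis using c by linarith
  qed
  show thesis
  proof (rule that[OF cab])
    show "\<exists>c>0. \<forall>H. weakly_harmonic_on W H \<longrightarrow>
      H x * c = (\<integral>y. H y * (\<alpha> y * (norm (y - x))\<^sup>2 powr a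
        + (\<beta> y \<bullet> (y - x)) * (norm (y - x))\<^sup>2 powr (a - 1)) \<partial>lborel)" if "x \<in> ball x0 \<rho>1" for x
      using pos[OF that] conc[OF that] by (intro exI[of _ "\<integral>y. k x 0 y \<partial>lborel"]) (simp add: k_def Q_def)
  qed (use ab0 in \<open>auto simp: K_def\<close>)
qed

section \<open>Analyticity along segments and propagation of zeros\<close>

lemma convex_ball_strip:
  fixes z0 e x0 :: "'a::real_normed_vector"
  shows "convex {\<zeta>. z0 + Re \<zeta> *\<^sub>R e \<in> ball x0 \<rho> \<and> \<bar>Im \<zeta>\<bar> * norm e < c}" (is "convex ?U")
proof (rule convexI)
  fix p q u v assume pq: "p \<in> ?U" "q \<in> ?U" and uv: "(0::real) \<le> u" "0 \<le> v" "u + v = 1"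
  have "u *\<^sub>R (z0 + Re p *\<^sub>R e) + v *\<^sub>R (z0 + Re q *\<^sub>R e) \<in> ball x0 \<rho>"
    using pq uv by (intro convexD[OF convex_ball]) auto
  also have "u *\<^sub>R (z0 + Re p *\<^sub>R e) + v *\<^sub>R (z0 + Re q *\<^sub>R e)
      = (u + v) *\<^sub>R z0 + Re (u *\<^sub>R p + v *\<^sub>R q) *\<^sub>R e"
    by (simp add: algebra_simps)
  finally have 1: "z0 + Re (u *\<^sub>R p + v *\<^sub>R q) *\<^sub>R e \<in> ball x0 \<rho>" using uv by simp
  have "u *\<^sub>R (Im p *\<^sub>R e) + v *\<^sub>R (Im q *\<^sub>R e) \<in> ball 0 c"
    using pq uv by (intro convexD[OF convex_ball]) auto
  also have "u *\<^sub>R (Im p *\<^sub>R e) + v *\<^sub>R (Im q *\<^sub>R e) = Im (u *\<^sub>R p + v *\<^sub>R q) *\<^sub>R e"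
    by (simp add: algebra_simps)
  finally have 2: "\<bar>Im (u *\<^sub>R p + v *\<^sub>R q)\<bar> * norm e < c" by simp
  show "u *\<^sub>R p + v *\<^sub>R q \<in> ?U" using 1 2 by blast
qed

text \<open>The squared distance from y to a point of the line is a polynomial in the parameter and
  extends to complex \<zeta>. Its real part is the squared distance at Re \<zeta> minus the square
  of \<open>Im \<zeta> * norm e\<close>. As the support of \<alpha> keeps distance \<rho>1 - \<rho>
  from the part of the line considered, this is positive there in a thin strip, where principal
  powers are holomorphic.\<close>

lemma potential_holomorphic_on_line:
  fixes \<alpha> :: "'a::euclidean_space \<Rightarrow> real"
  assumes c: "continuous_on UNIV \<alpha>"
    and z: "\<And>y. y \<in> cball x0 \<rho>1 \<or> y \<notin> cball x0 \<rho>2 \<Longrightarrow> \<alpha> y = 0"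
    and rho: "\<rho> < \<rho>1"
    and U: "U = {\<zeta>. z0 + Re \<zeta> *\<^sub>R e \<in> ball x0 \<rho> \<and> \<bar>Im \<zeta>\<bar> * norm e < (\<rho>1 - \<rho>) / 2}"
  shows "\<exists>F. F holomorphic_on U \<and> (\<forall>t. complex_of_real t \<in> U \<longrightarrow>
     integrable lborel (\<lambda>y. \<alpha> y * (norm (y - (z0 + t *\<^sub>R e)))\<^sup>2 powr \<mu>) \<and>
     F (of_real t) = of_real (\<integral>y. \<alpha> y * (norm (y - (z0 + t *\<^sub>R e)))\<^sup>2 powr \<mu> \<partial>lborel))"
proof -
  define r where "r = \<rho>1 - \<rho>"
  have r: "r > 0" using rho by (simp add: r_def)
  define \<kappa> where "\<kappa> y = r * max 0 (\<rho>1 - norm (y - x0))" for y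
  \<comment> \<open>\<open>\<kappa>\<close> vanishes on the support of \<open>\<alpha>\<close> and keeps \<open>Re Q\<close> positive off it\<close>
  have k0: "\<kappa> y \<ge> 0" for y using r by (simp add: \<kappa>_def)
  have kc: "continuous_on A \<kappa>" for A unfolding \<kappa>_def[abs_def] by (intro continuous_intros)
  define Q where "Q \<zeta> y = of_real ((norm (y - z0))\<^sup>2 + \<kappa> y) - 2 * \<zeta> * of_real ((y - z0) \<bullet> e)
     + \<zeta>\<^sup>2 * of_real ((norm e)\<^sup>2)" for \<zeta> :: complex and y
  have ReQ: "Re (Q \<zeta> y) = (norm (y - (z0 + Re \<zeta> *\<^sub>R e)))\<^sup>2 - (Im \<zeta> * norm e)\<^sup>2 + \<kappa> y" for \<zeta> y
  proof -
    have "(norm (y - (z0 + Re \<zeta> *\<^sub>R e)))\<^sup>2 = (norm (y - z0))\<^sup>2 - 2 * Re \<zeta> * ((y - z0) \<bullet> e) + (Re \<zeta>)\<^sup>2 * (norm e)\<^sup>2"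
      unfolding power2_norm_eq_inner by (simp add: algebra_simps inner_commute power2_eq_square)
    then show ?thesis unfolding Q_def by (simp add: power2_eq_square algebra_simps)
  qed
  have Qpos: "Re (Q \<zeta> y) > 0" if "\<zeta> \<in> U" for \<zeta> y
  proof -
    have u: "z0 + Re \<zeta> *\<^sub>R e \<in> ball x0 \<rho>" "\<bar>Im \<zeta> * norm e\<bar> < r / 2"
      using that unfolding U r_def by (auto simp: abs_mult)
    have i: "(Im \<zeta> * norm e)\<^sup>2 < (r / 2)\<^sup>2"
      using u(2) r by (metis abs_ge_zero pos2 power2_abs power_strict_mono)
    show ?thesis
    \<comment> \<open>Beyond this radius the distance to the line is at least r / 2, which beats the
      imaginary part; inside it, \<open>\<kappa> y\<close> is at least r^2 / 2.\<close>
    proof (cases "norm (y - x0) \<ge> \<rho> + r / 2")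
      case True
      have "norm (y - x0) \<le> norm (y - (z0 + Re \<zeta> *\<^sub>R e)) + norm (z0 + Re \<zeta> *\<^sub>R e - x0)"
        using norm_triangle_ineq[of "y - (z0 + Re \<zeta> *\<^sub>R e)" "z0 + Re \<zeta> *\<^sub>R e - x0"] by simp
      then have "r / 2 \<le> norm (y - (z0 + Re \<zeta> *\<^sub>R e))"
        using True u(1) by (simp add: dist_norm norm_minus_commute)
      then have "(r / 2)\<^sup>2 \<le> (norm (y - (z0 + Re \<zeta> *\<^sub>R e)))\<^sup>2" using r by (intro power_mono) auto
      then show ?thesis using i k0[of y] unfolding ReQ by linarith
    next
      case False
      then have "r / 2 \<le> \<rho>1 - norm (y - x0)" unfolding r_def by argo
      then have "r / 2 \<le> max 0 (\<rho>1 - norm (y - x0))" by (rule max.coboundedI2)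
      then have "r * (r / 2) \<le> \<kappa> y" unfolding \<kappa>_def by (rule mult_left_mono) (use r in simp)
      moreover have "(r / 2)\<^sup>2 \<le> r * (r / 2)" using r by (simp add: power2_eq_square)
      moreover have "0 \<le> (norm (y - (z0 + Re \<zeta> *\<^sub>R e)))\<^sup>2" by simp
      ultimately show ?thesis using i unfolding ReQ by linarith
    qed
  qed
  obtain b where b: "cball x0 \<rho>2 \<subseteq> cbox (- b) b"
    using bounded_subset_cbox_symmetric[OF bounded_cball] by blast
  define f where "f \<zeta> y = of_real (\<alpha> y) * Q \<zeta> y powr of_real \<mu>" for \<zeta> y
  define f' where "f' \<zeta> y = of_real (\<alpha> y) * (of_real \<mu> * Q \<zeta> y powr (of_real \<mu> - 1)
     * (- 2 * of_real ((y - z0) \<bullet> e) + 2 * \<zeta> * of_real ((norm e)\<^sup>2)))" for \<zeta> y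
  have cQ: "continuous_on (U \<times> A) (\<lambda>(\<zeta>, y). Q \<zeta> y)" for A
    unfolding Q_def split_def
    by (intro continuous_intros continuous_on_compose2[OF kc[of UNIV]]) auto
  have ca: "continuous_on (U \<times> A) (\<lambda>(\<zeta>, y). complex_of_real (\<alpha> y))" for A
    unfolding split_def by (intro continuous_intros continuous_on_compose2[OF c]) auto
  have cQ2: "continuous_on (U \<times> A) (\<lambda>(\<zeta>, y). Q \<zeta> y powr \<nu>)" for A \<nu>
    unfolding split_def
  proof (rule continuous_on_powr_complex)
    show "U \<times> A \<subseteq> {p. 0 \<le> Re (Q (fst p) (snd p)) \<or> Im (Q (fst p) (snd p)) \<noteq> 0}"
      by (auto intro: less_imp_le[OF Qpos])
    show "0 < Re \<nu>" if "p \<in> U \<times> A" "Q (fst p) (snd p) = 0" for p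
      using Qpos[of "fst p" "snd p"] that by auto
    show "continuous_on (U \<times> A) (\<lambda>p. Q (fst p) (snd p))" using cQ[of A] by (simp add: split_def)
  qed (rule continuous_on_const)
  have cf: "continuous_on A (f \<zeta>)" if "\<zeta> \<in> U" for \<zeta> A
  proof -
    have "continuous_on (U \<times> A) (\<lambda>(\<zeta>, y). f \<zeta> y)"
      using continuous_on_mult[OF ca[of A] cQ2[of A "of_real \<mu>"]] by (simp add: f_def split_def)
    then have "continuous_on A (\<lambda>y. (\<lambda>(\<zeta>, y). f \<zeta> y) (\<zeta>, y))"
      by (rule continuous_on_compose2) (use that in \<open>auto intro!: continuous_intros\<close>)
    then show ?thesis by simp
  qed
  define F where "F \<zeta> = integral (cbox (- b) b) (f \<zeta>)" for \<zeta>
  have convU: "convex U" unfolding U by (rule convex_ball_strip)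
  have "F holomorphic_on U"
    unfolding F_def
  proof (rule leibniz_rule_holomorphic[where fx=f'])
    show "((\<lambda>x. f x t) has_field_derivative f' x t) (at x within U)" if "x \<in> U" for x t
    proof -
      have "((\<lambda>x. Q x t) has_field_derivative - 2 * of_real ((t - z0) \<bullet> e) + 2 * x * of_real ((norm e)\<^sup>2)) (at x within U)"
        unfolding Q_def by (auto intro!: derivative_eq_intros)
      moreover have "Q x t \<notin> \<real>\<^sub>\<le>\<^sub>0" using Qpos[OF that, of t] by (auto simp: complex_nonpos_Reals_iff)
      then have "((\<lambda>w. w powr of_real \<mu>) has_field_derivative of_real \<mu> * Q x t powr (of_real \<mu> - 1)) (at (Q x t))"
        by (rule has_field_derivative_powr)
      ultimately have "((\<lambda>x. Q x t powr of_real \<mu>) has_field_derivative of_real \<mu> * Q x t powr (of_real \<mu> - 1)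
        * (- 2 * of_real ((t - z0) \<bullet> e) + 2 * x * of_real ((norm e)\<^sup>2))) (at x within U)"
        by (rule DERIV_chain2[rotated])
      then show ?thesis unfolding f_def f'_def by (rule DERIV_cmult)
    qed
    show "f x integrable_on cbox (- b) b" if "x \<in> U" for x
      by (rule integrable_continuous[OF cf[OF that]])
    show "continuous_on (U \<times> cbox (- b) b) (\<lambda>(x, t). f' x t)"
    proof -
      have "continuous_on (U \<times> cbox (- b) b) (\<lambda>p. of_real \<mu> *
          (- 2 * of_real ((snd p - z0) \<bullet> e) + 2 * fst p * of_real ((norm e)\<^sup>2)))"
        by (intro continuous_intros)
      from continuous_on_mult[OF continuous_on_mult[OF ca cQ2[of _ "of_real \<mu> - 1"]] this]
      show ?thesis by (simp add: f'_def split_def mult_ac)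
    qed
  qed (rule convU)
  moreover have "integrable lborel (\<lambda>y. \<alpha> y * (norm (y - (z0 + t *\<^sub>R e)))\<^sup>2 powr \<mu>) \<and>
     F (of_real t) = of_real (\<integral>y. \<alpha> y * (norm (y - (z0 + t *\<^sub>R e)))\<^sup>2 powr \<mu> \<partial>lborel)"
    if t: "complex_of_real t \<in> U" for t
  proof -
    define h where "h y = \<alpha> y * (norm (y - (z0 + t *\<^sub>R e)))\<^sup>2 powr \<mu>" for y
    \<comment> \<open>Where \<alpha> is nonzero, \<kappa> vanishes and \<open>Q\<close> at a real
      parameter is a nonnegative real, so complex and real powers agree.\<close>
    have fh: "f (of_real t) y = of_real (h y)" for y
    proof (cases "\<alpha> y = 0")
      case True
      then show ?thesis by (simp add: f_def h_def)
    next
      case False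
      then have "y \<notin> cball x0 \<rho>1" using z by blast
      then have "\<kappa> y = 0" by (simp add: \<kappa>_def dist_norm norm_minus_commute)
      then have "Re (Q (of_real t) y) = (norm (y - (z0 + t *\<^sub>R e)))\<^sup>2" by (simp add: ReQ)
      moreover have "Im (Q (of_real t) y) = 0" by (simp add: Q_def power2_eq_square)
      ultimately have "Q (of_real t) y = of_real ((norm (y - (z0 + t *\<^sub>R e)))\<^sup>2)"
        by (simp add: complex_eq_iff)
      moreover have "of_real ((norm (y - (z0 + t *\<^sub>R e)))\<^sup>2) powr complex_of_real \<mu>
        = of_real ((norm (y - (z0 + t *\<^sub>R e)))\<^sup>2 powr \<mu>)"
        by (intro powr_of_real) auto
      ultimately show ?thesis by (simp add: f_def h_def)
    qed
    have "continuous_on UNIV (\<lambda>y. Re (f (of_real t) y))" by (intro continuous_intros cf t)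
    then have ch: "continuous_on UNIV h" using fh by simp
    have h0: "h y = 0" if "y \<notin> cball x0 \<rho>2" for y using z that by (simp add: h_def)
    have hb: "(\<lambda>y. if y \<in> cbox (- b) b then h y else 0) = h" using h0 b by force
    have ih: "integrable lborel h"
      by (rule integrable_compact_support[OF ch compact_cball h0])
    have "(h has_integral (\<integral>y. h y \<partial>lborel)) UNIV" by (rule has_integral_integral_lborel[OF ih])
    then have "(h has_integral (\<integral>y. h y \<partial>lborel)) (cbox (- b) b)"
      using has_integral_restrict_UNIV[of "cbox (- b) b" h]
      by (simp add: hb)
    then have "((\<lambda>y. complex_of_real (h y)) has_integral of_real (\<integral>y. h y \<partial>lborel)) (cbox (- b) b)"
      by (rule has_integral_of_real)
    then have "F (of_real t) = of_real (\<integral>y. h y \<partial>lborel)"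
      unfolding F_def ext[of "f (of_real t)", OF fh] by (rule integral_unique)
    then show ?thesis using ih by (simp add: h_def[abs_def])
  qed
  ultimately show ?thesis by blast
qed

text \<open>Along the segment from a point of \<open>V\<close> to \<open>x\<close>, the representing
  integral is the restriction of a holomorphic function that vanishes for small parameters, hence
  also at the end point. It differs from \<open>H\<close> by a positive factor at each point, so
  both have the same zeros.\<close>

theorem weakly_harmonic_unique_continuation:
  fixes x0 :: "'a::euclidean_space"
  assumes dim: "DIM('a) \<ge> 3" and W: "open W" "cball x0 \<rho>2 \<subseteq> W" and rho: "0 < \<rho>" "\<rho> < \<rho>2"
    and H: "weakly_harmonic_on W H"
    and V: "open V" "V \<noteq> {}" "V \<subseteq> ball x0 \<rho>" "\<And>y. y \<in> V \<Longrightarrow> H y = 0"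
    and x: "x \<in> ball x0 \<rho>"
  shows "H x = 0"
proof -
  define \<rho>1 where "\<rho>1 = (\<rho> + \<rho>2) / 2"
  have r1: "0 < \<rho>1" "\<rho>1 < \<rho>2" "\<rho> < \<rho>1" using rho by (auto simp: \<rho>1_def)
  obtain \<alpha> :: "'a \<Rightarrow> real" and \<beta> :: "'a \<Rightarrow> 'a" and a :: real where
    cab: "continuous_on UNIV \<alpha>" "continuous_on UNIV \<beta>" and
    a0: "\<And>y. y \<in> cball x0 \<rho>1 \<or> y \<notin> cball x0 \<rho>2 \<Longrightarrow> \<alpha> y = 0" and
    b0: "\<And>y. y \<in> cball x0 \<rho>1 \<or> y \<notin> cball x0 \<rho>2 \<Longrightarrow> \<beta> y = 0" and
    rep: "\<And>x. x \<in> ball x0 \<rho>1 \<Longrightarrow> \<exists>c>0. \<forall>H. weakly_harmonic_on W H \<longrightarrow>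
      H x * c = (\<integral>y. H y * (\<alpha> y * (norm (y - x))\<^sup>2 powr a
        + (\<beta> y \<bullet> (y - x)) * (norm (y - x))\<^sup>2 powr (a - 1)) \<partial>lborel)"
    using weakly_harmonic_representation[OF dim W r1(1,2)] by blast
  define I where "I x = (\<integral>y. H y * (\<alpha> y * (norm (y - x))\<^sup>2 powr a
        + (\<beta> y \<bullet> (y - x)) * (norm (y - x))\<^sup>2 powr (a - 1)) \<partial>lborel)" for x
  have I: "\<exists>c>0. H x * c = I x" if "x \<in> ball x0 \<rho>" for x
    using rep[of x] that r1 H unfolding I_def by force
  obtain z0 where z0: "z0 \<in> V" using V by blast
  define e where "e = x - z0"
  define U where "U = {\<zeta>. z0 + Re \<zeta> *\<^sub>R e \<in> ball x0 \<rho> \<and> \<bar>Im \<zeta>\<bar> * norm e < (\<rho>1 - \<rho>) / 2}"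
  have cH: "continuous_on W H" using H by (simp add: weakly_harmonic_on_def)
  \<comment> \<open>Splitting y - (z0 + t e) makes the densities independent of t, at the price of
    an explicit factor t before the third integral.\<close>
  define A1 where "A1 y = H y * \<alpha> y" for y
  define A2 where "A2 y = H y * (\<beta> y \<bullet> (y - z0))" for y
  define A3 where "A3 y = H y * (\<beta> y \<bullet> e)" for y
  note cms = continuous_on_mult_compact_support[OF W(1) cH _ compact_cball W(2)]
  have cA: "continuous_on UNIV A1" "continuous_on UNIV A2" "continuous_on UNIV A3"
    unfolding A1_def A2_def A3_def by (rule cms; use a0 b0 cab in \<open>auto intro!: continuous_intros\<close>)+
  have A0: "A1 y = 0" "A2 y = 0" "A3 y = 0" if "y \<in> cball x0 \<rho>1 \<or> y \<notin> cball x0 \<rho>2" for y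
    using a0[OF that] b0[OF that] by (simp_all add: A1_def A2_def A3_def)
  note hol = potential_holomorphic_on_line[OF _ _ r1(3) U_def]
  obtain F1 where F1: "F1 holomorphic_on U" "\<And>t. complex_of_real t \<in> U \<Longrightarrow>
     integrable lborel (\<lambda>y. A1 y * (norm (y - (z0 + t *\<^sub>R e)))\<^sup>2 powr a) \<and>
     F1 (of_real t) = of_real (\<integral>y. A1 y * (norm (y - (z0 + t *\<^sub>R e)))\<^sup>2 powr a \<partial>lborel)"
    using hol[OF cA(1) A0(1)] by blast
  obtain F2 where F2: "F2 holomorphic_on U" "\<And>t. complex_of_real t \<in> U \<Longrightarrow>
     integrable lborel (\<lambda>y. A2 y * (norm (y - (z0 + t *\<^sub>R e)))\<^sup>2 powr (a - 1)) \<and>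
     F2 (of_real t) = of_real (\<integral>y. A2 y * (norm (y - (z0 + t *\<^sub>R e)))\<^sup>2 powr (a - 1) \<partial>lborel)"
    using hol[OF cA(2) A0(2)] by blast
  obtain F3 where F3: "F3 holomorphic_on U" "\<And>t. complex_of_real t \<in> U \<Longrightarrow>
     integrable lborel (\<lambda>y. A3 y * (norm (y - (z0 + t *\<^sub>R e)))\<^sup>2 powr (a - 1)) \<and>
     F3 (of_real t) = of_real (\<integral>y. A3 y * (norm (y - (z0 + t *\<^sub>R e)))\<^sup>2 powr (a - 1) \<partial>lborel)"
    using hol[OF cA(3) A0(3)] by blast
  define F where "F \<zeta> = F1 \<zeta> + F2 \<zeta> - \<zeta> * F3 \<zeta>" for \<zeta>
  have hF: "F holomorphic_on U" unfolding F_def by (intro holomorphic_intros F1 F2 F3)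
  have FI: "F (of_real t) = of_real (I (z0 + t *\<^sub>R e))" if "complex_of_real t \<in> U" for t
  proof -
    have "H y * (\<alpha> y * (norm (y - (z0 + t *\<^sub>R e)))\<^sup>2 powr a
        + (\<beta> y \<bullet> (y - (z0 + t *\<^sub>R e))) * (norm (y - (z0 + t *\<^sub>R e)))\<^sup>2 powr (a - 1))
      = A1 y * (norm (y - (z0 + t *\<^sub>R e)))\<^sup>2 powr a + A2 y * (norm (y - (z0 + t *\<^sub>R e)))\<^sup>2 powr (a - 1)
        - t * (A3 y * (norm (y - (z0 + t *\<^sub>R e)))\<^sup>2 powr (a - 1))" for y
    proof -
      have "\<beta> y \<bullet> (y - (z0 + t *\<^sub>R e)) = \<beta> y \<bullet> (y - z0) - t * (\<beta> y \<bullet> e)"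
        by (simp add: inner_diff_right inner_add_right)
      then show ?thesis unfolding A1_def A2_def A3_def by (simp add: algebra_simps)
    qed
    then have "I (z0 + t *\<^sub>R e) = (\<integral>y. A1 y * (norm (y - (z0 + t *\<^sub>R e)))\<^sup>2 powr a \<partial>lborel)
      + (\<integral>y. A2 y * (norm (y - (z0 + t *\<^sub>R e)))\<^sup>2 powr (a - 1) \<partial>lborel)
      - t * (\<integral>y. A3 y * (norm (y - (z0 + t *\<^sub>R e)))\<^sup>2 powr (a - 1) \<partial>lborel)"
      using F1(2)[OF that] F2(2)[OF that] F3(2)[OF that] unfolding I_def by simp
    then show ?thesis using F1(2)[OF that] F2(2)[OF that] F3(2)[OF that] unfolding F_def by simp
  qed
  have realU: "complex_of_real t \<in> U" if "0 \<le> t" "t \<le> 1" for t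
  proof -
    have "(1 - t) *\<^sub>R z0 + t *\<^sub>R x \<in> ball x0 \<rho>"
      using that z0 V x by (intro convexD[OF convex_ball]) auto
    moreover have "(1 - t) *\<^sub>R z0 + t *\<^sub>R x = z0 + t *\<^sub>R e" by (simp add: e_def algebra_simps)
    ultimately show ?thesis using r1 by (simp add: U_def)
  qed
  have openU: "open U"
    unfolding U_def by (intro open_Collect_conj open_Collect_less) (auto simp: ball_def intro!: open_Collect_less continuous_intros)
  have convU: "convex U" unfolding U_def by (rule convex_ball_strip)
  have "F 1 = 0"
  proof -
    obtain d where d: "d > 0" "ball z0 d \<subseteq> V" using V(1) z0 open_contains_ball by blast
    \<comment> \<open>Ensures \<open>t * norm e < d\<close> for t below \<open>d'\<close>; the added
      1 covers the case x = z0.\<close>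
    define d' where "d' = min 1 (d / (norm e + 1))"
    have d': "0 < d'" "d' \<le> 1" using d by (auto simp: d'_def add_nonneg_pos)
    define S where "S = complex_of_real ` {0<..<d'}"
    show ?thesis
    proof (rule analytic_continuation[of F U S 0])
      show "F holomorphic_on U" "open U" "connected U"
        using hF openU convU by (auto intro: convex_connected)
      show "S \<subseteq> U" using realU d' by (auto simp: S_def)
      show "0 \<in> U" using realU[of 0] by simp
      show "1 \<in> U" using realU[of 1] by simp
      show "0 islimpt S"
        unfolding islimpt_approachable
      proof (intro allI impI)
        fix e' :: real assume "0 < e'"
        then show "\<exists>x'\<in>S. x' \<noteq> 0 \<and> dist x' 0 < e'"
          using d' by (intro bexI[of _ "complex_of_real (min (d' / 2) (e' / 2))"]) (auto simp: S_def)
      qed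
      show "F z = 0" if "z \<in> S" for z
      proof -
        obtain t where t: "z = of_real t" "0 < t" "t < d'" using \<open>z \<in> S\<close> by (auto simp: S_def)
        have "t * norm e < d"
        proof -
          have "t < d / (norm e + 1)" using t by (simp add: d'_def)
          then have "t * (norm e + 1) < d" by (subst (asm) pos_less_divide_eq) (auto simp: add_nonneg_pos)
          then show ?thesis using t by (simp add: algebra_simps)
        qed
        then have "z0 + t *\<^sub>R e \<in> V" using d(2) t by (auto simp: dist_norm subset_iff)
        then have "H (z0 + t *\<^sub>R e) = 0" "z0 + t *\<^sub>R e \<in> ball x0 \<rho>" using V by auto
        then have "I (z0 + t *\<^sub>R e) = 0" using I by fastforce
        then show ?thesis using FI[of t] realU[of t] t d' by simp
      qed
    qed
  qed
  then have "I x = 0" using FI[of 1] realU[of 1] by (simp add: e_def)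
  then show ?thesis using I[OF x] by force
qed

subsection \<open>Radial solutions\<close>

text \<open>A function of \<open>r = dist(x, p)\<close> satisfies \<open>\<Delta>v + n v = 0\<close> on the sphere iff, as a function \<open>f\<close> of
  \<open>c = cos r\<close>, it solves \<open>(1 - c\<^sup>2) f'' - n c f' + n f = 0\<close>. One solution is \<open>c\<close>; reduction of order
  gives the general one, \<open>c (A + C k(c))\<close>. The parameters are \<open>b = cos R\<close>, \<open>\<beta> = cos R\<^sub>1\<close>, and \<open>A = (a + 1) / b\<close>.\<close>

locale radial_ode =
  fixes n b \<beta> A C :: real and k :: "real \<Rightarrow> real"
  assumes n: "n \<ge> 1" and b: "0 < b" "b < 1" and \<beta>: "0 < \<beta>" "\<beta> < b" and A: "A > 0"
    and k_b: "k b = 0"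
    and k_deriv: "\<And>c. 0 < c \<Longrightarrow> c < 1 \<Longrightarrow> (k has_real_derivative - ((1 - c\<^sup>2) powr (- n / 2)) / c\<^sup>2) (at c)"
    and slope: "A - C * (1 - b\<^sup>2) powr (- n / 2) / b = 1 / \<beta>"
begin

definition w :: "real \<Rightarrow> real" where "w c = (1 - c\<^sup>2) powr (- n / 2)"
definition f :: "real \<Rightarrow> real" where "f c = c * (A + C * k c)"
definition f1 :: "real \<Rightarrow> real" where "f1 c = A + C * k c - C * w c / c"
definition f2 :: "real \<Rightarrow> real" where "f2 c = - C * n * (1 - c\<^sup>2) powr (- n / 2 - 1)"

lemma sq_less_1: "0 < c \<Longrightarrow> c < 1 \<Longrightarrow> c\<^sup>2 < (1::real)"
  by (simp add: power_less_one_iff abs_square_less_1)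

lemma w_pos: "0 < c \<Longrightarrow> c < 1 \<Longrightarrow> w c > 0"
  using sq_less_1[of c] by (simp add: w_def)

lemma f_deriv: "0 < c \<Longrightarrow> c < 1 \<Longrightarrow> (f has_real_derivative f1 c) (at c)"
  unfolding f_def[abs_def] f1_def w_def
  by (rule derivative_eq_intros k_deriv refl | simp add: power2_eq_square)+

lemma w_deriv:
  assumes "0 < c" "c < 1"
  shows "(w has_real_derivative n * c * (1 - c\<^sup>2) powr (- n / 2 - 1)) (at c)"
proof -
  have "((\<lambda>c. 1 - c\<^sup>2) has_real_derivative - 2 * c) (at c)"
    by (auto intro!: derivative_eq_intros)
  from DERIV_chain2[OF has_real_derivative_powr[of "1 - c\<^sup>2" "- n / 2"] this]
  show ?thesis unfolding w_def[abs_def] using sq_less_1[OF assms] by (simp add: mult_ac)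
qed

lemma f1_deriv:
  assumes c: "0 < c" "c < 1"
  shows "(f1 has_real_derivative f2 c) (at c)"
proof -
  have "((\<lambda>c. A + C * k c - C * w c / c) has_real_derivative
     C * (- w c / c\<^sup>2) - ((C * (n * c * (1 - c\<^sup>2) powr (- n / 2 - 1))) * c - C * w c * 1) / (c * c)) (at c)"
    using c by (auto intro!: derivative_eq_intros k_deriv[folded w_def] w_deriv simp: mult_ac)
  moreover have "C * (- w c / c\<^sup>2) - ((C * (n * c * (1 - c\<^sup>2) powr (- n / 2 - 1))) * c - C * w c * 1) / (c * c) = f2 c"
    using c unfolding f2_def by (simp add: field_simps power2_eq_square)
  ultimately show ?thesis by (simp add: f1_def[abs_def])
qed

text \<open>The left side is the Wronskian of the two solutions c and f, hence a constant multiple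
  of the fixed function \<open>w\<close>; from here on the sign of \<open>C\<close> decides the
  estimates.\<close>

lemma first_integral: "0 < c \<Longrightarrow> c * f1 c - f c = - C * w c"
  by (simp add: f1_def f_def field_simps)

lemma f2_eq:
  assumes "0 < c" "c < 1"
  shows "(1 - c\<^sup>2) * f2 c = - C * n * w c"
proof -
  have "(1 - c\<^sup>2) powr (- n / 2 - 1) * (1 - c\<^sup>2) = w c"
    using sq_less_1[OF assms] powr_add[of "1 - c\<^sup>2" "- n / 2 - 1" 1] by (simp add: w_def)
  then show ?thesis unfolding f2_def by (metis mult.commute mult.assoc)
qed

lemma ode: "0 < c \<Longrightarrow> c < 1 \<Longrightarrow> (1 - c\<^sup>2) * f2 c - n * c * f1 c + n * f c = 0"
proof -
  assume c: "0 < c" "c < 1"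
  have "(1 - c\<^sup>2) * f2 c - n * c * f1 c + n * f c = (1 - c\<^sup>2) * f2 c - n * (c * f1 c - f c)"
    by (simp add: algebra_simps)
  then show ?thesis unfolding f2_eq[OF c] first_integral[OF c(1)] by simp
qed

lemma isCont_f: "0 < c \<Longrightarrow> c < 1 \<Longrightarrow> isCont f c"
  using f_deriv DERIV_isCont by blast

lemma isCont_f1: "0 < c \<Longrightarrow> c < 1 \<Longrightarrow> isCont f1 c"
  using f1_deriv DERIV_isCont by blast

lemma isCont_f2: "0 < c \<Longrightarrow> c < 1 \<Longrightarrow> isCont f2 c"
  unfolding f2_def[abs_def] using sq_less_1[of c] by (intro continuous_intros) auto

lemma f_b: "f b = b * A" by (simp add: f_def k_b)

text \<open>On Gamma_2 the outward normal derivative of f (cos r) is f' sin R, so 1 / \<beta> is the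
  Neumann datum divided by sin R.\<close>

lemma f1_b: "f1 b = 1 / \<beta>"
  using slope by (simp add: f1_def k_b w_def)

section \<open>Monotonicity of the radial profile above the level where it reaches one\<close>

lemma k_antimono:
  assumes "0 < c" "c \<le> d" "d < 1"
  shows "k d \<le> k c"
proof (rule DERIV_nonpos_imp_nonincreasing[where f=k, OF assms(2)])
  fix x assume "c \<le> x" "x \<le> d"
  then have x: "0 < x" "x < 1" using assms by auto
  have "- ((1 - x\<^sup>2) powr (- n / 2)) / x\<^sup>2 \<le> 0" by simp
  then show "\<exists>y. (k has_real_derivative y) (at x) \<and> y \<le> 0" using k_deriv[OF x] by blast
qed

text \<open>A point of Gamma_0 is seen through points of the domain converging to it, along which u
  + 1 tends to 1. Stating the value as a limit admits \<open>c0 = 0\<close>, the equator, where the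
  formula for \<open>f\<close> breaks down.\<close>

definition reaches_one_at :: "(nat \<Rightarrow> real) \<Rightarrow> real \<Rightarrow> bool" where
  "reaches_one_at X c0 \<longleftrightarrow> 0 \<le> c0 \<and> c0 < b \<and> (\<forall>j. 0 < X j \<and> X j < b) \<and> X \<longlonglongrightarrow> c0 \<and> (\<lambda>j. f (X j)) \<longlonglongrightarrow> 1"

text \<open>If \<open>A + C * k c\<close> is nonpositive, then C < 0; since \<open>k\<close>
  decreases, the expression stays nonpositive for all smaller arguments, and \<open>f\<close> could
  not tend to 1 at \<open>c0\<close>.\<close>

lemma f_pos:
  assumes X: "reaches_one_at X c0" and c: "c0 < c" "c \<le> b"
  shows "f c > 0"
proof (rule ccontr)
  assume "\<not> f c > 0"
  have c01: "0 < c" "c < 1" using X c b unfolding reaches_one_at_def by auto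
  with \<open>\<not> f c > 0\<close> have neg: "A + C * k c \<le> 0"
    unfolding f_def by (metis mult_pos_pos not_le)
  have "k c \<ge> 0" using k_antimono[of c b] c01 c b k_b by simp
  then have "C < 0" using neg A by (smt (verit) mult_nonneg_nonneg)
  have "eventually (\<lambda>j. X j < c) sequentially"
    using X c(1) unfolding reaches_one_at_def by (auto intro: order_tendstoD(2))
  then have "eventually (\<lambda>j. f (X j) \<le> 0) sequentially"
  proof eventually_elim
    case (elim j)
    have Xj: "0 < X j" using X unfolding reaches_one_at_def by simp
    have "k c \<le> k (X j)" using k_antimono[of "X j" c] Xj elim c01 by simp
    then have "C * k (X j) \<le> C * k c" using \<open>C < 0\<close> by (simp add: mult_left_mono_neg)
    then have "A + C * k (X j) \<le> 0" using neg by linarith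
    then show "f (X j) \<le> 0" unfolding f_def using Xj by (simp add: mult_nonneg_nonpos)
  qed
  then have "(1::real) \<le> 0"
    using X unfolding reaches_one_at_def by (intro tendsto_upperbound[of "\<lambda>j. f (X j)"]) auto
  then show False by simp
qed

text \<open>For C \<le> 0 the Wronskian identity gives c f' = f - C w > 0. For C > 0 the function is
  concave and f' is at least its value 1 / \<beta> at \<open>b\<close>.\<close>

lemma f1_pos:
  assumes X: "reaches_one_at X c0" and c: "c0 < c" "c \<le> b"
  shows "f1 c > 0"
proof -
  have c01: "0 < c" "c < 1" using X c b unfolding reaches_one_at_def by auto
  show ?thesis
  proof (cases "C \<le> 0")
    case True
    then have "- C * w c \<ge> 0" using w_pos[OF c01] by (simp add: mult_nonpos_nonneg)
    then have "c * f1 c > 0" using first_integral[OF c01(1)] f_pos[OF X c] by linarith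
    then show ?thesis using c01 zero_less_mult_pos by blast
  next
    case False
    have "f1 b \<le> f1 c"
    proof (rule DERIV_nonpos_imp_nonincreasing[where f=f1, OF c(2)])
      fix x assume "c \<le> x" "x \<le> b"
      then have "0 < x" "x < 1" using c01 b by auto
      moreover have "f2 x \<le> 0" unfolding f2_def using False n by (simp add: mult_nonneg_nonneg)
      ultimately show "\<exists>y. (f1 has_real_derivative y) (at x) \<and> y \<le> 0" using f1_deriv by blast
    qed
    then show ?thesis using f1_b \<beta> by (smt (verit) zero_less_divide_1_iff)
  qed
qed

lemma f_less:
  assumes X: "reaches_one_at X c0" and c: "c0 < c" "c < d" "d \<le> b"
  shows "f c < f d"
proof (rule DERIV_pos_imp_increasing[where f=f, OF c(2)])
  fix x assume x: "c \<le> x" "x \<le> d"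
  then have "0 < x" "x < 1" using X c b unfolding reaches_one_at_def by auto
  then show "\<exists>y. (f has_real_derivative y) (at x) \<and> y > 0"
    using f_deriv f1_pos[OF X, of x] x c by force
qed

text \<open>\<open>f\<close> increases strictly above \<open>c0\<close> and equals 1 at the interior
  level \<open>d0\<close>; its value at a level strictly between keeps the values along
  \<open>X\<close> away from 1.\<close>

lemma reaches_one_not_less:
  assumes X: "reaches_one_at X c0" and Y: "reaches_one_at Y d0"
  shows "\<not> c0 < d0"
proof
  assume lt: "c0 < d0"
  then have d0: "0 < d0" "d0 < b" using X Y unfolding reaches_one_at_def by auto
  then have "(\<lambda>j. f (Y j)) \<longlonglongrightarrow> f d0"
    using Y isCont_f[of d0] b unfolding reaches_one_at_def by (auto intro: isCont_tendsto_compose)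
  then have one: "f d0 = 1" using Y LIMSEQ_unique unfolding reaches_one_at_def by blast
  define m where "m = (c0 + d0) / 2"
  have m: "c0 < m" "m < d0" using lt by (auto simp: m_def)
  have mono: "f x \<le> f m" if "0 < x" "x < m" for x
  proof (cases "x > c0")
    case True
    then show ?thesis using f_less[OF X, of x m] that m d0 by simp
  next
    \<comment> \<open>The sequence may run at or below \<open>c0\<close>. Then \<open>c0\<close> is
      positive, so \<open>f\<close> is continuous there, and f c0 = 1 = f d0 contradicts strict
      monotonicity.\<close>
    case False
    then show ?thesis
    proof -
      have "c0 > 0" using that False by linarith
      then have "(\<lambda>j. f (X j)) \<longlonglongrightarrow> f c0"
        using X isCont_f[of c0] b unfolding reaches_one_at_def by (auto intro: isCont_tendsto_compose)
      then have c01: "f c0 = 1" using X LIMSEQ_unique unfolding reaches_one_at_def by blast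
      have "continuous_on {c0..d0} f"
        using isCont_f \<open>c0 > 0\<close> d0 b by (intro continuous_at_imp_continuous_on) auto
      moreover have "\<exists>y. (f has_real_derivative y) (at x) \<and> 0 < y" if "c0 < x" "x < d0" for x
        using that f_deriv[of x] f1_pos[OF X, of x] \<open>c0 > 0\<close> d0 b by auto
      ultimately have "f c0 < f d0" using DERIV_pos_imp_increasing_open[where f=f, OF lt] by blast
      then show ?thesis using c01 one by simp
    qed
  qed
  have "eventually (\<lambda>j. X j < m) sequentially"
    using X m(1) unfolding reaches_one_at_def by (auto intro: order_tendstoD(2))
  then have "eventually (\<lambda>j. f (X j) \<le> f m) sequentially"
    by eventually_elim (use mono X in \<open>auto simp: reaches_one_at_def\<close>)
  then have "1 \<le> f m"
    using X unfolding reaches_one_at_def by (intro tendsto_upperbound[of "\<lambda>j. f (X j)"]) auto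
  then show False using f_less[OF X m(1,2)] d0 one by simp
qed

text \<open>The energy \<open>(1 - c\<^sup>2) f'\<^sup>2 + f\<^sup>2\<close> (the P-function of the problem) is monotone in \<open>c\<close>, in a direction
  given by the sign of \<open>C\<close>, while its values at both ends compare in the opposite way unless \<open>C = 0\<close>.\<close>

lemma rigidity:
  assumes X: "reaches_one_at X c0" and g: "(\<lambda>j. (1 - (X j)\<^sup>2) * (f1 (X j))\<^sup>2) \<longlonglongrightarrow> (1 - \<beta>\<^sup>2) / \<beta>\<^sup>2"
    and gt: "\<And>j. X j > c0"
  shows "c0 = \<beta> \<and> (\<forall>c. f c = c / \<beta>)"
proof -
  define P where "P c = (1 - c\<^sup>2) * (f1 c)\<^sup>2 + (f c)\<^sup>2" for c
  have Xj: "0 < X j" "X j < b" "c0 < X j" for j using X gt unfolding reaches_one_at_def by auto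
  have dP: "(P has_real_derivative - 2 * (n - 1) * f1 c * w c * C) (at c)" if c: "0 < c" "c < 1" for c
  proof -
    have "(P has_real_derivative (- 2 * c) * (f1 c)\<^sup>2 + (2 * f1 c * f2 c) * (1 - c\<^sup>2) + 2 * f c * f1 c) (at c)"
      unfolding P_def[abs_def] using f_deriv[OF c] f1_deriv[OF c]
      by (auto intro!: derivative_eq_intros simp: algebra_simps)
    moreover have "(- 2 * c) * (f1 c)\<^sup>2 + (2 * f1 c * f2 c) * (1 - c\<^sup>2) + 2 * f c * f1 c
       = 2 * f1 c * ((1 - c\<^sup>2) * f2 c - (c * f1 c - f c))"
      by (simp add: algebra_simps power2_eq_square)
    moreover have "\<dots> = - 2 * (n - 1) * f1 c * w c * C"
      unfolding f2_eq[OF c] first_integral[OF c(1)] by (simp add: algebra_simps)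
    ultimately show ?thesis by simp
  qed
  have "(\<lambda>j. P (X j)) \<longlonglongrightarrow> (1 - \<beta>\<^sup>2) / \<beta>\<^sup>2 + 1\<^sup>2"
    unfolding P_def using g X unfolding reaches_one_at_def by (intro tendsto_intros) auto
  moreover have "(1 - \<beta>\<^sup>2) / \<beta>\<^sup>2 + 1\<^sup>2 = 1 / \<beta>\<^sup>2" using \<beta> by (simp add: field_simps)
  ultimately have limP: "(\<lambda>j. P (X j)) \<longlonglongrightarrow> 1 / \<beta>\<^sup>2" by simp
  have Pb: "P b = (1 - b\<^sup>2) / \<beta>\<^sup>2 + (b * A)\<^sup>2" by (simp add: P_def f_b f1_b power_divide)
  have wb: "w b / b > 0" using w_pos b by simp
  have sl: "A - 1 / \<beta> = C * (w b / b)" using slope by (simp add: w_def algebra_simps)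
  \<comment> \<open>This is the value \<open>P b\<close> takes for A = 1 / \<beta>, so comparing
    \<open>P b\<close> with the limit amounts to comparing \<open>A\<close> with 1 / \<beta>, that
    is, to the sign of \<open>C\<close>.\<close>
  have split: "1 / \<beta>\<^sup>2 = (1 - b\<^sup>2) / \<beta>\<^sup>2 + (b * (1 / \<beta>))\<^sup>2" using \<beta> by (simp add: field_simps power2_eq_square)
  have "\<not> C > 0"
  proof
    assume C: "C > 0"
    then have "A > 1 / \<beta>" using sl wb by (smt (verit) mult_pos_pos)
    then have "(b * (1 / \<beta>))\<^sup>2 < (b * A)\<^sup>2" using b \<beta> by (intro power_strict_mono mult_strict_left_mono) auto
    then have "P b > 1 / \<beta>\<^sup>2" unfolding Pb split by simp
    moreover have "P b \<le> P (X j)" for j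
    proof (rule DERIV_nonpos_imp_nonincreasing[where f=P])
      show "X j \<le> b" using Xj less_imp_le by blast
      fix x assume x: "X j \<le> x" "x \<le> b"
      then have x01: "0 < x" "x < 1" "c0 < x" using Xj[of j] b by auto
      have "0 \<le> 2 * (n - 1) * f1 x * w x * C"
        using n C w_pos[OF x01(1,2)] f1_pos[OF X x01(3) x(2)] by simp
      then have "- 2 * (n - 1) * f1 x * w x * C \<le> 0" by (simp add: algebra_simps)
      then show "\<exists>y. (P has_real_derivative y) (at x) \<and> y \<le> 0" using dP[OF x01(1,2)] by blast
    qed
    then have "P b \<le> 1 / \<beta>\<^sup>2" by (intro tendsto_lowerbound[OF limP]) auto
    ultimately show False by simp
  qed
  moreover have "\<not> C < 0"
  proof
    assume C: "C < 0"
    then have "A < 1 / \<beta>" using sl wb by (smt (verit) mult_neg_pos)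
    then have "(b * A)\<^sup>2 < (b * (1 / \<beta>))\<^sup>2" using b A by (intro power_strict_mono mult_strict_left_mono) auto
    then have "P b < 1 / \<beta>\<^sup>2" unfolding Pb split by simp
    moreover have "P (X j) \<le> P b" for j
    proof (rule DERIV_nonneg_imp_nondecreasing[where f=P])
      show "X j \<le> b" using Xj less_imp_le by blast
      fix x assume x: "X j \<le> x" "x \<le> b"
      then have x01: "0 < x" "x < 1" "c0 < x" using Xj[of j] b by auto
      have "2 * (n - 1) * f1 x * w x * C \<le> 0"
        using n C w_pos[OF x01(1,2)] f1_pos[OF X x01(3) x(2)] by (intro mult_nonneg_nonpos) auto
      then have "0 \<le> - 2 * (n - 1) * f1 x * w x * C" by (simp add: algebra_simps)
      then show "\<exists>y. (P has_real_derivative y) (at x) \<and> 0 \<le> y" using dP[OF x01(1,2)] by blast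
    qed
    then have "P b \<ge> 1 / \<beta>\<^sup>2" by (intro tendsto_upperbound[OF limP]) auto
    ultimately show False by simp
  qed
  ultimately have C: "C = 0" by simp
  with sl have A\<beta>: "A = 1 / \<beta>" by simp
  have fc: "f c = c / \<beta>" for c
  proof -
    have "f c = c * (A + C * k c)" by (rule f_def)
    also have "\<dots> = c / \<beta>" using C A\<beta> by simp
    finally show ?thesis .
  qed
  have "(\<lambda>j. X j / \<beta>) \<longlonglongrightarrow> c0 / \<beta>" using X \<beta> unfolding reaches_one_at_def by (intro tendsto_intros) auto
  then have "c0 / \<beta> = 1" using X LIMSEQ_unique unfolding reaches_one_at_def fc by blast
  then show ?thesis using \<beta> fc by (simp add: field_simps)
qed

end

text \<open>\<open>k\<close> is the primitive of the prescribed derivative that vanishes at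
  \<open>b\<close>, and \<open>C\<close> is solved from the slope condition.\<close>

lemma radial_ode_exists:
  fixes n b \<beta> A :: real
  assumes n: "n \<ge> 1" and b: "0 < b" "b < 1" and \<beta>: "0 < \<beta>" "\<beta> < b" and A: "A > 0"
  obtains C k where "radial_ode n b \<beta> A C k"
proof -
  define F where "F c = - ((1 - c\<^sup>2) powr (- n / 2)) / c\<^sup>2" for c :: real
  define k where "k u = (LBINT y=b..u. F y)" for u :: real
  have "(k has_real_derivative F c) (at c)" if c: "0 < c" "c < 1" for c
  proof -
    \<comment> \<open>A compact interval in (0, 1) around both \<open>b\<close> and
      \<open>c\<close>, away from the singular ends of the integrand.\<close>
    define l u where "l = min b c / 2" and "u = (max b c + 1) / 2"
    have lu: "0 < l" "u < 1" "l < b" "b < u" "l < c" "c < u" using b c by (auto simp: l_def u_def)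
    have "continuous_on {l..u} F"
      unfolding F_def using lu
      by (intro continuous_intros) (auto simp: power2_eq_1_iff)
    then have "(k has_vector_derivative F c) (at c within {l..u})"
      unfolding k_def using lu by (intro interval_integral_FTC2) auto
    then show ?thesis
      using lu at_within_interior[of c "{l..u}"]
      by (simp add: has_real_derivative_iff_has_vector_derivative)
  qed
  moreover have "k b = 0" by (simp add: k_def)
  moreover have "A - ((A - 1 / \<beta>) * b / (1 - b\<^sup>2) powr (- n / 2)) * (1 - b\<^sup>2) powr (- n / 2) / b = 1 / \<beta>"
  proof -
    have "b\<^sup>2 < 1" using b by (simp add: abs_square_less_1)
    then show ?thesis using b by simp
  qed
  ultimately have "radial_ode n b \<beta> A ((A - 1 / \<beta>) * b / (1 - b\<^sup>2) powr (- n / 2)) k"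
    using assms unfolding radial_ode_def F_def by blast
  then show ?thesis by (rule that)
qed

text \<open>The largest open set on which \<open>H\<close> vanishes is also relatively closed,
  because a small ball that meets it falls under the local theorem. Halving the radius leaves room
  for the larger closed ball of that theorem.\<close>

theorem weakly_harmonic_unique_continuation_connected:
  fixes H :: "'a::euclidean_space \<Rightarrow> real"
  assumes dim: "DIM('a) \<ge> 3" and W: "open W" "connected W" and H: "weakly_harmonic_on W H"
    and V: "open V" "V \<noteq> {}" "V \<subseteq> W" "\<And>y. y \<in> V \<Longrightarrow> H y = 0" and x: "x \<in> W"
  shows "H x = 0"
proof -
  define Z where "Z = \<Union>{B. open B \<and> B \<subseteq> W \<and> (\<forall>y\<in>B. H y = 0)}"
  have oZ: "open Z" and ZW: "Z \<subseteq> W" and Z0: "\<And>y. y \<in> Z \<Longrightarrow> H y = 0" by (auto simp: Z_def)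
  have VZ: "V \<subseteq> Z" using V by (auto simp: Z_def)
  have "open (W - Z)"
  proof (subst open_contains_ball, rule ballI)
    fix y assume y: "y \<in> W - Z"
    then obtain \<rho>2 where r: "\<rho>2 > 0" "cball y \<rho>2 \<subseteq> W"
      using W(1) open_contains_cball by blast
    have "ball y (\<rho>2 / 2) \<inter> Z = {}"
    proof (rule ccontr)
      assume ne: "ball y (\<rho>2 / 2) \<inter> Z \<noteq> {}"
      have "H z = 0" if "z \<in> ball y (\<rho>2 / 2)" for z
        by (rule weakly_harmonic_unique_continuation[OF dim W(1) r(2) _ _ H _ ne _ _ that])
          (use r oZ Z0 in auto)
      moreover have "ball y (\<rho>2 / 2) \<subseteq> W" using r by (auto simp: subset_iff)
      ultimately have "ball y (\<rho>2 / 2) \<subseteq> Z" unfolding Z_def by blast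
      moreover have "y \<in> ball y (\<rho>2 / 2)" using r by simp
      ultimately show False using y by blast
    qed
    moreover have "ball y (\<rho>2 / 2) \<subseteq> W" using r by (auto simp: subset_iff)
    ultimately show "\<exists>e>0. ball y e \<subseteq> W - Z" using r by (intro exI[of _ "\<rho>2 / 2"]) auto
  qed
  from connectedD[OF W(2) oZ this] have "Z \<inter> W = {} \<or> (W - Z) \<inter> W = {}" by auto
  then have "W \<subseteq> Z" using VZ V(2,3) by auto
  then show ?thesis using x Z0 by blast
qed

subsection \<open>Cones on the sphere\<close>

locale spherical_cone =
  fixes p :: "'a::euclidean_space" and \<omega> Sg :: "'a set"
  assumes norm_p: "norm p = 1"
    and \<omega>_sub: "\<omega> \<subseteq> {\<theta>. norm \<theta> = 1 \<and> \<theta> \<bullet> p = 0}"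
    and \<omega>_open: "openin (top_of_set {\<theta>. norm \<theta> = 1 \<and> \<theta> \<bullet> p = 0}) \<omega>"
    and \<omega>_conn: "connected \<omega>" and \<omega>_ne: "\<omega> \<noteq> {}"
    and Sg_def: "Sg = sph_cone p \<omega>"
begin

lemma pp [simp]: "p \<bullet> p = 1"
  using norm_p by (simp add: norm_eq_1)

lemma polar:
  assumes "norm \<theta> = 1" "\<theta> \<bullet> p = 0"
  shows "norm (cos t *\<^sub>R p + sin t *\<^sub>R \<theta>) = 1" "(cos t *\<^sub>R p + sin t *\<^sub>R \<theta>) \<bullet> p = cos t"
proof -
  have "\<theta> \<bullet> \<theta> = 1" using assms by (simp add: norm_eq_1)
  then have "(cos t *\<^sub>R p + sin t *\<^sub>R \<theta>) \<bullet> (cos t *\<^sub>R p + sin t *\<^sub>R \<theta>) = (cos t)\<^sup>2 + (sin t)\<^sup>2"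
    using assms by (simp add: inner_add_left inner_add_right inner_commute power2_eq_square)
  then show "norm (cos t *\<^sub>R p + sin t *\<^sub>R \<theta>) = 1" by (simp add: norm_eq_1)
  show "(cos t *\<^sub>R p + sin t *\<^sub>R \<theta>) \<bullet> p = cos t" using assms by (simp add: inner_add_left)
qed

lemma Sg_E:
  assumes "x \<in> Sg"
  obtains t \<theta> where "\<theta> \<in> \<omega>" "norm \<theta> = 1" "\<theta> \<bullet> p = 0" "0 < t" "t < pi" "x = cos t *\<^sub>R p + sin t *\<^sub>R \<theta>"
    "norm x = 1" "x \<bullet> p = cos t"
proof -
  obtain t \<theta> where t: "\<theta> \<in> \<omega>" "0 < t" "t < pi" "x = cos t *\<^sub>R p + sin t *\<^sub>R \<theta>"
    using assms unfolding Sg_def sph_cone_def by auto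
  then have "norm \<theta> = 1" "\<theta> \<bullet> p = 0" using \<omega>_sub by auto
  then show ?thesis using that t polar[of \<theta> t] by blast
qed

lemma Sg_I: "\<theta> \<in> \<omega> \<Longrightarrow> 0 < t \<Longrightarrow> t < pi \<Longrightarrow> cos t *\<^sub>R p + sin t *\<^sub>R \<theta> \<in> Sg"
  unfolding Sg_def sph_cone_def by auto

lemma Sg_bounds:
  assumes "x \<in> Sg"
  shows "norm x = 1" "- 1 < x \<bullet> p" "x \<bullet> p < 1"
proof -
  obtain t where "norm x = 1" "0 < t" "t < pi" "x \<bullet> p = cos t" using Sg_E[OF assms] by metis
  moreover have "cos t < cos 0" using calculation by (intro cos_monotone_0_pi) auto
  moreover have "cos pi < cos t" using calculation by (intro cos_monotone_0_pi) auto
  ultimately show "norm x = 1" "- 1 < x \<bullet> p" "x \<bullet> p < 1" by auto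
qed

text \<open>The cone is the preimage of \<open>\<omega>\<close> under the continuous projection of
  the sphere without its poles onto the equatorial sphere.\<close>

lemma Sg_open: "openin (top_of_set (sphere 0 1)) Sg"
proof -
  define S' where "S' = sphere (0::'a) 1 \<inter> {x. \<bar>x \<bullet> p\<bar> < 1}"
  define \<Phi> where "\<Phi> x = (x - (x \<bullet> p) *\<^sub>R p) /\<^sub>R sqrt (1 - (x \<bullet> p)\<^sup>2)" for x
  have op: "openin (top_of_set (sphere 0 1)) S'"
    unfolding S'_def by (intro openin_open_Int open_Collect_less continuous_intros)
  have sq: "(x \<bullet> p)\<^sup>2 < 1" if "x \<in> S'" for x using that by (auto simp: S'_def abs_square_less_1)
  have cont: "continuous_on S' \<Phi>"
    unfolding \<Phi>_def by (intro continuous_intros) (use sq in fastforce)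
  have im: "\<Phi> \<in> S' \<rightarrow> {\<theta>. norm \<theta> = 1 \<and> \<theta> \<bullet> p = 0}"
  proof
    fix x assume x: "x \<in> S'"
    have "x \<bullet> x = 1" using x by (simp add: S'_def norm_eq_1)
    then have "(x - (x \<bullet> p) *\<^sub>R p) \<bullet> (x - (x \<bullet> p) *\<^sub>R p) = 1 - (x \<bullet> p)\<^sup>2"
      by (simp add: inner_diff_left inner_diff_right inner_commute power2_eq_square)
    then have "norm (x - (x \<bullet> p) *\<^sub>R p) = sqrt (1 - (x \<bullet> p)\<^sup>2)" by (simp add: norm_eq_sqrt_inner)
    then show "\<Phi> x \<in> {\<theta>. norm \<theta> = 1 \<and> \<theta> \<bullet> p = 0}"
      using sq[OF x] by (simp add: \<Phi>_def inner_diff_left)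
  qed
  have "openin (top_of_set S') (S' \<inter> \<Phi> -` \<omega>)"
    by (rule continuous_openin_preimage[OF cont im \<omega>_open])
  then have "openin (top_of_set (sphere 0 1)) (S' \<inter> \<Phi> -` \<omega>)"
    using op openin_trans by blast
  moreover have "S' \<inter> \<Phi> -` \<omega> = Sg"
  proof (rule set_eqI, rule iffI)
    fix x assume x: "x \<in> S' \<inter> \<Phi> -` \<omega>"
    define t where "t = arccos (x \<bullet> p)"
    have ab: "\<bar>x \<bullet> p\<bar> < 1" using x by (auto simp: S'_def)
    then have ct: "cos t = x \<bullet> p" "sin t = sqrt (1 - (x \<bullet> p)\<^sup>2)" "0 < t" "t < pi"
      using arccos_lt_bounded[of "x \<bullet> p"] by (auto simp: t_def sin_arccos)
    have "x = cos t *\<^sub>R p + sin t *\<^sub>R \<Phi> x" unfolding ct \<Phi>_def using sq[of x] x by simp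
    then show "x \<in> Sg" using Sg_I[of "\<Phi> x" t] x ct by auto
  next
    fix x assume x: "x \<in> Sg"
    then obtain t \<theta> where t: "\<theta> \<in> \<omega>" "norm \<theta> = 1" "\<theta> \<bullet> p = 0" "0 < t" "t < pi" "x = cos t *\<^sub>R p + sin t *\<^sub>R \<theta>"
      "norm x = 1" "x \<bullet> p = cos t" by (rule Sg_E)
    have "sin t > 0" using t by (simp add: sin_gt_zero)
    then have s: "sqrt (1 - (x \<bullet> p)\<^sup>2) = sin t"
      unfolding t(8) by (simp add: cos_squared_eq)
    have "\<Phi> x = (x - cos t *\<^sub>R p) /\<^sub>R sin t" unfolding \<Phi>_def s by (simp only: t(8))
    also have "\<dots> = \<theta>" unfolding t(6) using \<open>sin t > 0\<close> by simp
    finally have "\<Phi> x = \<theta>" .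
    moreover have "x \<in> S'" using Sg_bounds[OF x] by (auto simp: S'_def)
    ultimately show "x \<in> S' \<inter> \<Phi> -` \<omega>" using t by auto
  qed
  ultimately show ?thesis by simp
qed

text \<open>Image of the product of two connected sets under polar coordinates.\<close>

lemma connected_sector:
  assumes "connected T" "T \<subseteq> {0<..<pi}"
  shows "connected {x\<in>Sg. \<exists>t\<in>T. x \<bullet> p = cos t}"
proof -
  have "connected ((\<lambda>(\<theta>, t). cos t *\<^sub>R p + sin t *\<^sub>R \<theta>) ` (\<omega> \<times> T))"
    unfolding split_def
    by (intro connected_continuous_image connected_Times \<omega>_conn assms continuous_intros)
  moreover have "(\<lambda>(\<theta>, t). cos t *\<^sub>R p + sin t *\<^sub>R \<theta>) ` (\<omega> \<times> T) = {x\<in>Sg. \<exists>t\<in>T. x \<bullet> p = cos t}"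
  proof (intro set_eqI iffI)
    fix x assume "x \<in> (\<lambda>(\<theta>, t). cos t *\<^sub>R p + sin t *\<^sub>R \<theta>) ` (\<omega> \<times> T)"
    then obtain \<theta> t where t: "\<theta> \<in> \<omega>" "t \<in> T" "x = cos t *\<^sub>R p + sin t *\<^sub>R \<theta>" by auto
    then have "x \<in> Sg" using Sg_I[of \<theta> t] assms(2) by (auto simp: subset_iff)
    moreover have "x \<bullet> p = cos t" unfolding t(3) using t(1) \<omega>_sub by (intro polar) auto
    ultimately show "x \<in> {x\<in>Sg. \<exists>t\<in>T. x \<bullet> p = cos t}" using t by blast
  next
    fix x assume x: "x \<in> {x\<in>Sg. \<exists>t\<in>T. x \<bullet> p = cos t}"
    then obtain s where s: "s \<in> T" "x \<bullet> p = cos s" by blast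
    obtain t \<theta> where t: "\<theta> \<in> \<omega>" "0 < t" "t < pi" "x = cos t *\<^sub>R p + sin t *\<^sub>R \<theta>" "x \<bullet> p = cos t"
      using x Sg_E[of x] by blast
    have "t = s" using t s assms(2) cos_inj_pi[of t s] by (auto simp: subset_iff)
    then show "x \<in> (\<lambda>(\<theta>, t). cos t *\<^sub>R p + sin t *\<^sub>R \<theta>) ` (\<omega> \<times> T)"
      using t s by (auto intro!: image_eqI[of _ _ "(\<theta>, s)"])
  qed
  ultimately show ?thesis by simp
qed

lemma connected_upper:
  assumes "- 1 \<le> c" "c < 1"
  shows "connected {x\<in>Sg. c < x \<bullet> p}"
proof -
  have a: "0 < arccos c" "arccos c \<le> pi" using assms arccos_less_arccos[of c 1] arccos_bounded[of c] by auto
  have "connected {x\<in>Sg. \<exists>t\<in>{0<..<arccos c}. x \<bullet> p = cos t}"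
    by (rule connected_sector) (use a in auto)
  moreover have "{x\<in>Sg. \<exists>t\<in>{0<..<arccos c}. x \<bullet> p = cos t} = {x\<in>Sg. c < x \<bullet> p}"
  proof (intro Collect_cong conj_cong refl iffI)
    fix x assume "\<exists>t\<in>{0<..<arccos c}. x \<bullet> p = cos t"
    then obtain t where "0 < t" "t < arccos c" "x \<bullet> p = cos t" by auto
    then show "c < x \<bullet> p" using cos_monotone_0_pi[of t "arccos c"] a assms by simp
  next
    fix x assume "x \<in> Sg" "c < x \<bullet> p"
    then obtain t where t: "0 < t" "t < pi" "x \<bullet> p = cos t" using Sg_E by metis
    have "t < arccos c"
    proof (rule ccontr)
      assume "\<not> t < arccos c"
      then have "cos t \<le> cos (arccos c)" using t a by (intro cos_monotone_0_pi_le) auto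
      then show False using t \<open>c < x \<bullet> p\<close> assms by simp
    qed
    then show "\<exists>t\<in>{0<..<arccos c}. x \<bullet> p = cos t" using t by auto
  qed
  ultimately show ?thesis by simp
qed

lemma connected_lower:
  assumes "- 1 < c" "c \<le> 1"
  shows "connected {x\<in>Sg. x \<bullet> p < c}"
proof -
  have a: "0 \<le> arccos c" "arccos c < pi" using assms arccos_less_arccos[of "-1" c] arccos_bounded[of c] by auto
  have "connected {x\<in>Sg. \<exists>t\<in>{arccos c<..<pi}. x \<bullet> p = cos t}"
    by (rule connected_sector) (use a in auto)
  moreover have "{x\<in>Sg. \<exists>t\<in>{arccos c<..<pi}. x \<bullet> p = cos t} = {x\<in>Sg. x \<bullet> p < c}"
  proof (intro Collect_cong conj_cong refl iffI)
    fix x assume "\<exists>t\<in>{arccos c<..<pi}. x \<bullet> p = cos t"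
    then obtain t where "arccos c < t" "t < pi" "x \<bullet> p = cos t" by auto
    then show "x \<bullet> p < c" using cos_monotone_0_pi[of "arccos c" t] a assms by simp
  next
    fix x assume "x \<in> Sg" "x \<bullet> p < c"
    then obtain t where t: "0 < t" "t < pi" "x \<bullet> p = cos t" using Sg_E by metis
    have "arccos c < t"
    proof (rule ccontr)
      assume "\<not> arccos c < t"
      then have "cos (arccos c) \<le> cos t" using t a by (intro cos_monotone_0_pi_le) auto
      then show False using t \<open>x \<bullet> p < c\<close> assms by simp
    qed
    then show "\<exists>t\<in>{arccos c<..<pi}. x \<bullet> p = cos t" using t by auto
  qed
  ultimately show ?thesis by simp
qed

lemma Sg_level_exists:
  assumes "- 1 < c" "c < 1"
  shows "\<exists>x\<in>Sg. x \<bullet> p = c"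
proof -
  obtain \<theta> where th: "\<theta> \<in> \<omega>" using \<omega>_ne by blast
  then have "norm \<theta> = 1" "\<theta> \<bullet> p = 0" using \<omega>_sub by auto
  then show ?thesis
    using Sg_I[OF th, of "arccos c"] polar[of \<theta> "arccos c"] arccos_lt_bounded[OF assms] assms by force
qed

text \<open>Move along the meridian through \<open>x\<close>, towards \<open>p\<close> and away from
  it.\<close>

lemma closure_levels:
  assumes x: "x \<in> Sg"
  shows "x \<in> closure {y\<in>Sg. y \<bullet> p > x \<bullet> p}" "x \<in> closure {y\<in>Sg. y \<bullet> p < x \<bullet> p}"
proof -
  obtain t \<theta> where t: "\<theta> \<in> \<omega>" "norm \<theta> = 1" "\<theta> \<bullet> p = 0" "0 < t" "t < pi" "x = cos t *\<^sub>R p + sin t *\<^sub>R \<theta>"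
    "norm x = 1" "x \<bullet> p = cos t" using Sg_E[OF x] by blast
  define g where "g s = cos s *\<^sub>R p + sin s *\<^sub>R \<theta>" for s
  have cg: "continuous_on UNIV g" unfolding g_def by (intro continuous_intros)
  have gp: "g s \<bullet> p = cos s" for s unfolding g_def using t by (intro polar)
  have cl: "x \<in> closure B" if "\<And>s. s \<in> A \<Longrightarrow> g s \<in> B" "t \<in> closure A" for A B
  proof -
    have "g ` closure A \<subseteq> closure (g ` A)"
      by (rule image_closure_subset[OF continuous_on_subset[OF cg]]) (auto simp: closure_subset)
    also have "\<dots> \<subseteq> closure B" by (rule closure_mono) (use that in auto)
    finally show ?thesis using that(2) t(6) unfolding g_def by auto
  qed
  show "x \<in> closure {y\<in>Sg. y \<bullet> p > x \<bullet> p}"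
  proof (rule cl[of "{0<..<t}"])
    show "t \<in> closure {0<..<t}" using t by simp
    show "g s \<in> {y\<in>Sg. y \<bullet> p > x \<bullet> p}" if "s \<in> {0<..<t}" for s
      using that t Sg_I[OF t(1), of s] gp[of s] cos_monotone_0_pi[of s t] unfolding g_def by auto
  qed
  show "x \<in> closure {y\<in>Sg. y \<bullet> p < x \<bullet> p}"
  proof (rule cl[of "{t<..<pi}"])
    show "t \<in> closure {t<..<pi}" using t by simp
    show "g s \<in> {y\<in>Sg. y \<bullet> p < x \<bullet> p}" if "s \<in> {t<..<pi}" for s
      using that t Sg_I[OF t(1), of s] gp[of s] cos_monotone_0_pi[of t s] unfolding g_def by auto
  qed
qed

lemma closure_lower_openin:
  assumes A: "openin (top_of_set (sphere 0 1)) A" and x: "x \<in> A" "x \<in> Sg"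
  shows "x \<in> closure {y\<in>A. y \<bullet> p < x \<bullet> p}"
proof -
  obtain U where U: "open U" "A = sphere 0 1 \<inter> U" using A by (auto simp: openin_open)
  have "x \<in> U \<inter> closure {y\<in>Sg. y \<bullet> p < x \<bullet> p}" using closure_levels(2)[OF x(2)] U x by auto
  then have "x \<in> closure (U \<inter> {y\<in>Sg. y \<bullet> p < x \<bullet> p})"
    using open_Int_closure_subset[OF U(1)] by blast
  moreover have "U \<inter> {y\<in>Sg. y \<bullet> p < x \<bullet> p} \<subseteq> {y\<in>A. y \<bullet> p < x \<bullet> p}"
    using U Sg_bounds(1) by auto
  ultimately show ?thesis using closure_mono by blast
qed

lemma closure_upper_Int: "closure {x\<in>Sg. b < x \<bullet> p} \<inter> Sg = {x\<in>Sg. b \<le> x \<bullet> p}"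
proof (intro equalityI subsetI)
  fix x assume x: "x \<in> closure {x\<in>Sg. b < x \<bullet> p} \<inter> Sg"
  have "closure {x\<in>Sg. b < x \<bullet> p} \<subseteq> {x. b \<le> x \<bullet> p}"
    by (rule closure_minimal) (auto intro!: closed_Collect_le continuous_intros)
  then show "x \<in> {x\<in>Sg. b \<le> x \<bullet> p}" using x by auto
next
  fix x assume x: "x \<in> {x\<in>Sg. b \<le> x \<bullet> p}"
  then have "{y\<in>Sg. y \<bullet> p > x \<bullet> p} \<subseteq> {x\<in>Sg. b < x \<bullet> p}" by auto
  then show "x \<in> closure {x\<in>Sg. b < x \<bullet> p} \<inter> Sg"
    using closure_levels(1)[of x] x closure_mono by blast
qed

text \<open>The circle of latitude through \<open>x\<close> in direction \<open>w\<close>; its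
  radius is sin r, hence the length of the velocity. It supplies tangent vectors for normals and for
  tangential derivatives.\<close>

lemma level_curve:
  assumes x: "x \<in> Sg" and A: "openin (top_of_set (sphere 0 1)) A" "x \<in> A"
    and w: "norm w = 1" "w \<bullet> x = 0" "w \<bullet> p = 0"
  obtains \<gamma> \<epsilon> where "\<epsilon> > 0" "\<gamma> 0 = x" "\<And>t. \<bar>t\<bar> < \<epsilon> \<Longrightarrow> \<gamma> t \<in> Sg \<inter> A \<and> \<gamma> t \<bullet> p = x \<bullet> p"
    "(\<gamma> has_vector_derivative sqrt (1 - (x \<bullet> p)\<^sup>2) *\<^sub>R w) (at 0)"
proof -
  define c where "c = x \<bullet> p"
  define m where "m = x - c *\<^sub>R p"
  define \<sigma> where "\<sigma> = sqrt (1 - c\<^sup>2)"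
  define \<gamma> where "\<gamma> t = c *\<^sub>R p + cos t *\<^sub>R m + sin t *\<^sub>R (\<sigma> *\<^sub>R w)" for t
  have xx: "x \<bullet> x = 1" using Sg_bounds[OF x] by (simp add: norm_eq_1)
  have ww: "w \<bullet> w = 1" using w by (simp add: norm_eq_1)
  have c1: "c\<^sup>2 < 1" using Sg_bounds[OF x] by (simp add: c_def abs_square_less_1)
  have sg: "\<sigma> * \<sigma> = 1 - c\<^sup>2" using c1 by (simp add: \<sigma>_def)
  have mm: "m \<bullet> m = 1 - c\<^sup>2" "m \<bullet> p = 0" "m \<bullet> w = 0" "p \<bullet> m = 0" "w \<bullet> m = 0"
    using xx w by (auto simp: m_def c_def inner_diff_left inner_diff_right inner_commute power2_eq_square)
  have gp: "\<gamma> t \<bullet> p = c" for t using mm w by (simp add: \<gamma>_def inner_add_left)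
  have "\<gamma> t \<bullet> \<gamma> t = c\<^sup>2 + (1 - c\<^sup>2) * ((cos t)\<^sup>2 + (sin t)\<^sup>2)" for t
  proof -
    have "\<gamma> t \<bullet> \<gamma> t = c\<^sup>2 + (cos t)\<^sup>2 * (m \<bullet> m) + (sin t)\<^sup>2 * (\<sigma> * \<sigma>)"
      using mm w ww by (simp add: \<gamma>_def inner_add_left inner_add_right power2_eq_square inner_commute)
    then show ?thesis unfolding mm(1) sg
      by (simp only: mult.commute[of "1 - c\<^sup>2"] distrib_right add.assoc)
  qed
  then have "\<gamma> t \<bullet> \<gamma> t = 1" for t unfolding sin_cos_squared_add2 by simp
  then have gn: "\<gamma> t \<in> sphere 0 1" for t by (simp add: norm_eq_1)
  have g0: "\<gamma> 0 = x" by (simp add: \<gamma>_def m_def)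
  have cg: "continuous_on UNIV \<gamma>" unfolding \<gamma>_def by (intro continuous_intros)
  have "openin (top_of_set (sphere 0 1)) (Sg \<inter> A)" by (intro openin_Int Sg_open A)
  then obtain U where U: "open U" "Sg \<inter> A = sphere 0 1 \<inter> U" by (auto simp: openin_open)
  have "open (\<gamma> -` U)" using cg U(1) by (simp add: open_vimage continuous_on_eq_continuous_at)
  moreover have "0 \<in> \<gamma> -` U" using g0 x A U by auto
  ultimately obtain \<epsilon> where e: "\<epsilon> > 0" "ball 0 \<epsilon> \<subseteq> \<gamma> -` U" using open_contains_ball by blast
  have "((\<lambda>t. c *\<^sub>R p + cos t *\<^sub>R m + sin t *\<^sub>R (\<sigma> *\<^sub>R w)) has_vector_derivative
      0 + (- sin 0) *\<^sub>R m + cos 0 *\<^sub>R (\<sigma> *\<^sub>R w)) (at 0)"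
    by (auto intro!: derivative_eq_intros)
  then have "(\<gamma> has_vector_derivative \<sigma> *\<^sub>R w) (at 0)" by (simp add: \<gamma>_def[abs_def])
  moreover have "\<gamma> t \<in> Sg \<inter> A \<and> \<gamma> t \<bullet> p = x \<bullet> p" if "\<bar>t\<bar> < \<epsilon>" for t
    using that e gn[of t] U gp[of t] by (auto simp: c_def subset_iff)
  ultimately show ?thesis using that[of \<epsilon> \<gamma>] e g0 unfolding \<sigma>_def c_def by blast
qed

text \<open>\<open>A\<close> and the complement of its closure separate a connected set that misses
  the boundary.\<close>

lemma connected_subset_of_openin:
  assumes T: "connected T" "T \<subseteq> Sg" and A: "openin (top_of_set (sphere 0 1)) A"
    and d: "T \<inter> bdry A = {}" and ne: "T \<inter> A \<noteq> {}"
  shows "T \<subseteq> A"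
proof -
  obtain U where U: "open U" "A = sphere 0 1 \<inter> U" using A by (auto simp: openin_open)
  have TS: "T \<subseteq> sphere 0 1" using T(2) Sg_bounds(1) by auto
  have "T \<subseteq> U \<union> - closure A" using d U unfolding bdry_def by auto
  moreover have "U \<inter> - closure A \<inter> T = {}" using TS U closure_subset[of A] by auto
  ultimately have "U \<inter> T = {} \<or> - closure A \<inter> T = {}"
    using connectedD[OF T(1) U(1)] by (metis closed_closure open_Compl)
  then have "T \<subseteq> closure A" using ne U by auto
  then show ?thesis using d unfolding bdry_def by auto
qed

text \<open>The unit tangent vector at \<open>x\<close> pointing towards \<open>p\<close>, that is,
  minus the gradient of r.\<close>

definition radial_dir :: "'a \<Rightarrow> 'a" where
  "radial_dir x = (p - (x \<bullet> p) *\<^sub>R x) /\<^sub>R sqrt (1 - (x \<bullet> p)\<^sup>2)"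

lemma radial_dir:
  assumes x: "x \<in> Sg"
  shows "norm (radial_dir x) = 1" "radial_dir x \<bullet> x = 0" "radial_dir x \<bullet> p = sqrt (1 - (x \<bullet> p)\<^sup>2)"
    "p = (x \<bullet> p) *\<^sub>R x + sqrt (1 - (x \<bullet> p)\<^sup>2) *\<^sub>R radial_dir x" "(x \<bullet> p)\<^sup>2 < 1"
proof -
  define s where "s = sqrt (1 - (x \<bullet> p)\<^sup>2)"
  show c1: "(x \<bullet> p)\<^sup>2 < 1" using Sg_bounds[OF x] by (simp add: abs_square_less_1)
  then have s: "s > 0" "s * s = 1 - (x \<bullet> p)\<^sup>2" by (simp_all add: s_def)
  have xx: "x \<bullet> x = 1" using Sg_bounds[OF x] by (simp add: norm_eq_1)
  have e: "radial_dir x = (p - (x \<bullet> p) *\<^sub>R x) /\<^sub>R s" by (simp add: radial_dir_def s_def)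
  have "(p - (x \<bullet> p) *\<^sub>R x) \<bullet> (p - (x \<bullet> p) *\<^sub>R x) = s * s"
    unfolding s(2) using xx by (simp add: inner_diff_left inner_diff_right inner_commute power2_eq_square)
  then have "norm (p - (x \<bullet> p) *\<^sub>R x) = sqrt (s * s)" by (simp only: norm_eq_sqrt_inner)
  then have "norm (p - (x \<bullet> p) *\<^sub>R x) = s" using s(1) by simp
  then show "norm (radial_dir x) = 1" unfolding e using s by simp
  show "radial_dir x \<bullet> x = 0" unfolding e inner_scaleR_left inner_diff_left xx by (simp add: inner_commute)
  have "(p - (x \<bullet> p) *\<^sub>R x) \<bullet> p = s * s"
    unfolding s(2) by (simp add: inner_diff_left power2_eq_square)
  then show "radial_dir x \<bullet> p = sqrt (1 - (x \<bullet> p)\<^sup>2)" unfolding e s_def[symmetric] using s(1) by simp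
  show "p = (x \<bullet> p) *\<^sub>R x + sqrt (1 - (x \<bullet> p)\<^sup>2) *\<^sub>R radial_dir x"
    unfolding e s_def[symmetric] using s(1) by simp
qed

text \<open>\<open>p\<close> lies in the span of \<open>x\<close> and \<open>radial_dir x\<close>,
  so \<open>v\<close> is orthogonal to \<open>p\<close> and, once normalised, may itself be inserted
  for \<open>w\<close>.\<close>

lemma perp_zero:
  assumes x: "x \<in> Sg" and v: "v \<bullet> x = 0" "v \<bullet> radial_dir x = 0"
    and w: "\<And>w. norm w = 1 \<Longrightarrow> w \<bullet> x = 0 \<Longrightarrow> w \<bullet> p = 0 \<Longrightarrow> v \<bullet> w = 0"
  shows "v = 0"
proof (rule ccontr)
  assume "v \<noteq> 0"
  have "v \<bullet> p = 0" using arg_cong[OF radial_dir(4)[OF x], of "\<lambda>q. v \<bullet> q"] v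
    by (simp add: inner_add_right)
  then have "v \<bullet> (v /\<^sub>R norm v) = 0" using w[of "v /\<^sub>R norm v"] v \<open>v \<noteq> 0\<close> by simp
  then show False using \<open>v \<noteq> 0\<close> by simp
qed

text \<open>Circles of latitude supply enough tangent directions to confine the normal to the radial
  line; \<open>normal_eq_inner\<close> settles the sign when \<open>A\<close> lies below the
  level.\<close>

lemma normal_eq:
  assumes x: "x \<in> Sg" and B: "{y\<in>Sg. y \<bullet> p = x \<bullet> p} \<subseteq> bdry A" and \<nu>: "outward_normal A x \<nu>"
  shows "\<nu> = radial_dir x \<or> \<nu> = - radial_dir x"
proof -
  note rd = radial_dir[OF x]
  have rr: "radial_dir x \<bullet> radial_dir x = 1" using rd(1) by (simp add: norm_eq_1)
  define v where "v = \<nu> - (\<nu> \<bullet> radial_dir x) *\<^sub>R radial_dir x"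
  have n: "norm \<nu> = 1" "\<nu> \<bullet> x = 0" and tan: "\<And>v. v \<in> tangent_vecs (bdry A) x \<Longrightarrow> v \<bullet> \<nu> = 0"
    using \<nu> by (auto simp: outward_normal_def)
  have "v = 0"
  proof (rule perp_zero[OF x])
    show "v \<bullet> x = 0" using n rd by (simp add: v_def inner_diff_left)
    show "v \<bullet> radial_dir x = 0" using rr by (simp add: v_def inner_diff_left)
    fix w assume w: "norm w = 1" "w \<bullet> x = 0" "w \<bullet> p = 0"
    have "w \<bullet> radial_dir x = 0"
      unfolding radial_dir_def using w by (simp add: inner_diff_right)
    moreover have "sqrt (1 - (x \<bullet> p)\<^sup>2) *\<^sub>R w \<in> tangent_vecs (bdry A) x"
    proof -
      obtain \<gamma> \<epsilon> where "\<epsilon> > 0" "\<gamma> 0 = x" "\<And>t. \<bar>t\<bar> < \<epsilon> \<Longrightarrow> \<gamma> t \<in> Sg \<inter> sphere 0 1 \<and> \<gamma> t \<bullet> p = x \<bullet> p"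
        "(\<gamma> has_vector_derivative sqrt (1 - (x \<bullet> p)\<^sup>2) *\<^sub>R w) (at 0)"
        by (rule level_curve[OF x _ _ w, of "sphere 0 1"]) (use Sg_bounds(1)[OF x] in auto)
      then show ?thesis using B unfolding tangent_vecs_def
        by (intro CollectI exI[of _ \<gamma>] exI[of _ \<epsilon>]) auto
    qed
    then have "w \<bullet> \<nu> = 0" using tan[of "sqrt (1 - (x \<bullet> p)\<^sup>2) *\<^sub>R w"] rd(5) by simp
    ultimately have "w \<bullet> v = 0" by (simp add: v_def inner_diff_right)
    then show "v \<bullet> w = 0" by (simp add: inner_commute)
  qed
  then have v: "\<nu> = (\<nu> \<bullet> radial_dir x) *\<^sub>R radial_dir x" by (simp add: v_def)
  then have "\<bar>\<nu> \<bullet> radial_dir x\<bar> = 1" using n(1) rd(1) by (metis mult.right_neutral norm_scaleR)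
  then consider "\<nu> \<bullet> radial_dir x = 1" | "\<nu> \<bullet> radial_dir x = - 1" by linarith
  then show ?thesis using v by cases auto
qed

text \<open>With the opposite sign, the points \<open>sexp x (- t) \<nu>\<close> of \<open>A\<close>
  would start towards \<open>p\<close>, where the inner product with \<open>p\<close> exceeds its
  value at \<open>x\<close>.\<close>

lemma normal_eq_inner:
  assumes x: "x \<in> Sg" and B: "{y\<in>Sg. y \<bullet> p = x \<bullet> p} \<subseteq> bdry A" and \<nu>: "outward_normal A x \<nu>"
    and A: "\<And>y. y \<in> A \<Longrightarrow> y \<bullet> p < x \<bullet> p"
  shows "\<nu> = radial_dir x"
proof (rule ccontr)
  assume "\<nu> \<noteq> radial_dir x"
  then have n: "\<nu> = - radial_dir x" using normal_eq[OF x B \<nu>] by blast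
  define s where "s = sqrt (1 - (x \<bullet> p)\<^sup>2)"
  have s: "s > 0" using radial_dir(5)[OF x] by (simp add: s_def)
  obtain \<epsilon> where e: "\<epsilon> > 0" "\<And>t. 0 < t \<Longrightarrow> t < \<epsilon> \<Longrightarrow> sexp x (- t) \<nu> \<in> A"
    using \<nu> by (auto simp: outward_normal_def)
  have val: "sexp x (- t) \<nu> \<bullet> p = (x \<bullet> p) * cos t + s * sin t" for t
    unfolding sexp_def n using radial_dir(3)[OF x] by (simp add: inner_add_left s_def)
  have "((\<lambda>t. (x \<bullet> p) * cos t + s * sin t) has_real_derivative s) (at 0)"
    by (auto intro!: derivative_eq_intros)
  from DERIV_pos_inc_right[OF this s] obtain d where d: "d > 0"
    "\<And>h. 0 < h \<Longrightarrow> h < d \<Longrightarrow> (x \<bullet> p) * cos 0 + s * sin 0 < (x \<bullet> p) * cos (0 + h) + s * sin (0 + h)"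
    by blast
  define t where "t = min \<epsilon> d / 2"
  have "0 < t" "t < \<epsilon>" "t < d" using e d by (auto simp: t_def)
  then have "sexp x (- t) \<nu> \<bullet> p < x \<bullet> p" "x \<bullet> p < (x \<bullet> p) * cos t + s * sin t"
    using A[OF e(2)] d(2)[of t] by simp_all
  then show False using val[of t] by simp
qed

end

section \<open>Open and connected cones in the ambient space\<close>

lemma open_cone_over:
  fixes A :: "'a::real_normed_vector set"
  assumes "openin (top_of_set (sphere 0 1)) A"
  shows "open (cone_over A)"
proof -
  obtain U where U: "open U" "A = sphere 0 1 \<inter> U" using assms by (auto simp: openin_open)
  have "continuous_on (- {0}) (\<lambda>y::'a. inverse (norm y) *\<^sub>R y)"
    by (intro continuous_intros) auto
  then have "open (- {0} \<inter> (\<lambda>y::'a. inverse (norm y) *\<^sub>R y) -` U)"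
    using U(1) by (intro continuous_open_preimage) auto
  moreover have "- {0} \<inter> (\<lambda>y::'a. inverse (norm y) *\<^sub>R y) -` U = cone_over A"
    by (auto simp: cone_over_def U(2))
  ultimately show ?thesis by simp
qed

lemma connected_cone_over:
  fixes A :: "'a::real_normed_vector set"
  assumes "connected A" "A \<subseteq> sphere 0 1"
  shows "connected (cone_over A)"
proof -
  have "connected ((\<lambda>(x, t). t *\<^sub>R x) ` (A \<times> {0::real<..}))"
    unfolding split_def by (intro connected_continuous_image connected_Times assms continuous_intros) auto
  moreover have "(\<lambda>(x, t). t *\<^sub>R x) ` (A \<times> {0::real<..}) = cone_over A"
  proof (intro set_eqI iffI)
    fix y assume "y \<in> (\<lambda>(x, t). t *\<^sub>R x) ` (A \<times> {0::real<..})"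
    then obtain x t where "x \<in> A" "t > 0" "y = t *\<^sub>R x" by auto
    moreover have "norm x = 1" using calculation assms by auto
    ultimately show "y \<in> cone_over A" unfolding cone_over_def by auto
  next
    fix y assume "y \<in> cone_over A"
    then show "y \<in> (\<lambda>(x, t). t *\<^sub>R x) ` (A \<times> {0::real<..})"
      unfolding cone_over_def by (intro image_eqI[of _ _ "(inverse (norm y) *\<^sub>R y, norm y)"]) auto
  qed
  ultimately show ?thesis by simp
qed

subsection \<open>Homogeneous extensions and boundary derivatives\<close>

lemma has_pd_divide:
  "has_pd v f A y \<Longrightarrow> has_pd v g B y \<Longrightarrow> g y \<noteq> 0 \<Longrightarrow>
    has_pd v (\<lambda>y. f y / g y) ((A * g y - f y * B) / (g y * g y)) y"
  unfolding has_pd_def using DERIV_divide[of "\<lambda>t. f (y + t *\<^sub>R v)" A 0 UNIV "\<lambda>t. g (y + t *\<^sub>R v)" B] by simp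

lemma has_pd_norm:
  fixes y :: "'a::real_inner"
  assumes "y \<noteq> 0"
  shows "has_pd v norm (y \<bullet> v / norm y) y"
  using has_derivative_imp_has_pd[OF has_derivative_norm[OF assms], of v]
  by (simp add: sgn_div_norm inner_commute divide_inverse mult_ac)

lemma has_pd_inner0: "has_pd v (\<lambda>y. y \<bullet> q) (v \<bullet> q) y"
  using has_pd_inner[of v 0 q y] by simp

lemma has_pd_scale:
  assumes "has_pd i f D (s *\<^sub>R y)"
  shows "has_pd i (\<lambda>z. f (s *\<^sub>R z)) (s * D) y"
proof -
  have "((\<lambda>t. f (s *\<^sub>R y + t *\<^sub>R i)) has_real_derivative D) (at (s * 0))"
    using assms by (simp add: has_pd_def)
  moreover have "((\<lambda>t. s * t) has_real_derivative s) (at 0)" by (auto intro!: derivative_eq_intros)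
  ultimately have "((\<lambda>t. f (s *\<^sub>R y + (s * t) *\<^sub>R i)) has_real_derivative D * s) (at 0)"
    by (rule DERIV_chain2)
  then show ?thesis by (simp add: has_pd_def scaleR_add_right mult.commute)
qed

text \<open>Most of the traces computed in \<open>Ht_harmonic\<close> are coordinate sums of this
  shape.\<close>

lemma sum_quadratic_Basis:
  fixes p y :: "'a::euclidean_space"
  shows "(\<Sum>i\<in>Basis. \<alpha> * (p \<bullet> i)\<^sup>2 + \<beta> * ((p \<bullet> i) * (y \<bullet> i)) + \<gamma> * (y \<bullet> i)\<^sup>2 + \<delta>)
    = \<alpha> * (norm p)\<^sup>2 + \<beta> * (p \<bullet> y) + \<gamma> * (norm y)\<^sup>2 + \<delta> * real DIM('a)"
proof -
  have "(\<Sum>i\<in>Basis. (z \<bullet> i)\<^sup>2) = (norm z)\<^sup>2" for z :: 'a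
    unfolding power2_norm_eq_inner by (simp add: euclidean_inner[of z z] power2_eq_square)
  moreover have "(\<Sum>i\<in>Basis. (p \<bullet> i) * (y \<bullet> i)) = p \<bullet> y" by (rule euclidean_inner[symmetric])
  ultimately show ?thesis by (simp add: sum.distrib sum_distrib_left[symmetric])
qed

lemma normalize_scale:
  fixes y :: "'a::real_normed_vector"
  assumes "s > 0"
  shows "inverse (norm (s *\<^sub>R y)) *\<^sub>R (s *\<^sub>R y) = inverse (norm y) *\<^sub>R y"
proof -
  have "inverse (norm (s *\<^sub>R y)) * s = inverse (norm y)" using assms by simp
  then show ?thesis by (metis scaleR_scaleR)
qed

lemma hext_scale: "s > 0 \<Longrightarrow> hext u (s *\<^sub>R y) = hext u y"
  unfolding hext_def by (simp only: normalize_scale)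

lemma cone_over_scale: "s > 0 \<Longrightarrow> y \<in> cone_over A \<Longrightarrow> s *\<^sub>R y \<in> cone_over A"
  unfolding cone_over_def mem_Collect_eq normalize_scale by simp

text \<open>Consequences of homogeneity of degree zero: no derivative along the ray, first
  derivatives of degree -1, second ones of degree -2. The scaling laws carry the equation from the
  sphere to the cone.\<close>

lemma hext_C2:
  fixes u :: "'a::euclidean_space \<Rightarrow> real"
  assumes A: "openin (top_of_set (sphere 0 1)) A" and C2: "sph_C2 A u"
  defines "D \<equiv> \<lambda>y. frechet_derivative (hext u) (at y)"
  shows "\<And>y v. y \<in> cone_over A \<Longrightarrow> has_pd v (hext u) (D y v) y"
    and "\<And>y i. y \<in> cone_over A \<Longrightarrow> has_pd i (\<lambda>z. D z i) (ehess (hext u) y i i) y"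
    and "\<And>i. continuous_on (cone_over A) (\<lambda>y. D y i)"
    and "\<And>i. continuous_on (cone_over A) (\<lambda>y. ehess (hext u) y i i)"
    and "\<And>y. y \<in> cone_over A \<Longrightarrow> D y y = 0"
    and "\<And>y v s. y \<in> cone_over A \<Longrightarrow> s > 0 \<Longrightarrow> D y v = s * D (s *\<^sub>R y) v"
    and "\<And>y i s. y \<in> cone_over A \<Longrightarrow> s > 0 \<Longrightarrow> ehess (hext u) y i i = s\<^sup>2 * ehess (hext u) (s *\<^sub>R y) i i"
    and "\<And>y v. y \<in> cone_over A \<Longrightarrow> D y v = egrad (hext u) y \<bullet> v"
proof -
  let ?O = "cone_over A"
  have O: "open ?O" by (rule open_cone_over[OF A])
  have C: "hext u differentiable_on ?O" "\<And>v. (\<lambda>x. D x v) differentiable_on ?O"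
    "\<And>v v'. continuous_on ?O (\<lambda>x. frechet_derivative (\<lambda>x. D x v) (at x) v')"
    using C2 by (auto simp: sph_C2_def numeral_2_eq_2 D_def)
  have d1: "(hext u has_derivative D y) (at y)" if "y \<in> ?O" for y
    using C(1) that O unfolding D_def
    by (simp add: differentiable_on_eq_differentiable_at frechet_derivative_works)
  have d2: "((\<lambda>x. D x v) has_derivative frechet_derivative (\<lambda>x. D x v) (at y)) (at y)" if "y \<in> ?O" for y v
    using C(2)[of v] that O
    by (simp add: differentiable_on_eq_differentiable_at frechet_derivative_works)
  show p1: "has_pd v (hext u) (D y v) y" if "y \<in> ?O" for y v
    by (rule has_derivative_imp_has_pd[OF d1[OF that]])
  show p2: "has_pd i (\<lambda>z. D z i) (ehess (hext u) y i i) y" if "y \<in> ?O" for y i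
    using has_derivative_imp_has_pd[OF d2[OF that, of i], of i] by (simp add: ehess_def D_def)
  show "continuous_on ?O (\<lambda>y. D y i)" for i
    by (rule differentiable_imp_continuous_on[OF C(2)])
  show "continuous_on ?O (\<lambda>y. ehess (hext u) y i i)" for i
    using C(3)[of i i] by (simp add: ehess_def D_def)
  show "D y y = 0" if y: "y \<in> ?O" for y
  proof -
    have "((\<lambda>t. hext u (y + t *\<^sub>R y)) has_real_derivative 0) (at 0)"
    proof (rule has_field_derivative_transform_within_open[where S="{-1<..}"])
      show "((\<lambda>t. hext u y) has_real_derivative 0) (at 0)" by simp
      fix t :: real assume "t \<in> {-1<..}"
      moreover have "y + t *\<^sub>R y = (1 + t) *\<^sub>R y" by (simp add: algebra_simps)
      ultimately show "hext u y = hext u (y + t *\<^sub>R y)" by (simp add: hext_scale)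
    qed auto
    then have "has_pd y (hext u) 0 y" by (simp add: has_pd_def)
    then show ?thesis using p1[OF y, of y] has_pd_unique by blast
  qed
  show s1: "D y v = s * D (s *\<^sub>R y) v" if y: "y \<in> ?O" "s > 0" for y v s
  proof -
    have "has_pd v (\<lambda>z. hext u (s *\<^sub>R z)) (s * D (s *\<^sub>R y) v) y"
      by (intro has_pd_scale p1 cone_over_scale y)
    then have "has_pd v (hext u) (s * D (s *\<^sub>R y) v) y" using y by (simp add: hext_scale)
    then show ?thesis using p1[OF y(1), of v] has_pd_unique by blast
  qed
  show "ehess (hext u) y i i = s\<^sup>2 * ehess (hext u) (s *\<^sub>R y) i i" if y: "y \<in> ?O" "s > 0" for y i s
  proof -
    have "has_pd i (\<lambda>z. D (s *\<^sub>R z) i) (s * ehess (hext u) (s *\<^sub>R y) i i) y"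
      by (rule has_pd_scale[of i "\<lambda>z. D z i"]) (intro p2 cone_over_scale y)
    from has_pd_mult[OF has_pd_const this]
    have "has_pd i (\<lambda>z. s * D (s *\<^sub>R z) i) (s * (s * ehess (hext u) (s *\<^sub>R y) i i)) y" by simp
    then have "has_pd i (\<lambda>z. D z i) (s * (s * ehess (hext u) (s *\<^sub>R y) i i)) y"
      by (rule has_pd_cong_open[OF _ O y(1)]) (use s1 y(2) in auto)
    then show ?thesis using p2[OF y(1), of i] has_pd_unique by (fastforce simp: power2_eq_square)
  qed
  show "D y v = egrad (hext u) y \<bullet> v" if y: "y \<in> ?O" for y v
  proof -
    interpret bounded_linear "D y" using d1[OF y] by (rule has_derivative_bounded_linear)
    have "D y v = D y (\<Sum>i\<in>Basis. (v \<bullet> i) *\<^sub>R i)" by (simp add: euclidean_representation)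
    also have "\<dots> = (\<Sum>i\<in>Basis. (v \<bullet> i) * D y i)" by (simp add: sum scaleR)
    also have "\<dots> = egrad (hext u) y \<bullet> v"
      by (simp add: egrad_def D_def inner_sum_left inner_commute[of v] mult.commute)
    finally show ?thesis .
  qed
qed

lemma pd_segment_bound:
  fixes \<Psi> :: "'a::real_normed_vector \<Rightarrow> real"
  assumes pd: "\<And>t. 0 < t \<Longrightarrow> t < 1 \<Longrightarrow> has_pd v \<Psi> (D t) (a + t *\<^sub>R v) \<and> \<bar>D t\<bar> \<le> B"
    and c: "continuous_on {0..1} (\<lambda>t. \<Psi> (a + t *\<^sub>R v))"
  shows "\<bar>\<Psi> (a + v) - \<Psi> a\<bar> \<le> B"
proof -
  obtain t where t: "0 < t" "t < 1" "\<Psi> (a + 1 *\<^sub>R v) - \<Psi> (a + 0 *\<^sub>R v) = D t * (1 - 0)"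
  proof (rule mvt[OF zero_less_one c])
    fix t :: real assume "0 < t" "t < 1"
    then have "((\<lambda>t. \<Psi> (a + t *\<^sub>R v)) has_real_derivative D t) (at t)"
      using pd has_pd_line by blast
    then show "((\<lambda>t. \<Psi> (a + t *\<^sub>R v)) has_derivative (\<lambda>h. D t * h)) (at t)"
      by (simp add: has_field_derivative_def)
  qed auto
  then show ?thesis using pd[OF t(1,2)] by simp
qed

text \<open>The set \<open>d \<ge> 0\<close> need not be convex; nearby points are joined by moving away from the boundary
  along \<open>- e\<close> first, then in parallel to it, and back.\<close>

lemma boundary_derivative:
  fixes H d :: "'a::euclidean_space \<Rightarrow> real" and g :: "'a \<Rightarrow> 'a"
  assumes W: "open W" "y0 \<in> W" and d0: "d y0 = 0"
    and H: "\<And>y v. y \<in> W \<Longrightarrow> d y > 0 \<Longrightarrow> has_pd v H (g y \<bullet> v) y"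
    and cH: "continuous_on {y\<in>W. d y \<ge> 0} H" and cg: "continuous_on {y\<in>W. d y \<ge> 0} g"
    and lip: "\<And>y z. \<bar>d y - d z\<bar> \<le> L * norm (y - z)" and L: "L > 0"
    and shift: "\<And>y t. d (y - t *\<^sub>R e) = d y + t" and e: "norm e = 1"
  shows "(H has_derivative (\<lambda>v. g y0 \<bullet> v)) (at y0 within {y\<in>W. d y \<ge> 0})"
  unfolding has_derivative_within_alt
proof (intro conjI allI impI)
  show "bounded_linear (\<lambda>v. g y0 \<bullet> v)" by (rule bounded_linear_inner_right)
  fix \<epsilon> :: real assume eps: "\<epsilon> > 0"
  \<comment> \<open>The three-piece path to a point at distance l has length at most (2 L + 1)
    l.\<close>
  define \<epsilon>' where "\<epsilon>' = \<epsilon> / (2 * L + 1)"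
  have eps': "\<epsilon>' > 0" using eps L by (simp add: \<epsilon>'_def)
  obtain \<delta>1 where d1: "\<delta>1 > 0" "\<And>y. y \<in> W \<Longrightarrow> d y \<ge> 0 \<Longrightarrow> dist y y0 < \<delta>1 \<Longrightarrow> dist (g y) (g y0) < \<epsilon>'"
    using cg[unfolded continuous_on_iff, rule_format, of y0 \<epsilon>'] W d0 eps' by auto
  obtain \<delta>2 where d2: "\<delta>2 > 0" "ball y0 \<delta>2 \<subseteq> W" using W open_contains_ball by blast
  define \<delta> where "\<delta> = min \<delta>1 \<delta>2 / (L + 1)"
  have del: "\<delta> > 0" using d1 d2 L by (simp add: \<delta>_def)
  \<comment> \<open>Subtracting the candidate linear part leaves a function with gradient g - g y0,
    which is small near y0.\<close>
  define \<Psi> where "\<Psi> y = H y - y \<bullet> g y0" for y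
  have "norm (H y - H y0 - g y0 \<bullet> (y - y0)) \<le> \<epsilon> * norm (y - y0)"
    if y: "y \<in> {y\<in>W. d y \<ge> 0}" "norm (y - y0) < \<delta>" for y
  proof -
    define l where "l = norm (y - y0)"
    \<comment> \<open>Over a displacement of length l the function \<open>d\<close> can drop by at
      most L l; lifting by this amount first keeps the interior of the middle piece in d >
      0.\<close>
    define T where "T = L * l"
    have l: "l \<ge> 0" "T \<ge> 0" "T + l < min \<delta>1 \<delta>2"
    proof -
      show "l \<ge> 0" "T \<ge> 0" using L by (simp_all add: l_def T_def)
      have "(L + 1) * l < (L + 1) * \<delta>" using y(2) L by (intro mult_strict_left_mono) (auto simp: l_def)
      moreover have "(L + 1) * \<delta> = min \<delta>1 \<delta>2" using L by (simp add: \<delta>_def)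
      ultimately show "T + l < min \<delta>1 \<delta>2" unfolding T_def by (simp only: distrib_right mult_1)
    qed
    have near: "z \<in> W" "norm (z - y0) < \<delta>1" if "norm (z - y0) \<le> T + l" for z
      using that l d2 by (auto simp: subset_iff dist_norm norm_minus_commute)
    have seg: "\<bar>\<Psi> (a + v) - \<Psi> a\<bar> \<le> \<epsilon>' * norm v"
      if s0: "\<And>t. 0 \<le> t \<Longrightarrow> t \<le> 1 \<Longrightarrow> norm (a + t *\<^sub>R v - y0) \<le> T + l \<and> d (a + t *\<^sub>R v) \<ge> 0"
        and s1: "\<And>t. 0 < t \<Longrightarrow> t < 1 \<Longrightarrow> v \<noteq> 0 \<Longrightarrow> d (a + t *\<^sub>R v) > 0" for a v
    proof (cases "v = 0")
      case False
      show ?thesis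
      proof (rule pd_segment_bound[where D="\<lambda>t. g (a + t *\<^sub>R v) \<bullet> v - v \<bullet> g y0"])
        fix t :: real assume t: "0 < t" "t < 1"
        let ?z = "a + t *\<^sub>R v"
        have z: "norm (?z - y0) \<le> T + l" "d ?z > 0" using s0[of t] s1[of t] t False by auto
        have "has_pd v \<Psi> (g ?z \<bullet> v - v \<bullet> g y0) ?z"
          unfolding \<Psi>_def by (intro has_pd_diff H near z has_pd_inner0)
        moreover have "\<bar>g ?z \<bullet> v - v \<bullet> g y0\<bar> \<le> \<epsilon>' * norm v"
        proof -
          have "g ?z \<bullet> v - v \<bullet> g y0 = (g ?z - g y0) \<bullet> v" by (simp add: inner_diff_left inner_diff_right inner_commute)
          also have "\<bar>\<dots>\<bar> \<le> norm (g ?z - g y0) * norm v" by (rule Cauchy_Schwarz_ineq2)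
          also have "\<dots> \<le> \<epsilon>' * norm v"
            using d1(2)[of ?z] near[OF z(1)] z(2) by (intro mult_right_mono) (auto simp: dist_norm)
          finally show ?thesis .
        qed
        ultimately show "has_pd v \<Psi> (g ?z \<bullet> v - v \<bullet> g y0) ?z \<and> \<bar>g ?z \<bullet> v - v \<bullet> g y0\<bar> \<le> \<epsilon>' * norm v" by simp
      next
        have "continuous_on {y\<in>W. d y \<ge> 0} \<Psi>" unfolding \<Psi>_def by (intro continuous_intros cH)
        then show "continuous_on {0..1} (\<lambda>t. \<Psi> (a + t *\<^sub>R v))"
          by (rule continuous_on_compose2) (use s0 near in \<open>auto intro!: continuous_intros\<close>)
      qed
    qed simp
    have n1: "norm (t *\<^sub>R (- (T *\<^sub>R e))) \<le> T" if "0 \<le> t" "t \<le> 1" for t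
      using that l e by (simp add: abs_mult mult_left_le_one_le)
    have b1: "\<bar>\<Psi> (y0 + - (T *\<^sub>R e)) - \<Psi> y0\<bar> \<le> \<epsilon>' * norm (- (T *\<^sub>R e))"
    proof (rule seg)
      fix t :: real
      have "d (y0 + t *\<^sub>R - (T *\<^sub>R e)) = t * T" using shift[of y0 "t * T"] d0 by simp
      then show "0 \<le> t \<Longrightarrow> t \<le> 1 \<Longrightarrow> norm (y0 + t *\<^sub>R - (T *\<^sub>R e) - y0) \<le> T + l \<and> 0 \<le> d (y0 + t *\<^sub>R - (T *\<^sub>R e))"
        "0 < t \<Longrightarrow> t < 1 \<Longrightarrow> - (T *\<^sub>R e) \<noteq> 0 \<Longrightarrow> 0 < d (y0 + t *\<^sub>R - (T *\<^sub>R e))"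
        using n1[of t] l by auto
    qed
    have b2: "\<bar>\<Psi> ((y0 - T *\<^sub>R e) + (y - y0)) - \<Psi> (y0 - T *\<^sub>R e)\<bar> \<le> \<epsilon>' * norm (y - y0)"
    proof (rule seg)
      fix t :: real
      have eq: "(y0 - T *\<^sub>R e) + t *\<^sub>R (y - y0) = (y0 + t *\<^sub>R (y - y0)) - T *\<^sub>R e" by simp
      have dd: "d ((y0 - T *\<^sub>R e) + t *\<^sub>R (y - y0)) \<ge> T * (1 - t)" if "0 \<le> t"
      proof -
        have "\<bar>d (y0 + t *\<^sub>R (y - y0)) - d y0\<bar> \<le> L * norm (t *\<^sub>R (y - y0))"
          using lip[of "y0 + t *\<^sub>R (y - y0)" y0] by simp
        also have "\<dots> = t * T" using that by (simp add: T_def l_def)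
        finally show ?thesis unfolding eq shift using d0 by (simp add: algebra_simps)
      qed
      show "norm ((y0 - T *\<^sub>R e) + t *\<^sub>R (y - y0) - y0) \<le> T + l \<and> 0 \<le> d ((y0 - T *\<^sub>R e) + t *\<^sub>R (y - y0))"
        if "0 \<le> t" "t \<le> 1"
      proof
        have "norm (t *\<^sub>R (y - y0)) \<le> l" using that by (simp add: l_def mult_left_le_one_le)
        moreover have "norm (- (T *\<^sub>R e)) \<le> T" using l e by simp
        ultimately show "norm ((y0 - T *\<^sub>R e) + t *\<^sub>R (y - y0) - y0) \<le> T + l"
          using norm_triangle_ineq[of "- (T *\<^sub>R e)" "t *\<^sub>R (y - y0)"] by (simp add: algebra_simps)
        have "0 \<le> T * (1 - t)" using that l by simp
        then show "0 \<le> d ((y0 - T *\<^sub>R e) + t *\<^sub>R (y - y0))" using dd[OF that(1)] by linarith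
      qed
      show "0 < d ((y0 - T *\<^sub>R e) + t *\<^sub>R (y - y0))" if "0 < t" "t < 1" "y - y0 \<noteq> 0"
      proof -
        have "0 < T * (1 - t)" using that L by (simp add: T_def l_def)
        then show ?thesis using dd that by fastforce
      qed
    qed
    have b3: "\<bar>\<Psi> (y + - (T *\<^sub>R e)) - \<Psi> y\<bar> \<le> \<epsilon>' * norm (- (T *\<^sub>R e))"
    proof (rule seg)
      fix t :: real
      have dd: "d (y + t *\<^sub>R - (T *\<^sub>R e)) = d y + t * T" using shift[of y "t * T"] by simp
      show "norm (y + t *\<^sub>R - (T *\<^sub>R e) - y0) \<le> T + l \<and> 0 \<le> d (y + t *\<^sub>R - (T *\<^sub>R e))"
        if "0 \<le> t" "t \<le> 1"
        using norm_triangle_ineq[of "t *\<^sub>R - (T *\<^sub>R e)" "y - y0"] n1[OF that] l y that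
        unfolding dd by (simp add: l_def algebra_simps)
      show "0 < d (y + t *\<^sub>R - (T *\<^sub>R e))" if "0 < t" "t < 1" "- (T *\<^sub>R e) \<noteq> 0"
      proof -
        have "T > 0" using that l by (cases "T = 0") auto
        then show ?thesis unfolding dd using that y by (simp add: add_nonneg_pos)
      qed
    qed
    have "\<bar>\<Psi> y - \<Psi> y0\<bar> \<le> \<epsilon>' * T + \<epsilon>' * l + \<epsilon>' * T"
    proof -
      have eqs: "(y0 - T *\<^sub>R e) + (y - y0) = y - T *\<^sub>R e" by simp
      have nT: "norm (- (T *\<^sub>R e)) = T" using l e by simp
      have "\<bar>\<Psi> (y0 - T *\<^sub>R e) - \<Psi> y0\<bar> \<le> \<epsilon>' * T" "\<bar>\<Psi> (y - T *\<^sub>R e) - \<Psi> y\<bar> \<le> \<epsilon>' * T"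
        using b1 b3 unfolding nT by simp_all
      then show ?thesis using b2 unfolding eqs l_def[symmetric] by linarith
    qed
    also have "\<dots> = \<epsilon> * l"
    proof -
      have "\<epsilon>' * T + \<epsilon>' * l + \<epsilon>' * T = \<epsilon>' * (2 * L + 1) * l" by (simp add: T_def algebra_simps)
      then show ?thesis using L by (simp add: \<epsilon>'_def)
    qed
    finally show ?thesis unfolding \<Psi>_def l_def by (simp add: inner_diff_right inner_commute algebra_simps)
  qed
  then show "\<exists>\<delta>>0. \<forall>y\<in>{y\<in>W. d y \<ge> 0}. norm (y - y0) < \<delta> \<longrightarrow>
      norm (H y - H y0 - g y0 \<bullet> (y - y0)) \<le> \<epsilon> * norm (y - y0)"
    using del by blast
qed

text \<open>At a boundary point only the derivative within \<open>S\<close> is available; a curve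
  that stays in \<open>S\<close> for both signs of its parameter turns it into an ordinary
  derivative of the zero function.\<close>

lemma derivative_along_zero_curve:
  fixes H :: "'a::real_inner \<Rightarrow> real"
  assumes H: "(H has_derivative (\<lambda>v. q \<bullet> v)) (at y0 within S)"
    and c: "(\<gamma> has_vector_derivative w) (at 0)" "\<gamma> 0 = y0" "\<epsilon> > 0"
    and z: "\<And>t. \<bar>t\<bar> < \<epsilon> \<Longrightarrow> \<gamma> t \<in> S \<and> H (\<gamma> t) = 0"
  shows "q \<bullet> w = 0"
proof -
  let ?I = "ball (0::real) \<epsilon>"
  have "(\<gamma> has_derivative (\<lambda>t. t *\<^sub>R w)) (at 0 within ?I)"
    using c(1) unfolding has_vector_derivative_def by (rule has_derivative_at_withinI)
  moreover have "(H has_derivative (\<lambda>v. q \<bullet> v)) (at (\<gamma> 0) within \<gamma> ` ?I)"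
    unfolding c(2) by (rule has_derivative_subset[OF H]) (use z in auto)
  ultimately have "(H \<circ> \<gamma> has_derivative (\<lambda>v. q \<bullet> v) \<circ> (\<lambda>t. t *\<^sub>R w)) (at 0 within ?I)"
    by (rule diff_chain_within)
  then have "(H \<circ> \<gamma> has_derivative (\<lambda>t. q \<bullet> (t *\<^sub>R w))) (at 0)"
    using c(3) at_within_open[of 0 ?I] by (simp add: o_def)
  then have "((\<lambda>t. 0) has_derivative (\<lambda>t. q \<bullet> (t *\<^sub>R w))) (at (0::real))"
    by (rule has_derivative_transform_within_open[of _ _ 0 UNIV ?I]) (use z c in auto)
  from has_derivative_unique[OF this has_derivative_const] have "q \<bullet> (1 *\<^sub>R w) = 0" by meson
  then show ?thesis by simp
qed

subsection \<open>The difference from the radial solution\<close>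

text \<open>The problem in terms of x \<bullet> p = cos r: Gamma_2 is the level \<open>b\<close>,
  its outward normal is \<open>radial_dir\<close>, and sqrt (1 - b^2) is sin R.\<close>

locale overdetermined = spherical_cone p \<omega> Sg + radial_ode n b \<beta> A C k
  for p :: "'a::euclidean_space" and \<omega> Sg and n b \<beta> A C :: real and k +
  fixes Om1 Om :: "'a set" and u :: "'a \<Rightarrow> real" and G :: "'a \<Rightarrow> 'a"
  assumes dim: "DIM('a) \<ge> 3" and n_eq: "n = real DIM('a) - 1"
    and Om1_open: "openin (top_of_set (sphere 0 1)) Om1" and Om1_conn: "connected Om1"
    and Om1_sub: "Om1 \<subseteq> Sg" and up: "{x\<in>Sg. b \<le> x \<bullet> p} \<subseteq> Om1"
    and Om_eq: "Om = {x\<in>Om1. x \<bullet> p < b}"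
    and hemi: "\<And>x. x \<in> Om \<Longrightarrow> 0 < x \<bullet> p"
    and C2: "sph_C2 Om u" and C1: "sph_C1_closure Om u G"
    and eq: "\<And>x. x \<in> Om \<Longrightarrow> slap u x = - n * u x - n"
    and Dirichlet2: "\<And>x. x \<in> Sg \<Longrightarrow> x \<bullet> p = b \<Longrightarrow> u x + 1 = b * A"
    and Neumann2: "\<And>x. x \<in> Sg \<Longrightarrow> x \<bullet> p = b \<Longrightarrow> G x \<bullet> radial_dir x = sqrt (1 - b\<^sup>2) / \<beta>"
begin

abbreviation W :: "'a set" where "W \<equiv> cone_over Om1"
abbreviation Oc :: "'a set" where "Oc \<equiv> cone_over Om"
abbreviation proj :: "'a \<Rightarrow> 'a" where "proj y \<equiv> inverse (norm y) *\<^sub>R y"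

lemma Om_open: "openin (top_of_set (sphere 0 1)) Om"
proof -
  have "openin (top_of_set (sphere 0 1)) (Om1 \<inter> (sphere 0 1 \<inter> {x. x \<bullet> p < b}))"
    by (intro openin_Int Om1_open openin_open_Int open_Collect_less continuous_intros)
  moreover have "Om1 \<inter> (sphere 0 1 \<inter> {x. x \<bullet> p < b}) = Om"
    using Om1_sub Sg_bounds(1) unfolding Om_eq by auto
  ultimately show ?thesis by simp
qed

lemma open_W: "open W" and open_O: "open Oc"
  using Om1_open Om_open by (auto intro: open_cone_over)

lemma connected_W: "connected W"
  using Om1_conn Om1_sub Sg_bounds(1) by (intro connected_cone_over) auto

definition cs :: "'a \<Rightarrow> real" where "cs y = (y \<bullet> p) / norm y"

lemma proj_p: "proj y \<bullet> p = cs y"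
  by (simp add: cs_def field_simps)

lemma W_D:
  assumes "y \<in> W"
  shows "y \<noteq> 0" "proj y \<in> Sg" "- 1 < cs y" "cs y < 1" "(y \<bullet> p)\<^sup>2 < (norm y)\<^sup>2"
proof -
  show y: "y \<noteq> 0" "proj y \<in> Sg" using assms Om1_sub by (auto simp: cone_over_def)
  show c: "- 1 < cs y" "cs y < 1" using Sg_bounds[OF y(2)] unfolding proj_p by auto
  have "y \<bullet> p = cs y * norm y" using y by (simp add: cs_def)
  moreover have "(cs y)\<^sup>2 * (norm y)\<^sup>2 < 1 * (norm y)\<^sup>2"
    using c y by (intro mult_strict_right_mono) (auto simp: abs_square_less_1)
  ultimately show "(y \<bullet> p)\<^sup>2 < (norm y)\<^sup>2" by (simp add: power_mult_distrib)
qed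

lemma O_iff: "y \<in> Oc \<longleftrightarrow> y \<in> W \<and> cs y < b"
  unfolding Om_eq cone_over_def using proj_p[of y] by auto

lemma O_D:
  assumes "y \<in> Oc"
  shows "y \<in> W" "y \<noteq> 0" "0 < cs y" "cs y < 1" "proj y \<in> Om"
proof -
  show W: "y \<in> W" using assms by (simp add: O_iff)
  show "y \<noteq> 0" "cs y < 1" using W_D[OF W] by auto
  show "proj y \<in> Om" using assms by (simp add: cone_over_def)
  then show "0 < cs y" using hemi[of "proj y"] unfolding proj_p by simp
qed

text \<open>The cotangent of R, the slope for which \<open>d\<close> vanishes exactly on the cone r
  = R.\<close>

definition \<kappa> :: real where "\<kappa> = b / sqrt (1 - b\<^sup>2)"

text \<open>A defining function of the cone over \<open>r = R\<close> that is affine in the direction \<open>p\<close>, so that strips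
  along the cone are translates of each other.\<close>

definition d :: "'a \<Rightarrow> real" where "d y = \<kappa> * sqrt ((norm y)\<^sup>2 - (y \<bullet> p)\<^sup>2) - y \<bullet> p"

definition dg :: "'a \<Rightarrow> 'a" where
  "dg y = (\<kappa> / sqrt ((norm y)\<^sup>2 - (y \<bullet> p)\<^sup>2)) *\<^sub>R (y - (y \<bullet> p) *\<^sub>R p) - p"

lemma b_sq: "b\<^sup>2 < 1" "sqrt (1 - b\<^sup>2) > 0"
  using b by (simp_all add: abs_square_less_1)

lemma \<kappa>_pos: "\<kappa> > 0"
  using b b_sq by (simp add: \<kappa>_def)

text \<open>The component orthogonal to \<open>p\<close> is unaffected by translations along
  \<open>p\<close>, and it depends on y in a Lipschitz way.\<close>

lemma d_alt: "d y = \<kappa> * norm (y - (y \<bullet> p) *\<^sub>R p) - y \<bullet> p"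
proof -
  have "(y - (y \<bullet> p) *\<^sub>R p) \<bullet> (y - (y \<bullet> p) *\<^sub>R p) = (norm y)\<^sup>2 - (y \<bullet> p)\<^sup>2"
    unfolding power2_norm_eq_inner
    by (simp add: inner_diff_left inner_diff_right inner_commute power2_eq_square)
  then show ?thesis unfolding d_def by (simp add: norm_eq_sqrt_inner)
qed

lemma d_shift: "d (y - t *\<^sub>R p) = d y + t"
proof -
  have "(y - t *\<^sub>R p) - ((y - t *\<^sub>R p) \<bullet> p) *\<^sub>R p = y - (y \<bullet> p) *\<^sub>R p"
    by (simp add: inner_diff_left algebra_simps)
  then show ?thesis unfolding d_alt by (simp only: inner_diff_left inner_scaleR_left pp)
qed

lemma d_lipschitz: "\<bar>d y - d z\<bar> \<le> (2 * \<kappa> + 1) * norm (y - z)"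
proof -
  define q where "q y = y - (y \<bullet> p) *\<^sub>R p" for y
  have cs: "\<bar>v \<bullet> p\<bar> \<le> norm v" for v using Cauchy_Schwarz_ineq2[of v p] norm_p by simp
  have "\<bar>norm (q y) - norm (q z)\<bar> \<le> norm (q y - q z)" by (rule norm_triangle_ineq3)
  also have "q y - q z = (y - z) - ((y - z) \<bullet> p) *\<^sub>R p" by (simp add: q_def inner_diff_left algebra_simps)
  also have "norm \<dots> \<le> norm (y - z) + norm (((y - z) \<bullet> p) *\<^sub>R p)" by (rule norm_triangle_ineq4)
  also have "\<dots> \<le> 2 * norm (y - z)" using cs[of "y - z"] norm_p by simp
  finally have "\<kappa> * \<bar>norm (q y) - norm (q z)\<bar> \<le> \<kappa> * (2 * norm (y - z))"
    using \<kappa>_pos by (intro mult_left_mono) auto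
  then have "\<bar>\<kappa> * norm (q y) - \<kappa> * norm (q z)\<bar> \<le> 2 * \<kappa> * norm (y - z)"
    using \<kappa>_pos by (simp add: right_diff_distrib[symmetric] abs_mult)
  moreover have "\<bar>y \<bullet> p - z \<bullet> p\<bar> \<le> norm (y - z)" using cs[of "y - z"] by (simp add: inner_diff_left)
  ultimately show ?thesis unfolding d_alt q_def by (simp add: algebra_simps abs_le_iff)
qed

lemma continuous_d: "continuous_on UNIV d"
  unfolding d_def by (intro continuous_intros)

lemma d_pos_iff:
  assumes "y \<in> W"
  shows "d y > 0 \<longleftrightarrow> cs y < b" "d y = 0 \<longleftrightarrow> cs y = b" "d y \<ge> 0 \<longleftrightarrow> cs y \<le> b"
proof -
  define c where "c = cs y"
  note W = W_D[OF assms]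
  have yp: "y \<bullet> p = c * norm y" using W(1) by (simp add: cs_def c_def)
  have c1: "c\<^sup>2 < 1" using W(3,4) by (simp add: c_def abs_square_less_1)
  have "(norm y)\<^sup>2 - (y \<bullet> p)\<^sup>2 = (norm y)\<^sup>2 * (1 - c\<^sup>2)"
    unfolding yp by (simp add: power_mult_distrib algebra_simps)
  then have "sqrt ((norm y)\<^sup>2 - (y \<bullet> p)\<^sup>2) = norm y * sqrt (1 - c\<^sup>2)" by (simp add: real_sqrt_mult)
  then have d: "d y = norm y * (\<kappa> * sqrt (1 - c\<^sup>2) - c)" unfolding d_def yp by (simp add: algebra_simps)
  \<comment> \<open>\<open>d\<close> is the norm times a function of the cosine alone; nonpositive
    cosines are treated apart because c^2 increases only for c \<ge> 0.\<close>
  define \<phi> where "\<phi> c = \<kappa> * sqrt (1 - c\<^sup>2) - c" for c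
  have \<phi>b: "\<phi> b = 0" using b_sq by (simp add: \<phi>_def \<kappa>_def)
  have pos: "\<phi> c > 0" if "c < b"
  proof (cases "c \<le> 0")
    case True
    have "\<kappa> * sqrt (1 - c\<^sup>2) > 0" using \<kappa>_pos c1 by simp
    then show ?thesis using True by (simp add: \<phi>_def)
  next
    case False
    then have "c\<^sup>2 \<le> b\<^sup>2" using that by (intro power_mono) auto
    then have "\<kappa> * sqrt (1 - b\<^sup>2) \<le> \<kappa> * sqrt (1 - c\<^sup>2)" using \<kappa>_pos by (intro mult_left_mono) auto
    then show ?thesis using \<phi>b that by (simp add: \<phi>_def)
  qed
  have neg: "\<phi> c < 0" if "b < c"
  proof -
    have "b\<^sup>2 \<le> c\<^sup>2" using that b by (intro power_mono) auto
    then have "\<kappa> * sqrt (1 - c\<^sup>2) \<le> \<kappa> * sqrt (1 - b\<^sup>2)" using \<kappa>_pos by (intro mult_left_mono) auto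
    then show ?thesis using \<phi>b that by (simp add: \<phi>_def)
  qed
  have d': "d y = norm y * \<phi> c" using d by (simp add: \<phi>_def)
  have ny: "norm y > 0" using W(1) by simp
  show "d y > 0 \<longleftrightarrow> cs y < b" "d y = 0 \<longleftrightarrow> cs y = b" "d y \<ge> 0 \<longleftrightarrow> cs y \<le> b"
    unfolding d' c_def[symmetric] using pos neg \<phi>b ny
    by (metis linorder_less_linear mult_pos_pos mult_pos_neg mult_zero_right not_less_iff_gr_or_eq,
        metis linorder_less_linear mult_pos_pos mult_pos_neg mult_zero_right not_less_iff_gr_or_eq,
        smt (verit, best) mult_pos_neg mult_nonneg_nonneg)
qed

lemma d_pd:
  assumes "y \<in> W"
  shows "has_pd v d (dg y \<bullet> v) y"
proof -
  define q where "q = (norm y)\<^sup>2 - (y \<bullet> p)\<^sup>2"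
  have q: "q > 0" using W_D(5)[OF assms] by (simp add: q_def)
  have 1: "has_pd v (\<lambda>y. (norm y)\<^sup>2 - (y \<bullet> p) * (y \<bullet> p)) (2 * (y \<bullet> v) - ((v \<bullet> p) * (y \<bullet> p) + (y \<bullet> p) * (v \<bullet> p))) y"
    using has_pd_norm2[of v 0 y] by (intro has_pd_diff has_pd_mult has_pd_inner0) auto
  have sq: "(sqrt has_real_derivative inverse (sqrt q) / 2) (at ((norm y)\<^sup>2 - (y \<bullet> p) * (y \<bullet> p)))"
    using DERIV_real_sqrt[OF q] by (simp add: q_def power2_eq_square)
  have "has_pd v (\<lambda>y. \<kappa> * sqrt ((norm y)\<^sup>2 - (y \<bullet> p) * (y \<bullet> p)) - y \<bullet> p)
    ((0 * sqrt ((norm y)\<^sup>2 - (y \<bullet> p) * (y \<bullet> p)) + \<kappa> * (inverse (sqrt q) / 2 *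
      (2 * (y \<bullet> v) - ((v \<bullet> p) * (y \<bullet> p) + (y \<bullet> p) * (v \<bullet> p))))) - v \<bullet> p) y"
    by (intro has_pd_diff has_pd_mult has_pd_const has_pd_chain[OF sq 1] has_pd_inner0)
  moreover have "(0 * sqrt ((norm y)\<^sup>2 - (y \<bullet> p) * (y \<bullet> p)) + \<kappa> * (inverse (sqrt q) / 2 *
      (2 * (y \<bullet> v) - ((v \<bullet> p) * (y \<bullet> p) + (y \<bullet> p) * (v \<bullet> p))))) - v \<bullet> p = dg y \<bullet> v"
  proof -
    have dgv: "dg y \<bullet> v = \<kappa> * inverse (sqrt q) * (y \<bullet> v - (y \<bullet> p) * (p \<bullet> v)) - p \<bullet> v"
      unfolding dg_def q_def[symmetric] by (simp only: divide_inverse inner_diff_left inner_scaleR_left)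
    have "\<kappa> * (j / 2 * (2 * (y \<bullet> v) - ((v \<bullet> p) * (y \<bullet> p) + (y \<bullet> p) * (v \<bullet> p))))
        = \<kappa> * j * (y \<bullet> v - (y \<bullet> p) * (p \<bullet> v))" for j
      unfolding inner_commute[of v p] by (simp add: algebra_simps)
    then show ?thesis unfolding dgv inner_commute[of v p] by simp
  qed
  ultimately show ?thesis by (simp add: d_def[abs_def] power2_eq_square)
qed

lemma continuous_dg: "continuous_on W dg"
  unfolding dg_def using W_D(5) by (intro continuous_intros) force

abbreviation D :: "'a \<Rightarrow> 'a \<Rightarrow> real" where "D y \<equiv> frechet_derivative (hext u) (at y)"

text \<open>Difference of two solutions of Delta w + n w = 0, extended with degree zero;
  \<open>Ht\<close> is the extension of degree one. The suffixes 1 and 2 mark first and second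
  derivatives in a direction v.\<close>

definition wt :: "'a \<Rightarrow> real" where "wt y = hext u y + 1 - f (cs y)"
definition cs1 :: "'a \<Rightarrow> 'a \<Rightarrow> real" where
  "cs1 v y = (p \<bullet> v) / norm y - (y \<bullet> p) * (y \<bullet> v) / norm y ^ 3"
definition cs2 :: "'a \<Rightarrow> 'a \<Rightarrow> real" where
  "cs2 v y = - 2 * (p \<bullet> v) * (y \<bullet> v) / norm y ^ 3 - (y \<bullet> p) * (v \<bullet> v) / norm y ^ 3
     + 3 * (y \<bullet> p) * (y \<bullet> v)\<^sup>2 / norm y ^ 5"
definition wt1 :: "'a \<Rightarrow> 'a \<Rightarrow> real" where "wt1 v y = D y v - f1 (cs y) * cs1 v y"
definition wt2 :: "'a \<Rightarrow> 'a \<Rightarrow> real" where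
  "wt2 v y = ehess (hext u) y v v - (f2 (cs y) * cs1 v y * cs1 v y + f1 (cs y) * cs2 v y)"

definition Ht :: "'a \<Rightarrow> real" where "Ht y = norm y * wt y"
definition Ht1 :: "'a \<Rightarrow> 'a \<Rightarrow> real" where "Ht1 v y = (y \<bullet> v / norm y) * wt y + norm y * wt1 v y"
definition Ht2 :: "'a \<Rightarrow> 'a \<Rightarrow> real" where
  "Ht2 v y = ((v \<bullet> v) / norm y - (y \<bullet> v)\<^sup>2 / norm y ^ 3) * wt y
     + 2 * (y \<bullet> v / norm y) * wt1 v y + norm y * wt2 v y"

lemma cs_pd: "y \<noteq> 0 \<Longrightarrow> has_pd v cs (cs1 v y) y"
  using has_pd_divide[OF has_pd_inner0[of v p y] has_pd_norm[of y v]]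
  by (simp add: cs_def[abs_def] cs1_def inner_commute power3_eq_cube diff_divide_distrib mult_ac)

lemma norm_cube_pd:
  fixes y :: 'a
  assumes "y \<noteq> 0"
  shows "has_pd v (\<lambda>y. norm y ^ 3) (3 * norm y * (y \<bullet> v)) y"
proof -
  have "((\<lambda>r. r ^ 3) has_real_derivative 3 * norm y ^ 2) (at (norm y))"
    by (auto intro!: derivative_eq_intros)
  from has_pd_chain[OF this has_pd_norm[OF assms, of v]] show ?thesis
    using assms by (simp add: power2_eq_square mult.assoc)
qed

lemma cs1_pd:
  assumes "y \<noteq> 0"
  shows "has_pd v (cs1 v) (cs2 v y) y"
proof -
  define r where "r = norm y"
  have r: "r > 0" using assms by (simp add: r_def)
  have "has_pd v (cs1 v) ((0 * norm y - (p \<bullet> v) * (y \<bullet> v / norm y)) / (norm y * norm y)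
    - (((v \<bullet> p) * (y \<bullet> v) + (y \<bullet> p) * (v \<bullet> v)) * norm y ^ 3 - (y \<bullet> p) * (y \<bullet> v) * (3 * norm y * (y \<bullet> v)))
       / (norm y ^ 3 * norm y ^ 3)) y"
    unfolding cs1_def[abs_def]
    by (intro has_pd_diff has_pd_divide has_pd_mult has_pd_const has_pd_norm has_pd_inner0 norm_cube_pd)
      (use assms in auto)
  moreover have "(0 * r - (p \<bullet> v) * (y \<bullet> v / r)) / (r * r)
    - (((v \<bullet> p) * (y \<bullet> v) + (y \<bullet> p) * (v \<bullet> v)) * r ^ 3 - (y \<bullet> p) * (y \<bullet> v) * (3 * r * (y \<bullet> v)))
       / (r ^ 3 * r ^ 3) = cs2 v y"
    unfolding cs2_def r_def[symmetric] inner_commute[of v p]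
    using r by (simp add: field_simps power2_eq_square eval_nat_numeral)
  ultimately show ?thesis unfolding r_def by simp
qed

lemmas hC2 = hext_C2[OF Om_open C2]

lemma wt_pd: "y \<in> Oc \<Longrightarrow> has_pd v wt (wt1 v y) y"
  unfolding wt_def[abs_def] wt1_def
  using has_pd_diff[OF has_pd_add[OF hC2(1)[of y v] has_pd_const[of v 1 y]] has_pd_chain[OF f_deriv cs_pd]] O_D
  by simp

lemma wt1_pd:
  assumes y: "y \<in> Oc" and i: "i \<in> Basis"
  shows "has_pd i (wt1 i) (wt2 i y) y"
proof -
  have "has_pd i (wt1 i) (ehess (hext u) y i i - (f2 (cs y) * cs1 i y * cs1 i y + f1 (cs y) * cs2 i y)) y"
    unfolding wt1_def[abs_def]
    by (intro has_pd_diff has_pd_mult hC2(2) has_pd_chain[OF f1_deriv cs_pd] cs1_pd) (use O_D[OF y] y in auto)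
  then show ?thesis by (simp add: wt2_def)
qed

lemma Ht_pd: "y \<in> Oc \<Longrightarrow> has_pd v Ht (Ht1 v y) y"
  unfolding Ht_def[abs_def] Ht1_def by (intro has_pd_mult has_pd_norm wt_pd O_D)

lemma Ht1_pd:
  assumes y: "y \<in> Oc" and i: "i \<in> Basis"
  shows "has_pd i (Ht1 i) (Ht2 i y) y"
proof -
  have y0: "y \<noteq> 0" using O_D[OF y] by simp
  have "has_pd i (Ht1 i) ((((i \<bullet> i) * norm y - (y \<bullet> i) * (y \<bullet> i / norm y)) / (norm y * norm y)) * wt y
     + (y \<bullet> i / norm y) * wt1 i y + ((y \<bullet> i / norm y) * wt1 i y + norm y * wt2 i y)) y"
    unfolding Ht1_def[abs_def]
    by (intro has_pd_add has_pd_mult has_pd_divide has_pd_inner0 has_pd_norm y0 wt_pd wt1_pd y i) (use y0 in simp)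
  moreover have "((i \<bullet> i) * norm y - (y \<bullet> i) * (y \<bullet> i / norm y)) / (norm y * norm y)
     = (i \<bullet> i) / norm y - (y \<bullet> i)\<^sup>2 / norm y ^ 3"
    using y0 by (simp add: field_simps power2_eq_square power3_eq_cube)
  ultimately have "has_pd i (Ht1 i) (((i \<bullet> i) / norm y - (y \<bullet> i)\<^sup>2 / norm y ^ 3) * wt y
     + (y \<bullet> i / norm y) * wt1 i y + ((y \<bullet> i / norm y) * wt1 i y + norm y * wt2 i y)) y"
    by (simp only:)
  moreover have "((i \<bullet> i) / norm y - (y \<bullet> i)\<^sup>2 / norm y ^ 3) * wt y
     + (y \<bullet> i / norm y) * wt1 i y + ((y \<bullet> i / norm y) * wt1 i y + norm y * wt2 i y) = Ht2 i y"
    unfolding Ht2_def by (simp only: mult_2 distrib_right add.assoc)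
  ultimately show ?thesis by (simp only:)
qed

lemma isCont_cs: "y \<noteq> 0 \<Longrightarrow> isCont cs y"
  unfolding cs_def[abs_def] by (intro continuous_intros) auto

lemma continuous_cs: "0 \<notin> S \<Longrightarrow> continuous_on S cs"
  by (rule continuous_at_imp_continuous_on) (metis isCont_cs)

lemma continuous_fcs:
  assumes "\<And>y. y \<in> S \<Longrightarrow> 0 < cs y \<and> cs y < 1" "0 \<notin> S"
  shows "continuous_on S (\<lambda>y. f (cs y))" "continuous_on S (\<lambda>y. f1 (cs y))" "continuous_on S (\<lambda>y. f2 (cs y))"
proof -
  have "continuous_on {0<..<1} f" "continuous_on {0<..<1} f1" "continuous_on {0<..<1} f2"
    by (auto intro!: continuous_at_imp_continuous_on isCont_f isCont_f1 isCont_f2)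
  then show "continuous_on S (\<lambda>y. f (cs y))" "continuous_on S (\<lambda>y. f1 (cs y))" "continuous_on S (\<lambda>y. f2 (cs y))"
    using assms by (auto intro!: continuous_on_compose2[OF _ continuous_cs])
qed

lemma continuous_Ht2: "i \<in> Basis \<Longrightarrow> continuous_on Oc (Ht2 i)"
proof -
  assume i: "i \<in> Basis"
  have z: "0 \<notin> Oc" by (simp add: cone_over_def)
  have n0: "y \<in> Oc \<Longrightarrow> norm y \<noteq> 0" for y using O_D by auto
  note cf = continuous_fcs[of Oc, OF _ z]
  have cwt: "continuous_on Oc wt"
  proof -
    have "continuous_on Oc (hext u)"
      using C2 differentiable_imp_continuous_on by (auto simp: sph_C2_def numeral_2_eq_2)
    then show ?thesis unfolding wt_def[abs_def] by (intro continuous_intros cf) (use O_D in auto)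
  qed
  have c1: "continuous_on Oc (cs1 i)" "continuous_on Oc (cs2 i)"
    unfolding cs1_def[abs_def] cs2_def[abs_def] by (intro continuous_intros; use n0 in simp)+
  have cwt1: "continuous_on Oc (wt1 i)" unfolding wt1_def[abs_def]
    by (intro continuous_intros cf hC2(3) c1) (use O_D in auto)
  have cwt2: "continuous_on Oc (wt2 i)" unfolding wt2_def[abs_def]
    by (intro continuous_intros cf hC2(4) c1) (use O_D in auto)
  show ?thesis unfolding Ht2_def[abs_def]
    by (intro continuous_intros cwt cwt1 cwt2; use n0 in simp)
qed

text \<open>Degree one homogeneity turns \<open>\<Delta>w + n w = 0\<close> on the sphere into harmonicity.\<close>

lemma Ht_harmonic:
  assumes y: "y \<in> Oc"
  shows "(\<Sum>i\<in>Basis. Ht2 i y) = 0"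
proof -
  define r where "r = norm y"
  define s where "s = y \<bullet> p"
  define c where "c = cs y"
  have r: "r > 0" using O_D[OF y] by (simp add: r_def)
  have sc: "s = c * r" using r by (simp add: c_def cs_def s_def r_def)
  have c01: "0 < c" "c < 1" using O_D[OF y] by (auto simp: c_def)
  have ps: "p \<bullet> y = s" by (simp add: s_def inner_commute)
  \<comment> \<open>The squared gradient of cos r; together with its Laplacian \<open>S2\<close> it
    produces the coefficients of the radial equation.\<close>
  have S1: "(\<Sum>i\<in>Basis. cs1 i y * cs1 i y) = (1 - c\<^sup>2) / r\<^sup>2"
  proof -
    have "cs1 i y * cs1 i y = (1 / r\<^sup>2) * (p \<bullet> i)\<^sup>2 + (- 2 * s / r ^ 4) * ((p \<bullet> i) * (y \<bullet> i))
      + (s\<^sup>2 / r ^ 6) * (y \<bullet> i)\<^sup>2 + 0" for i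
      unfolding cs1_def r_def[symmetric] s_def[symmetric] using r
      by (simp add: field_simps power2_eq_square eval_nat_numeral)
    then have "(\<Sum>i\<in>Basis. cs1 i y * cs1 i y) = 1 / r\<^sup>2 + (- 2 * s / r ^ 4) * s + (s\<^sup>2 / r ^ 6) * r\<^sup>2"
      using sum_quadratic_Basis[of "1 / r\<^sup>2" p "- 2 * s / r ^ 4" y "s\<^sup>2 / r ^ 6" 0] norm_p by (simp add: ps r_def)
    also have "\<dots> = (1 - c\<^sup>2) / r\<^sup>2"
      unfolding sc using r by (simp add: field_simps power2_eq_square eval_nat_numeral)
    finally show ?thesis .
  qed
  have S2: "(\<Sum>i\<in>Basis. cs2 i y) = - n * c / r\<^sup>2"
  proof -
    have "(\<Sum>i\<in>Basis. cs2 i y) = (\<Sum>i\<in>Basis. 0 * (p \<bullet> i)\<^sup>2 + (- 2 / r ^ 3) * ((p \<bullet> i) * (y \<bullet> i))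
      + (3 * s / r ^ 5) * (y \<bullet> i)\<^sup>2 + (- s / r ^ 3))"
      unfolding cs2_def r_def[symmetric] s_def[symmetric]
      by (intro sum.cong) (auto simp: algebra_simps)
    also have "\<dots> = (- 2 / r ^ 3) * s + (3 * s / r ^ 5) * r\<^sup>2 + (- s / r ^ 3) * real DIM('a)"
      unfolding sum_quadratic_Basis by (simp add: ps r_def)
    also have "\<dots> = - n * c / r\<^sup>2"
      unfolding sc n_eq using r by (simp add: field_simps power2_eq_square eval_nat_numeral)
    finally show ?thesis .
  qed
  have S3: "(\<Sum>i\<in>Basis. (y \<bullet> i) * cs1 i y) = 0"
  proof -
    have "(\<Sum>i\<in>Basis. (y \<bullet> i) * cs1 i y) = (\<Sum>i\<in>Basis. 0 * (p \<bullet> i)\<^sup>2 + (1 / r) * ((p \<bullet> i) * (y \<bullet> i))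
      + (- s / r ^ 3) * (y \<bullet> i)\<^sup>2 + 0)"
      unfolding cs1_def r_def[symmetric] s_def[symmetric]
      by (intro sum.cong) (auto simp: algebra_simps power2_eq_square)
    also have "\<dots> = (1 / r) * s + (- s / r ^ 3) * r\<^sup>2"
      unfolding sum_quadratic_Basis by (simp add: ps r_def)
    also have "\<dots> = 0" using r by (simp add: field_simps power2_eq_square eval_nat_numeral)
    finally show ?thesis .
  qed
  have S4: "(\<Sum>i\<in>Basis. (y \<bullet> i) * D y i) = 0"
  proof -
    have "(\<Sum>i\<in>Basis. (y \<bullet> i) * D y i) = egrad (hext u) y \<bullet> y"
      unfolding egrad_def inner_sum_left inner_scaleR_left by (simp add: inner_commute mult.commute)
    then show ?thesis using hC2(5)[OF y] hC2(8)[OF y, of y] by simp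
  qed
  have S5: "(\<Sum>i\<in>Basis. ehess (hext u) y i i) = (- n * hext u y - n) / r\<^sup>2"
  proof -
    have "(\<Sum>i\<in>Basis. ehess (hext u) y i i) = (inverse r)\<^sup>2 * elap (hext u) (proj y)"
      unfolding elap_def sum_distrib_left r_def using r hC2(7)[OF y, of "inverse (norm y)"]
      by (simp add: r_def)
    also have "elap (hext u) (proj y) = - n * u (proj y) - n"
      using eq[OF O_D(5)[OF y]] by (simp add: slap_def)
    also have "u (proj y) = hext u y" by (simp add: hext_def)
    finally show ?thesis by (simp add: power_inverse divide_inverse)
  qed
  \<comment> \<open>Euler's relation, as \<open>wt\<close> has degree zero.\<close>
  have T1: "(\<Sum>i\<in>Basis. (y \<bullet> i) * wt1 i y) = 0"
  proof -
    have "(\<Sum>i\<in>Basis. (y \<bullet> i) * wt1 i y) = (\<Sum>i\<in>Basis. (y \<bullet> i) * D y i) - f1 c * (\<Sum>i\<in>Basis. (y \<bullet> i) * cs1 i y)"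
      unfolding wt1_def c_def sum_distrib_left sum_subtractf[symmetric]
      by (intro sum.cong) (auto simp: algebra_simps)
    then show ?thesis using S3 S4 by simp
  qed
  have T2: "(\<Sum>i\<in>Basis. wt2 i y) = - n * wt y / r\<^sup>2"
  proof -
    have "(\<Sum>i\<in>Basis. wt2 i y) = (\<Sum>i\<in>Basis. ehess (hext u) y i i)
       - (f2 c * (\<Sum>i\<in>Basis. cs1 i y * cs1 i y) + f1 c * (\<Sum>i\<in>Basis. cs2 i y))"
      unfolding wt2_def c_def sum_distrib_left sum_subtractf sum.distrib by (simp add: mult.assoc)
    also have "\<dots> = ((- n * hext u y - n) - ((1 - c\<^sup>2) * f2 c - n * c * f1 c)) / r\<^sup>2"
      unfolding S1 S2 S5 by (simp add: diff_divide_distrib add_divide_distrib algebra_simps)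
    also have "(1 - c\<^sup>2) * f2 c - n * c * f1 c = - n * f c" using ode[OF c01] by simp
    also have "(- n * hext u y - n) - (- n * f c) = - n * wt y" by (simp add: wt_def c_def algebra_simps)
    finally show ?thesis .
  qed
  \<comment> \<open>Delta (r wt) = (n / r) wt + (2 / r) (y . grad wt) + r Delta wt: the middle term
    vanishes by \<open>T1\<close>, the outer ones cancel by \<open>T2\<close>.\<close>
  have "(\<Sum>i\<in>Basis. Ht2 i y) = (\<Sum>i\<in>Basis. 0 * (p \<bullet> i)\<^sup>2 + 0 * ((p \<bullet> i) * (y \<bullet> i)) + (- wt y / r ^ 3) * (y \<bullet> i)\<^sup>2 + wt y / r)
      + (2 / r) * (\<Sum>i\<in>Basis. (y \<bullet> i) * wt1 i y) + r * (\<Sum>i\<in>Basis. wt2 i y)"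
    unfolding Ht2_def r_def[symmetric] sum_distrib_left sum.distrib[symmetric]
    by (intro sum.cong) (auto simp: algebra_simps)
  also have "\<dots> = - wt y / r ^ 3 * r\<^sup>2 + wt y / r * real DIM('a) + r * (- n * wt y / r\<^sup>2)"
    unfolding sum_quadratic_Basis T1 T2 by (simp add: r_def)
  also have "\<dots> = 0" unfolding n_eq using r by (simp add: field_simps power2_eq_square eval_nat_numeral)
  finally show ?thesis .
qed

text \<open>The gradient of \<open>Ht\<close> written with \<open>u\<close>, \<open>G\<close> and
  the radial profile alone, so that it extends continuously to the cone over Gamma_2. As the
  gradient of a function of degree one, it depends on the direction of y only.\<close>

definition gt :: "'a \<Rightarrow> 'a" where
  "gt y = (u (proj y) + 1 - f (cs y)) *\<^sub>R proj y + G (proj y) - f1 (cs y) *\<^sub>R (p - cs y *\<^sub>R proj y)"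

lemma Ht1_eq_gt:
  assumes y: "y \<in> Oc"
  shows "Ht1 v y = gt y \<bullet> v"
proof -
  define r where "r = norm y"
  have r: "r > 0" using O_D[OF y] by (simp add: r_def)
  have po: "proj y \<in> Oc"
    using cone_over_scale[OF _ y, of "inverse (norm y)"] r by (simp add: r_def)
  have "G (proj y) = egrad (hext u) (proj y)"
    using C1 O_D(5)[OF y] by (simp add: sph_C1_closure_def sgrad_def)
  then have "G (proj y) \<bullet> v = D (proj y) v" using hC2(8)[OF po, of v] by simp
  also have "D y v = inverse (norm y) * D (proj y) v" using hC2(6)[OF y, of "inverse (norm y)" v] r by (simp add: r_def)
  then have "D (proj y) v = r * D y v" using r by (simp add: r_def)
  finally have 1: "G (proj y) \<bullet> v = r * D y v" .
  have 2: "r * cs1 v y = p \<bullet> v - cs y * (proj y \<bullet> v)"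
    unfolding cs1_def cs_def r_def[symmetric] using r by (simp add: field_simps power3_eq_cube)
  have "Ht1 v y = (proj y \<bullet> v) * wt y + r * D y v - f1 (cs y) * (r * cs1 v y)"
    unfolding Ht1_def wt1_def r_def by (simp add: divide_inverse algebra_simps)
  also have "\<dots> = gt y \<bullet> v"
    unfolding 2 1[symmetric] gt_def wt_def hext_def
    by (simp add: inner_add_left inner_diff_left algebra_simps)
  finally show ?thesis .
qed

abbreviation Wp :: "'a set" where "Wp \<equiv> {y\<in>W. d y \<ge> 0}"

lemma Wp_D:
  assumes "y \<in> Wp"
  shows "y \<noteq> 0" "0 < cs y" "cs y < 1" "proj y \<in> closure Om"
proof -
  have y: "y \<in> W" "cs y \<le> b" using assms d_pos_iff(3) by auto
  show "y \<noteq> 0" "cs y < 1" using W_D[OF y(1)] by auto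
  have "0 < cs y \<and> proj y \<in> closure Om"
  proof (cases "cs y < b")
    case True
    then have "y \<in> Oc" using O_iff y by simp
    then show ?thesis using O_D closure_subset by blast
  next
    case False
    then have cb: "cs y = b" using y by simp
    have pS: "proj y \<in> Sg" "proj y \<in> Om1" using y W_D(2) by (auto simp: cone_over_def)
    have "proj y \<in> closure {z\<in>Om1. z \<bullet> p < proj y \<bullet> p}"
      by (rule closure_lower_openin[OF Om1_open pS(2,1)])
    then have "proj y \<in> closure Om" unfolding proj_p cb Om_eq .
    then show ?thesis using cb b by simp
  qed
  then show "0 < cs y" "proj y \<in> closure Om" by auto
qed

lemma continuous_proj: "0 \<notin> S \<Longrightarrow> continuous_on S (\<lambda>y::'a. proj y)"
  by (intro continuous_intros) auto

lemma continuous_Wp: "continuous_on Wp Ht" "continuous_on Wp gt"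
proof -
  have z: "0 \<notin> Wp" by (simp add: cone_over_def)
  note cf = continuous_fcs[of Wp, OF _ z]
  have cu: "continuous_on Wp (\<lambda>y. u (proj y))" "continuous_on Wp (\<lambda>y. G (proj y))"
    using C1 unfolding sph_C1_closure_def
    by (auto intro!: continuous_on_compose2[OF _ continuous_proj[OF z]] Wp_D(4) simp: image_subset_iff)
  show "continuous_on Wp Ht"
    unfolding Ht_def[abs_def] wt_def hext_def by (intro continuous_intros cu cf) (use Wp_D in auto)
  show "continuous_on Wp gt"
    unfolding gt_def[abs_def]
    by (intro continuous_on_add continuous_on_diff continuous_on_scaleR continuous_on_const cu cf
        continuous_proj[OF z] continuous_cs[OF z]) (use Wp_D in auto)
qed

lemma O_iff_d: "y \<in> Oc \<longleftrightarrow> y \<in> W \<and> d y > 0"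
  using O_iff d_pos_iff(1) by blast

lemma Ht_boundary: "y \<in> W \<Longrightarrow> d y = 0 \<Longrightarrow> Ht y = 0"
  using Dirichlet2[OF W_D(2)] d_pos_iff(2)[of y] f_b unfolding proj_p
  by (simp add: Ht_def wt_def hext_def)

lemma Ht_derivative_boundary:
  "y0 \<in> W \<Longrightarrow> d y0 = 0 \<Longrightarrow> (Ht has_derivative (\<lambda>v. gt y0 \<bullet> v)) (at y0 within Wp)"
  by (rule boundary_derivative[where L="2 * \<kappa> + 1" and e=p])
    (use open_W continuous_Wp d_lipschitz d_shift norm_p \<kappa>_pos Ht_pd Ht1_eq_gt O_iff_d in auto)

text \<open>\<open>Ht\<close> stays zero along the ray and, as the Dirichlet datum is constant,
  along circles of latitude; in the remaining direction the Neumann data agree. On Gamma_2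
  \<open>G\<close> is known only as a continuous limit of gradients, so its tangential part has to
  come from the one-sided derivative of \<open>Ht\<close>.\<close>

lemma gt_boundary:
  assumes y: "y \<in> W" "d y = 0"
  shows "gt y = 0"
proof -
  define x where "x = proj y"
  have cb: "cs y = b" using d_pos_iff(2)[OF y(1)] y(2) by simp
  have x: "x \<in> Sg" "x \<in> Om1" "x \<bullet> p = b"
    using W_D(2)[OF y(1)] y(1) cb proj_p[of y] by (auto simp: x_def cone_over_def)
  have nx: "norm x = 1" "x \<bullet> x = 1" using Sg_bounds(1)[OF x(1)] by (auto simp: norm_eq_1)
  have in0: "z \<in> Wp \<and> Ht z = 0" if "z \<in> W" "cs z = b" for z
    using that d_pos_iff[OF that(1)] Ht_boundary by auto
  have xW: "x \<in> W" "cs x = b" using x nx by (auto simp: cone_over_def cs_def)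
  then have dx: "d x = 0" using d_pos_iff(2) by blast
  note der = Ht_derivative_boundary[OF xW(1) dx]
  have "proj x = x" using nx by simp
  then have gx: "gt y = gt x" unfolding gt_def x_def[symmetric] cb xW(2) by simp
  have gval: "gt x = G x - f1 b *\<^sub>R (p - b *\<^sub>R x)"
    unfolding gt_def \<open>proj x = x\<close> xW(2) using Dirichlet2[OF x(1,3)] f_b by simp
  have "gt x = 0"
  proof (rule perp_zero[OF x(1)])
    show "gt x \<bullet> x = 0"
    proof (rule derivative_along_zero_curve[OF der, of "\<lambda>t. (1 + t) *\<^sub>R x" x 1])
      show "((\<lambda>t. (1 + t) *\<^sub>R x) has_vector_derivative x) (at 0)"
        by (auto intro!: derivative_eq_intros)
      show "(1 + t) *\<^sub>R x \<in> Wp \<and> Ht ((1 + t) *\<^sub>R x) = 0" if "\<bar>t\<bar> < 1" for t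
      proof (rule in0)
        have t: "1 + t > 0" using that by linarith
        show "(1 + t) *\<^sub>R x \<in> W" by (rule cone_over_scale[OF t xW(1)])
        show "cs ((1 + t) *\<^sub>R x) = b" using t x nx by (simp add: cs_def)
      qed
    qed auto
    have "x \<bullet> radial_dir x = 0" "p \<bullet> radial_dir x = sqrt (1 - b\<^sup>2)"
      using radial_dir(2,3)[OF x(1)] x(3) by (simp_all add: inner_commute)
    then have "gt x \<bullet> radial_dir x = sqrt (1 - b\<^sup>2) / \<beta> - 1 / \<beta> * sqrt (1 - b\<^sup>2)"
      unfolding gval using Neumann2[OF x(1,3)] f1_b by (simp add: inner_diff_left)
    then show "gt x \<bullet> radial_dir x = 0" by simp
    fix w assume w: "norm w = 1" "w \<bullet> x = 0" "w \<bullet> p = 0"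
    obtain \<gamma> \<epsilon> where g: "\<epsilon> > 0" "\<gamma> 0 = x" "\<And>t. \<bar>t\<bar> < \<epsilon> \<Longrightarrow> \<gamma> t \<in> Sg \<inter> Om1 \<and> \<gamma> t \<bullet> p = x \<bullet> p"
      "(\<gamma> has_vector_derivative sqrt (1 - (x \<bullet> p)\<^sup>2) *\<^sub>R w) (at 0)"
      by (rule level_curve[OF x(1) Om1_open x(2) w]) blast
    have "gt x \<bullet> (sqrt (1 - (x \<bullet> p)\<^sup>2) *\<^sub>R w) = 0"
    proof (rule derivative_along_zero_curve[OF der g(4,2,1)])
      fix t assume "\<bar>t\<bar> < \<epsilon>"
      then have t: "\<gamma> t \<in> Sg" "\<gamma> t \<in> Om1" "\<gamma> t \<bullet> p = b" using g(3) x(3) by auto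
      then have "norm (\<gamma> t) = 1" using Sg_bounds(1) by blast
      then show "\<gamma> t \<in> Wp \<and> Ht (\<gamma> t) = 0"
        using t by (intro in0) (auto simp: cone_over_def cs_def)
    qed
    then show "gt x \<bullet> w = 0" using b_sq(2) x(3) by simp
  qed
  then show ?thesis using gx by simp
qed

section \<open>Zero extension across the cone over Gamma_2\<close>

definition H0 :: "'a \<Rightarrow> real" where "H0 y = (if d y \<le> 0 then 0 else Ht y)"
definition g0 :: "'a \<Rightarrow> 'a" where "g0 y = (if d y \<le> 0 then 0 else gt y)"

lemma continuous_H0: "continuous_on W H0" "continuous_on W g0"
proof -
  have "continuous_on W d" using continuous_d continuous_on_subset by blast
  then show "continuous_on W H0" "continuous_on W g0"
    unfolding H0_def[abs_def] g0_def[abs_def]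
    by (auto intro!: continuous_on_cases_le continuous_Wp simp: Ht_boundary gt_boundary)
qed

lemma H0_pd:
  assumes y: "y \<in> W"
  shows "has_pd v H0 (g0 y \<bullet> v) y"
proof -
  consider "d y < 0" | "d y > 0" | "d y = 0" by linarith
  then show ?thesis
  proof cases
    case 1
    have "open {z. d z < 0}" by (intro open_Collect_less continuous_d continuous_on_const)
    then have "has_pd v H0 0 y"
      by (rule has_pd_cong_open[OF has_pd_const[of v 0]]) (use 1 in \<open>auto simp: H0_def\<close>)
    then show ?thesis using 1 by (simp add: g0_def)
  next
    case 2
    then have yO: "y \<in> Oc" using y O_iff_d by simp
    have "has_pd v H0 (Ht1 v y) y"
      by (rule has_pd_cong_open[OF Ht_pd[OF yO] open_O yO]) (auto simp: H0_def O_iff_d)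
    then show ?thesis using 2 Ht1_eq_gt[OF yO] by (simp add: g0_def)
  next
    \<comment> \<open>On the hypersurface the derivative from the side d \<ge> 0 is zero and
      \<open>H0\<close> vanishes on the other side, so both combine to a full derivative.\<close>
    case 3
    have der: "(Ht has_derivative (\<lambda>v. 0)) (at y within Wp)"
      using Ht_derivative_boundary[OF y 3] gt_boundary[OF y 3] by simp
    have "(H0 has_derivative (\<lambda>v. 0)) (at y within W)"
      unfolding has_derivative_within_alt
    proof (intro conjI allI impI)
      fix \<epsilon> :: real assume "\<epsilon> > 0"
      then obtain \<delta> where del: "\<delta> > 0"
        "\<And>z. z \<in> Wp \<Longrightarrow> norm (z - y) < \<delta> \<Longrightarrow> norm (Ht z - Ht y - 0) \<le> \<epsilon> * norm (z - y)"
        using der unfolding has_derivative_within_alt by blast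
      have "norm (H0 z - H0 y - 0) \<le> \<epsilon> * norm (z - y)" if "z \<in> W" "norm (z - y) < \<delta>" for z
        using del(2)[of z] that \<open>\<epsilon> > 0\<close> 3 Ht_boundary[OF y 3] by (auto simp: H0_def)
      then show "\<exists>\<delta>>0. \<forall>z\<in>W. norm (z - y) < \<delta> \<longrightarrow> norm (H0 z - H0 y - 0) \<le> \<epsilon> * norm (z - y)"
        using del(1) by blast
    qed simp
    then have "(H0 has_derivative (\<lambda>v. 0)) (at y)" using at_within_open[OF y open_W] by simp
    from has_derivative_imp_has_pd[OF this] show ?thesis using 3 by (simp add: g0_def)
  qed
qed

lemma H0_weakly_harmonic: "weakly_harmonic_on W H0"
proof (rule zero_extension_weakly_harmonic[where d=d and dg=dg and g=g0 and h=Ht2 and e=p])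
  have O_eq: "{y\<in>W. d y > 0} = Oc" using O_iff_d by blast
  show "continuous_on {y\<in>W. d y > 0} (Ht2 i)" if "i \<in> Basis" for i
    unfolding O_eq by (rule continuous_Ht2[OF that])
  show "has_pd i (\<lambda>z. g0 z \<bullet> i) (Ht2 i y) y" if "y \<in> W" "d y > 0" "i \<in> Basis" for y i
  proof -
    have yO: "y \<in> Oc" using that O_iff_d by simp
    show ?thesis
      by (rule has_pd_cong_open[OF Ht1_pd[OF yO that(3)] open_O yO])
        (auto simp: g0_def O_iff_d[symmetric] Ht1_eq_gt dest: O_iff_d[THEN iffD1])
  qed
qed (use open_W H0_pd continuous_H0 d_pd continuous_d continuous_dg d_shift Ht_harmonic O_iff_d in
    \<open>auto simp: g0_def\<close>)

theorem u_radial: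
  assumes x: "x \<in> Om"
  shows "u x + 1 = f (x \<bullet> p)"
proof -
  have nx: "norm x = 1" using x Om1_sub Sg_bounds(1) by (auto simp: Om_eq)
  then have xO: "x \<in> Oc" using x by (auto simp: cone_over_def)
  then have xW: "x \<in> W" "d x > 0" using O_iff_d by auto
  define V where "V = W \<inter> {y. d y < 0}"
  have "H0 x = 0"
  proof (rule weakly_harmonic_unique_continuation_connected[OF dim open_W connected_W H0_weakly_harmonic _ _ _ _ xW(1)])
    show "open V" unfolding V_def
      by (intro open_Int open_W open_Collect_less continuous_d continuous_on_const)
    show "V \<noteq> {}"
    proof -
      \<comment> \<open>Any level strictly between \<open>b\<close> and 1 serves: such a point lies
        in \<open>Om1\<close> by \<open>up\<close>, and \<open>d\<close> is negative there.\<close>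
      obtain z where z: "z \<in> Sg" "z \<bullet> p = (b + 1) / 2"
        using Sg_level_exists[of "(b + 1) / 2"] b by auto
      then have "z \<in> Om1" "norm z = 1" using up b Sg_bounds(1) by auto
      then have zW: "z \<in> W" "cs z = (b + 1) / 2" using z by (auto simp: cone_over_def cs_def)
      then have "\<not> d z \<ge> 0" unfolding d_pos_iff(3)[OF zW(1)] using b by simp
      then show ?thesis using zW by (auto simp: V_def)
    qed
    show "H0 y = 0" if "y \<in> V" for y using that by (simp add: V_def H0_def)
  qed (simp add: V_def)
  then have "Ht x = 0" using xW by (simp add: H0_def)
  then show ?thesis using nx by (simp add: Ht_def wt_def hext_def cs_def)
qed

end

subsection \<open>Rigidity\<close>

context overdetermined
begin

lemma G_radial:
  assumes x: "x \<in> Om"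
  shows "G x = f1 (x \<bullet> p) *\<^sub>R (p - (x \<bullet> p) *\<^sub>R x)"
proof -
  have nx: "norm x = 1" using x Om1_sub Sg_bounds(1) by (auto simp: Om_eq)
  then have xO: "x \<in> Oc" using x by (auto simp: cone_over_def)
  have Ht0: "Ht y = 0" if "y \<in> Oc" for y
    using u_radial[OF O_D(5)[OF that]] unfolding proj_p by (simp add: Ht_def wt_def hext_def)
  have "gt x \<bullet> v = 0" for v
  proof -
    have "has_pd v Ht 0 x"
      by (rule has_pd_cong_open[OF has_pd_const open_O xO]) (simp add: Ht0)
    then show ?thesis using Ht_pd[OF xO] has_pd_unique Ht1_eq_gt[OF xO] by metis
  qed
  then have "gt x = 0" by (metis inner_eq_zero_iff)
  then show ?thesis using nx u_radial[OF x] by (simp add: gt_def cs_def)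
qed

lemma tendsto_closure:
  assumes "x \<in> closure Om" "\<And>j. X j \<in> Om" "X \<longlonglongrightarrow> x"
  shows "(\<lambda>j. u (X j)) \<longlonglongrightarrow> u x" "(\<lambda>j. G (X j)) \<longlonglongrightarrow> G x"
proof -
  have "eventually (\<lambda>j. X j \<in> closure Om) sequentially"
    using assms(2) closure_subset[of Om] by (intro always_eventually) blast
  then show "(\<lambda>j. u (X j)) \<longlonglongrightarrow> u x" "(\<lambda>j. G (X j)) \<longlonglongrightarrow> G x"
    using C1 assms unfolding sph_C1_closure_def by (auto intro: continuous_on_tendsto_compose)
qed

text \<open>All points of Gamma_0 share one level by \<open>reaches_one_not_less\<close>;
  connectedness of the two sides of that level then determines \<open>Om1\<close>. The Neumann datum
  enters squared, which absorbs the sign of the normal on Gamma_0.\<close>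

theorem overdetermined_rigidity:
  assumes D0: "\<And>x. x \<in> bdry Om1 \<inter> Sg \<Longrightarrow> u x = 0"
    and N0: "\<And>x. x \<in> bdry Om1 \<inter> Sg \<Longrightarrow>
      \<exists>\<nu>. outward_normal Om x \<nu> \<and> (G x \<bullet> \<nu>)\<^sup>2 = (1 - \<beta>\<^sup>2) / \<beta>\<^sup>2"
  shows "bdry Om1 \<inter> Sg = {x\<in>Sg. x \<bullet> p = \<beta>}" and "Om = {x\<in>Sg. \<beta> < x \<bullet> p \<and> x \<bullet> p < b}"
    and "\<And>x. x \<in> Om \<Longrightarrow> u x + 1 = (x \<bullet> p) / \<beta>"
proof -
  \<comment> \<open>\<open>Om1\<close> contains all of the cone with x \<bullet> p \<ge> b, so a
    point of Gamma_0 lies strictly below \<open>b\<close> and is a limit of points of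
    \<open>Om\<close>.\<close>
  have approach: "\<exists>X. (\<forall>j. X j \<in> Om) \<and> X \<longlonglongrightarrow> x \<and> reaches_one_at (\<lambda>j. X j \<bullet> p) (x \<bullet> p) \<and> x \<in> bdry Om"
    if x: "x \<in> bdry Om1 \<inter> Sg" for x
  proof -
    have x': "x \<in> closure Om1" "x \<notin> Om1" "x \<in> Sg" using x by (auto simp: bdry_def)
    then have xb: "x \<bullet> p < b" using up by force
    have "open {z. z \<bullet> p < b}" by (intro open_Collect_less continuous_intros)
    from open_Int_closure_subset[OF this, of Om1]
    have "x \<in> closure ({z. z \<bullet> p < b} \<inter> Om1)" using x' xb by auto
    moreover have "{z. z \<bullet> p < b} \<inter> Om1 = Om" by (auto simp: Om_eq)
    ultimately have xc: "x \<in> closure Om" by simp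
    then obtain X where X: "\<And>j. X j \<in> Om" "X \<longlonglongrightarrow> x" by (auto simp: closure_sequential)
    have Xp: "0 < X j \<bullet> p \<and> X j \<bullet> p < b" for j using X(1)[of j] hemi by (auto simp: Om_eq)
    have Xl: "(\<lambda>j. X j \<bullet> p) \<longlonglongrightarrow> x \<bullet> p" by (intro tendsto_intros X)
    have "0 \<le> x \<bullet> p" by (rule tendsto_lowerbound[OF Xl]) (auto intro!: always_eventually less_imp_le simp: Xp)
    moreover have "(\<lambda>j. f (X j \<bullet> p)) \<longlonglongrightarrow> 1"
    proof -
      have "(\<lambda>j. u (X j)) \<longlonglongrightarrow> u x"
        by (rule tendsto_closure[OF xc X])
      from tendsto_add[OF this tendsto_const[of 1]] show ?thesis
        using u_radial[OF X(1)] D0[OF x] by simp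
    qed
    moreover have "x \<in> bdry Om" using xc x' by (auto simp: bdry_def Om_eq)
    ultimately show ?thesis using X Xp Xl xb by (intro exI[of _ X]) (auto simp: reaches_one_at_def)
  qed
  \<comment> \<open>Any level below the equator would do: this point is outside \<open>Om1\<close>
    and \<open>z2\<close> is inside, so the connected cone meets the boundary of
    \<open>Om1\<close>.\<close>
  obtain z1 where z1: "z1 \<in> Sg" "z1 \<bullet> p = - 1 / 2" using Sg_level_exists[of "- 1 / 2"] by auto
  have z1n: "z1 \<notin> Om1" using hemi[of z1] z1 b by (auto simp: Om_eq)
  obtain z2 where z2: "z2 \<in> Sg" "z2 \<bullet> p = b" using Sg_level_exists[of b] b by auto
  have z2O: "z2 \<in> Om1" using up z2 by auto
  have "bdry Om1 \<inter> Sg \<noteq> {}"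
  proof
    assume e: "bdry Om1 \<inter> Sg = {}"
    have "{x\<in>Sg. - 1 < x \<bullet> p} = Sg" using Sg_bounds by auto
    then have "connected Sg" using connected_upper[of "-1"] by simp
    then have "Sg \<subseteq> Om1"
      by (rule connected_subset_of_openin[OF _ subset_refl Om1_open]) (use e z2 z2O in auto)
    then show False using z1 z1n by auto
  qed
  then obtain x0 where x0: "x0 \<in> bdry Om1 \<inter> Sg" by blast
  define c where "c = x0 \<bullet> p"
  obtain X where X: "\<And>j. X j \<in> Om" "X \<longlonglongrightarrow> x0" "reaches_one_at (\<lambda>j. X j \<bullet> p) c"
    using approach[OF x0] unfolding c_def by blast
  have c: "0 \<le> c" "c < b" using X(3) by (auto simp: reaches_one_at_def)
  have level: "x \<bullet> p = c" if x: "x \<in> bdry Om1 \<inter> Sg" for x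
  proof -
    obtain Y where "reaches_one_at (\<lambda>j. Y j \<bullet> p) (x \<bullet> p)" using approach[OF x] by blast
    then show ?thesis using reaches_one_not_less X(3) by (metis linorder_neqE_linordered_idom)
  qed
  have T1: "{x\<in>Sg. c < x \<bullet> p} \<subseteq> Om1"
  proof (rule connected_subset_of_openin[OF _ _ Om1_open])
    show "connected {x\<in>Sg. c < x \<bullet> p}" by (rule connected_upper) (use c b in auto)
    show "{x\<in>Sg. c < x \<bullet> p} \<inter> bdry Om1 = {}" using level by force
    show "{x\<in>Sg. c < x \<bullet> p} \<inter> Om1 \<noteq> {}" using z2 z2O c by auto
  qed auto
  have T2: "{x\<in>Sg. x \<bullet> p < c} \<inter> Om1 = {}"
  proof (rule ccontr)
    assume ne: "{x\<in>Sg. x \<bullet> p < c} \<inter> Om1 \<noteq> {}"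
    have "{x\<in>Sg. x \<bullet> p < c} \<subseteq> Om1"
    proof (rule connected_subset_of_openin[OF _ _ Om1_open _ ne])
      show "connected {x\<in>Sg. x \<bullet> p < c}" by (rule connected_lower) (use c b in auto)
      show "{x\<in>Sg. x \<bullet> p < c} \<inter> bdry Om1 = {}" using level by force
    qed auto
    then show False using z1 z1n c by auto
  qed
  \<comment> \<open>By openness, a point of \<open>Om1\<close> at level \<open>c\<close> would have
    points of \<open>Om1\<close> below it, which \<open>T2\<close> excludes.\<close>
  have nolevel: "x \<bullet> p \<noteq> c" if x: "x \<in> Om1" for x
  proof
    assume xc: "x \<bullet> p = c"
    have "x \<in> closure {y\<in>Om1. y \<bullet> p < x \<bullet> p}"
      by (rule closure_lower_openin[OF Om1_open x]) (use x Om1_sub in auto)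
    then have "{y\<in>Om1. y \<bullet> p < x \<bullet> p} \<noteq> {}" by (metis closure_empty empty_iff)
    then show False using T2 xc Om1_sub by auto
  qed
  have Om1_eq: "Om1 = {x\<in>Sg. c < x \<bullet> p}"
    using T1 T2 nolevel Om1_sub by (auto simp: not_less le_less)
  have G0: "bdry Om1 \<inter> Sg = {x\<in>Sg. x \<bullet> p = c}"
  proof -
    have "bdry Om1 \<inter> Sg = (closure Om1 \<inter> Sg) - Om1" by (auto simp: bdry_def)
    also have "closure Om1 \<inter> Sg = {x\<in>Sg. c \<le> x \<bullet> p}" unfolding Om1_eq by (rule closure_upper_Int)
    finally show ?thesis unfolding Om1_eq by auto
  qed
  have Om': "Om = {x\<in>Sg. c < x \<bullet> p \<and> x \<bullet> p < b}" unfolding Om_eq Om1_eq by auto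
  have xS: "x0 \<in> Sg" using x0 by simp
  have B: "{y\<in>Sg. y \<bullet> p = x0 \<bullet> p} \<subseteq> bdry Om" using approach G0 by (auto simp: c_def)
  obtain \<nu> where nu: "outward_normal Om x0 \<nu>" "(G x0 \<bullet> \<nu>)\<^sup>2 = (1 - \<beta>\<^sup>2) / \<beta>\<^sup>2" using N0[OF x0] by blast
  have nu': "\<nu> = radial_dir x0 \<or> \<nu> = - radial_dir x0" by (rule normal_eq[OF xS B nu(1)])
  \<comment> \<open>Component of the radial field at \<open>X j\<close> along the fixed normal at
    the limit point; its square tends to 1 - c^2 > 0, so it can be divided out to recover the
    P-function.\<close>
  define \<mu> where "\<mu> j = (p - (X j \<bullet> p) *\<^sub>R X j) \<bullet> \<nu>" for j
  have "((p - (x0 \<bullet> p) *\<^sub>R x0) \<bullet> \<nu>)\<^sup>2 = 1 - c\<^sup>2"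
  proof -
    have "p - (x0 \<bullet> p) *\<^sub>R x0 = sqrt (1 - c\<^sup>2) *\<^sub>R radial_dir x0"
      using radial_dir(4)[OF xS] unfolding c_def by (simp add: algebra_simps)
    moreover have "radial_dir x0 \<bullet> radial_dir x0 = 1" using radial_dir(1)[OF xS] by (simp add: norm_eq_1)
    ultimately show ?thesis using nu' radial_dir(5)[OF xS] unfolding c_def by auto
  qed
  moreover have "(\<lambda>j. (\<mu> j)\<^sup>2) \<longlonglongrightarrow> ((p - (x0 \<bullet> p) *\<^sub>R x0) \<bullet> \<nu>)\<^sup>2"
    unfolding \<mu>_def by (intro tendsto_intros X)
  ultimately have mu: "(\<lambda>j. (\<mu> j)\<^sup>2) \<longlonglongrightarrow> 1 - c\<^sup>2" by simp
  have c1: "1 - c\<^sup>2 > 0" using radial_dir(5)[OF xS] by (simp add: c_def)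
  have "(\<lambda>j. G (X j)) \<longlonglongrightarrow> G x0"
  proof -
    have "x0 \<in> closure Om" using X(1,2) by (auto simp: closure_sequential)
    then show ?thesis by (rule tendsto_closure[OF _ X(1,2)])
  qed
  then have "(\<lambda>j. (G (X j) \<bullet> \<nu>)\<^sup>2) \<longlonglongrightarrow> (1 - \<beta>\<^sup>2) / \<beta>\<^sup>2"
    unfolding nu(2)[symmetric] by (intro tendsto_intros)
  moreover have "G (X j) \<bullet> \<nu> = f1 (X j \<bullet> p) * \<mu> j" for j
    unfolding G_radial[OF X(1)] \<mu>_def by simp
  ultimately have lim1: "(\<lambda>j. (f1 (X j \<bullet> p) * \<mu> j)\<^sup>2) \<longlonglongrightarrow> (1 - \<beta>\<^sup>2) / \<beta>\<^sup>2" by simp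
  have Xl: "(\<lambda>j. X j \<bullet> p) \<longlonglongrightarrow> c" using X(3) by (simp add: reaches_one_at_def)
  have "(\<lambda>j. (f1 (X j \<bullet> p) * \<mu> j)\<^sup>2 * (1 - (X j \<bullet> p)\<^sup>2) / (\<mu> j)\<^sup>2)
      \<longlonglongrightarrow> (1 - \<beta>\<^sup>2) / \<beta>\<^sup>2 * (1 - c\<^sup>2) / (1 - c\<^sup>2)"
    by (intro tendsto_intros lim1 mu Xl) (use c1 in simp)
  moreover have "eventually (\<lambda>j. (f1 (X j \<bullet> p) * \<mu> j)\<^sup>2 * (1 - (X j \<bullet> p)\<^sup>2) / (\<mu> j)\<^sup>2
      = (1 - (X j \<bullet> p)\<^sup>2) * (f1 (X j \<bullet> p))\<^sup>2) sequentially"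
    using order_tendstoD(1)[OF mu c1]
  proof eventually_elim
    case (elim j)
    then show ?case by (simp add: power_mult_distrib)
  qed
  ultimately have "(\<lambda>j. (1 - (X j \<bullet> p)\<^sup>2) * (f1 (X j \<bullet> p))\<^sup>2)
      \<longlonglongrightarrow> (1 - \<beta>\<^sup>2) / \<beta>\<^sup>2 * (1 - c\<^sup>2) / (1 - c\<^sup>2)"
    by (rule Lim_transform_eventually)
  then have "(\<lambda>j. (1 - (X j \<bullet> p)\<^sup>2) * (f1 (X j \<bullet> p))\<^sup>2) \<longlonglongrightarrow> (1 - \<beta>\<^sup>2) / \<beta>\<^sup>2" using c1 by simp
  from rigidity[OF X(3) this] have r: "c = \<beta>" "\<And>c. f c = c / \<beta>" using X(1) Om' by auto
  show "bdry Om1 \<inter> Sg = {x\<in>Sg. x \<bullet> p = \<beta>}" using G0 r by simp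
  show "Om = {x\<in>Sg. \<beta> < x \<bullet> p \<and> x \<bullet> p < b}" using Om' r by simp
  show "u x + 1 = (x \<bullet> p) / \<beta>" if "x \<in> Om" for x using u_radial[OF that] r by simp
qed

end

section \<open>Passage between geodesic distances and cosines\<close>

theorem theorem3:
  fixes p :: "real^'n" and Sg Om1 Om2 Om G0 G1 G2 :: "(real^'n) set"
    and u :: "real^'n \<Rightarrow> real" and G :: "real^'n \<Rightarrow> real^'n" and R R1 a :: real
  defines "Om2 \<equiv> sgball p R \<inter> Sg"
      and "Om \<equiv> Om1 - closure Om2"
      and "G0 \<equiv> bdry Om1 \<inter> Sg"
      and "G2 \<equiv> bdry Om2 \<inter> Sg"
      and "G1 \<equiv> bdry Om - (closure G0 \<union> closure G2)"
  assumes n: "CARD('n) \<ge> 3"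
      and p: "p \<in> sphere 0 1"
      and cone: "convex_sph_cone p Sg"
      and radii: "0 < R" "R < R1" "R1 < pi / 2"
      and ann: "annular_sector p Sg Om1 Om2"
      and hemi: "Om \<subseteq> hemisphere p"
      and reg: "sph_C2 Om u" "sph_C1_closure Om u G" "sph_W1inf Om u" "sph_W22 Om u"
      and apos: "a > 0"
      and eq: "\<forall>x\<in>Om. slap u x = - real (CARD('n) - 1) * u x - real (CARD('n) - 1)"
      and bc0: "\<forall>x\<in>G0. u x = 0 \<and> (\<exists>\<nu>. outward_normal Om x \<nu> \<and> G x \<bullet> \<nu> = - sin R1 / cos R1)"
      and bc1: "\<forall>x\<in>G1. \<exists>\<nu>. outward_normal Om x \<nu> \<and> G x \<bullet> \<nu> = 0"
      and bc2: "\<forall>x\<in>G2. u x = a \<and> (\<exists>\<nu>. outward_normal Om x \<nu> \<and> G x \<bullet> \<nu> = sin R / cos R1)"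
  shows "G0 = {x \<in> sphere 0 1. sgdist x p = R1} \<inter> Sg \<and>
         Om = {x \<in> Sg. R < sgdist x p \<and> sgdist x p < R1} \<and>
         (\<forall>x\<in>Om. u x = (cos (sgdist x p) - cos R1) / cos R1)"
proof -
  obtain \<omega> where \<omega>: "\<omega> \<subseteq> {\<theta>. norm \<theta> = 1 \<and> \<theta> \<bullet> p = 0}"
    "openin (top_of_set {\<theta>. norm \<theta> = 1 \<and> \<theta> \<bullet> p = 0}) \<omega>" "connected \<omega>" "\<omega> \<noteq> {}" "Sg = sph_cone p \<omega>"
    using cone by (auto simp: convex_sph_cone_def is_open_cone_def)
  interpret spherical_cone p \<omega> Sg
    by unfold_locales (use p \<omega> in auto)
  define b \<beta> where "b = cos R" and "\<beta> = cos R1"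
  have b: "0 < b" "b < 1" and \<beta>: "0 < \<beta>" "\<beta> < b"
    using radii cos_monotone_0_pi[of 0 R] cos_monotone_0_pi[of R R1] cos_gt_zero[of R] cos_gt_zero[of R1]
    by (auto simp: b_def \<beta>_def)
  have Sg1: "norm x = 1" "\<bar>x \<bullet> p\<bar> \<le> 1" "cos (sgdist x p) = x \<bullet> p" "0 \<le> sgdist x p" "sgdist x p \<le> pi" if "x \<in> Sg" for x
    using Sg_bounds[OF that] arccos_bounded[of "x \<bullet> p"] by (auto simp: sgdist_def)
  have less_iff: "sgdist x p < t \<longleftrightarrow> cos t < x \<bullet> p" if "x \<in> Sg" "0 \<le> t" "t \<le> pi" for x t
    using Sg1[OF that(1)] that cos_mono_less_eq[of t "sgdist x p"] by auto
  have greater_iff: "t < sgdist x p \<longleftrightarrow> x \<bullet> p < cos t" if "x \<in> Sg" "0 \<le> t" "t \<le> pi" for x t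
    using Sg1[OF that(1)] that cos_mono_less_eq[of "sgdist x p" t] by auto
  have eq_iff: "sgdist x p = t \<longleftrightarrow> x \<bullet> p = cos t" if "x \<in> Sg" "0 \<le> t" "t \<le> pi" for x t
    using less_iff[OF that] greater_iff[OF that] by linarith
  have Om2: "Om2 = {x\<in>Sg. b < x \<bullet> p}"
    unfolding Om2_def sgball_def b_def using less_iff[of _ R] radii Sg1(1) by auto
  have clOm2: "closure Om2 \<inter> Sg = {x\<in>Sg. b \<le> x \<bullet> p}" unfolding Om2 by (rule closure_upper_Int)
  have Om1: "openin (top_of_set (sphere 0 1)) Om1" "connected Om1" "Om1 \<subseteq> Sg" "closure Om2 \<inter> Sg \<subseteq> Om1"
    using ann by (auto simp: annular_sector_def Let_def)
  have Om: "Om = {x\<in>Om1. x \<bullet> p < b}"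
    unfolding Om_def using clOm2 Om1(3) by (auto simp: not_le[symmetric])
  have G2: "G2 = {x\<in>Sg. x \<bullet> p = b}"
  proof -
    have "G2 = {x\<in>Sg. b \<le> x \<bullet> p} - Om2" unfolding clOm2[symmetric] by (auto simp: G2_def bdry_def)
    then show ?thesis by (auto simp: Om2)
  qed
  have hemi': "0 < x \<bullet> p" if "x \<in> Om" for x
  proof -
    have "x \<in> Sg" "sgdist x p < pi / 2"
      using that hemi Om Om1(3) by (auto simp: hemisphere_def sgball_def)
    then show ?thesis using less_iff[of x "pi / 2"] by simp
  qed
  \<comment> \<open>As \<open>Om1\<close> is open, points of \<open>Om\<close> lie just below every
    point of Gamma_2.\<close>
  have closOm: "{x\<in>Sg. x \<bullet> p = b} \<subseteq> bdry Om"
  proof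
    fix x assume x: "x \<in> {x\<in>Sg. x \<bullet> p = b}"
    then have "x \<in> Om1" using clOm2 Om1(4) by auto
    from closure_lower_openin[OF Om1(1) this] x show "x \<in> bdry Om"
      unfolding bdry_def Om by simp
  qed
  have sinR: "sin R = sqrt (1 - b\<^sup>2)" "sin R1 = sqrt (1 - \<beta>\<^sup>2)"
    unfolding b_def \<beta>_def using radii by (auto intro!: sin_cos_sqrt sin_ge_zero)
  define nn where "nn = real CARD('n) - 1"
  note card = n
  have nn: "nn \<ge> 1" "real (CARD('n) - 1) = nn" using n by (auto simp: nn_def)
  have A: "(a + 1) / b > 0" using apos b by simp
  obtain C k where "radial_ode nn b \<beta> ((a + 1) / b) C k"
    using radial_ode_exists[OF nn(1) b \<beta> A] by blast
  then interpret radial_ode nn b \<beta> "(a + 1) / b" C k .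
  interpret overdetermined p \<omega> Sg nn b \<beta> "(a + 1) / b" C k Om1 Om u G
  proof unfold_locales
    show "3 \<le> DIM(real^'n)" "nn = real DIM(real^'n) - 1" using card by (simp_all add: nn_def)
    show "openin (top_of_set (sphere 0 1)) Om1" "connected Om1" "Om1 \<subseteq> Sg" by fact+
    show "{x\<in>Sg. b \<le> x \<bullet> p} \<subseteq> Om1" using clOm2 Om1(4) by simp
    show "Om = {x\<in>Om1. x \<bullet> p < b}" by (rule Om)
    show "0 < x \<bullet> p" if "x \<in> Om" for x by (rule hemi'[OF that])
    show "sph_C2 Om u" "sph_C1_closure Om u G" by fact+
    show "slap u x = - nn * u x - nn" if "x \<in> Om" for x using eq that unfolding nn(2) by blast
    fix x assume x: "x \<in> Sg" "x \<bullet> p = b"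
    then have xG: "x \<in> G2" by (simp add: G2)
    show "u x + 1 = b * ((a + 1) / b)" using bc2 xG b by simp
    obtain \<nu> where nu: "outward_normal Om x \<nu>" "G x \<bullet> \<nu> = sin R / cos R1" using bc2 xG by blast
    \<comment> \<open>\<open>Om\<close> lies below the level \<open>b\<close>, so its outward normal
      on Gamma_2 points towards \<open>p\<close>.\<close>
    have "\<nu> = radial_dir x"
      by (rule normal_eq_inner[OF x(1) _ nu(1)]) (use closOm x Om in auto)
    then show "G x \<bullet> radial_dir x = sqrt (1 - b\<^sup>2) / \<beta>" using nu(2) sinR by (simp add: \<beta>_def)
  qed
  have sq: "(- sin R1 / cos R1)\<^sup>2 = (1 - \<beta>\<^sup>2) / \<beta>\<^sup>2"
    unfolding sin_squared_eq \<beta>_def by (simp add: power_divide sin_squared_eq)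
  have D0: "u x = 0" if "x \<in> bdry Om1 \<inter> Sg" for x using bc0 that by (simp add: G0_def)
  have N0: "\<exists>\<nu>. outward_normal Om x \<nu> \<and> (G x \<bullet> \<nu>)\<^sup>2 = (1 - \<beta>\<^sup>2) / \<beta>\<^sup>2" if "x \<in> bdry Om1 \<inter> Sg" for x
    using bc0 that sq unfolding G0_def by metis
  have rigid1: "bdry Om1 \<inter> Sg = {x\<in>Sg. x \<bullet> p = \<beta>}" by (rule overdetermined_rigidity(1)) (use D0 N0 in blast)+
  have rigid2: "Om = {x\<in>Sg. \<beta> < x \<bullet> p \<and> x \<bullet> p < b}" by (rule overdetermined_rigidity(2)) (use D0 N0 in blast)+
  have rigid3: "u x + 1 = (x \<bullet> p) / \<beta>" if "x \<in> Om" for x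
    by (rule overdetermined_rigidity(3)) (use D0 N0 that in blast)+
  have "G0 = {x \<in> sphere 0 1. sgdist x p = R1} \<inter> Sg"
    unfolding G0_def using rigid1 eq_iff[of _ R1] radii Sg1(1) by (auto simp: \<beta>_def)
  moreover have "Om = {x \<in> Sg. R < sgdist x p \<and> sgdist x p < R1}"
    using rigid2 greater_iff[of _ R] less_iff[of _ R1] radii by (auto simp: \<beta>_def b_def)
  moreover have "u x = (cos (sgdist x p) - cos R1) / cos R1" if "x \<in> Om" for x
  proof -
    have "x \<in> Sg" using that Om Om1(3) by auto
    then show ?thesis using rigid3[OF that] Sg1(3) \<beta> by (simp add: \<beta>_def field_simps)
  qed
  ultimately show ?thesis by blast
qed

end
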